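(* The network satisfaction problem $\mathrm{NSP}(24_{65})$ is in $\mathbf{P}$.
   Context: A relation algebra is an algebra $\mathbf{A}=(A;\cup,\bar{\ },0,1,\mathrm{Id},\breve{\ },\circ)$ such that, with $x\cap y:=\overline{(\bar x\cup\bar y)}$, the structure $(A;\cup,\cap,\bar{\ },0,1)$ is a Boolean algebra, $\circ$ is associative, and for all $a,b,c\in A$: $(a\cup b)\circ c=(a\circ c)\cup(b\circ c)$; $a\circ\mathrm{Id}=a$; $\breve{\breve a}=a$; $(a\cup b)\breve{\ }=\breve a\cup\breve b$; $(a\circ b)\breve{\ }=\breve b\circ\breve a$; $\bar b\cup(\breve a\circ\overline{(a\circ b)})=\bar b$. Write $a\le b$ if $a\cap b=a$. An atom is a minimal element of $A\setminus\{0\}$ with respect to $\le$. In a finite relation algebra, $\circ$ and $\breve{\ }$ are determined by their values on atoms. $24_{65}$ is the finite relation algebra with exactly four atoms $\mathrm{Id},a,b,c$, all satisfying $\breve x=x$, where $\mathrm{Id}\circ x=x\circ\mathrm{Id}=x$, where for $x,y\in\{a,b,c\}$ we have $\mathrm{Id}\le x\circ y$ iff $x=y$, and where for $x,y,z\in\{a,b,c\}$ we have $z\le x\circ y$ iff $x,y,z$ are not pairwise distinct. A representation of $\mathbf{A}$ is a relational structure $\mathfrak{B}$ with domain $B$ and a binary relation $a^{\mathfrak{B}}\subseteq B^2$ for each $a\in A$ such that for all $a,b\in A$: $0^{\mathfrak{B}}=\varnothing$; $1^{\mathfrak{B}}=\bigcup_{a\in A}a^{\mathfrak{B}}$; $\mathrm{Id}^{\mathfrak{B}}=\{(u,u)\mid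 u\in B\}$; $(\bar a)^{\mathfrak{B}}=1^{\mathfrak{B}}\setminus a^{\mathfrak{B}}$; $(\breve a)^{\mathfrak{B}}=\{(u,v)\mid(v,u)\in a^{\mathfrak{B}}\}$; $(a\cup b)^{\mathfrak{B}}=a^{\mathfrak{B}}\cup b^{\mathfrak{B}}$; $(a\circ b)^{\mathfrak{B}}=a^{\mathfrak{B}}\circ b^{\mathfrak{B}}$ (the usual composition of binary relations). An $\mathbf{A}$-network $(V,f)$ is a finite set $V$ together with a function $f\colon V^2\to A$. $\mathrm{NSP}(\mathbf{A})$ is the computational problem: given an $\mathbf{A}$-network $(V,f)$, decide whether there exist a representation $\mathfrak{B}$ of $\mathbf{A}$ and a function $s\colon V\to B$ with $(s(x),s(y))\in f(x,y)^{\mathfrak{B}}$ for all $x,y\in V$. *)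

theory Defs
  imports "HOL-Computational_Algebra.Polynomial"
begin

section \<open>Relation algebras, representations and networks\<close>

locale relation_algebra =
  fixes Idt :: "'a::boolean_algebra"
    and conv :: "'a \<Rightarrow> 'a"
    and comp :: "'a \<Rightarrow> 'a \<Rightarrow> 'a"
  assumes comp_assoc: "comp (comp x y) z = comp x (comp y z)"
    and comp_sup_left: "comp (sup x y) z = sup (comp x z) (comp y z)"
    and comp_Idt: "comp x Idt = x"
    and conv_conv: "conv (conv x) = x"
    and conv_sup: "conv (sup x y) = sup (conv x) (conv y)"
    and conv_comp: "conv (comp x y) = comp (conv y) (conv x)"
    and conv_residual: "sup (- y) (comp (conv x) (- comp x y)) = - y"
begin

text \<open>The structure has domain \<open>B\<close>, and \<open>R x\<close> is the interpretation of the element \<open>x\<close>.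
  The interpretation of \<open>top\<close> is not required to be all of \<open>B \<times> B\<close>.\<close>

definition representation :: "'u set \<Rightarrow> ('a \<Rightarrow> ('u \<times> 'u) set) \<Rightarrow> bool" where
  "representation B R \<longleftrightarrow>
     (\<forall>x. R x \<subseteq> B \<times> B) \<and>
     R bot = {} \<and>
     R top = (\<Union>x. R x) \<and>
     R Idt = {(u, u) | u. u \<in> B} \<and>
     (\<forall>x. R (- x) = R top - R x) \<and>
     (\<forall>x. R (conv x) = {(u, v). (v, u) \<in> R x}) \<and>
     (\<forall>x y. R (sup x y) = R x \<union> R y) \<and>
     (\<forall>x y. R (comp x y) = R x O R y)"

text \<open>A network \<open>(V, f)\<close> is satisfiable over \<open>'u\<close> if it is satisfied by a representation
  whose domain is some set of elements of the type \<open>'u\<close>.\<close>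

definition satisfiable :: "'u itself \<Rightarrow> 'v set \<Rightarrow> ('v \<Rightarrow> 'v \<Rightarrow> 'a) \<Rightarrow> bool" where
  "satisfiable U V f \<longleftrightarrow>
     (\<exists>(B :: 'u set) R s. representation B R \<and> s ` V \<subseteq> B \<and>
        (\<forall>x\<in>V. \<forall>y\<in>V. (s x, s y) \<in> R (f x y)))"

end


section \<open>The relation algebra $24_{65}$\<close>

datatype atom = Idt | At_a | At_b | At_c

text \<open>\<open>atom_le_comp z x y\<close> means $z \le x \circ y$ for atoms.\<close>

definition atom_le_comp :: "atom \<Rightarrow> atom \<Rightarrow> atom \<Rightarrow> bool" where
  "atom_le_comp z x y \<longleftrightarrow>
     (if x = Idt then z = y
      else if y = Idt then z = x
      else if z = Idt then x = y
      else \<not> (x \<noteq> y \<and> y \<noteq> z \<and> x \<noteq> z))"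

text \<open>Elements of the algebra are sets of atoms.\<close>

definition Idt_24_65 :: "atom set" where
  "Idt_24_65 = {Idt}"

definition conv_24_65 :: "atom set \<Rightarrow> atom set" where
  "conv_24_65 X = X"

definition comp_24_65 :: "atom set \<Rightarrow> atom set \<Rightarrow> atom set" where
  "comp_24_65 X Y = {z. \<exists>x\<in>X. \<exists>y\<in>Y. atom_le_comp z x y}"

lemma singleton_le_comp_24_65: "{z} \<le> comp_24_65 {x} {y} \<longleftrightarrow> atom_le_comp z x y"
  by (simp add: comp_24_65_def)

lemma atom_le_comp_assoc:
  "(\<exists>u. atom_le_comp u x y \<and> atom_le_comp w u z) \<longleftrightarrow>
   (\<exists>u. atom_le_comp u y z \<and> atom_le_comp w x u)"
proof -
  have ex: "(\<exists>u. P u) \<longleftrightarrow> P Idt \<or> P At_a \<or> P At_b \<or> P At_c" for P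
    by (metis atom.exhaust)
  show ?thesis
    unfolding ex by (cases x; cases y; cases z; cases w; simp add: atom_le_comp_def)
qed

lemma atom_le_comp_commute: "atom_le_comp z x y \<longleftrightarrow> atom_le_comp z y x"
  by (auto simp: atom_le_comp_def)

lemma atom_le_comp_cycle: "atom_le_comp z x y \<longleftrightarrow> atom_le_comp y x z"
  by (cases x; cases y; cases z; simp add: atom_le_comp_def)

interpretation ra_24_65: relation_algebra Idt_24_65 conv_24_65 comp_24_65
proof
  fix X Y Z :: "atom set"
  have "w \<in> comp_24_65 (comp_24_65 X Y) Z \<longleftrightarrow>
      (\<exists>x\<in>X. \<exists>y\<in>Y. \<exists>z\<in>Z. \<exists>u. atom_le_comp u x y \<and> atom_le_comp w u z)" for w
    by (auto simp: comp_24_65_def)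
  moreover have "w \<in> comp_24_65 X (comp_24_65 Y Z) \<longleftrightarrow>
      (\<exists>x\<in>X. \<exists>y\<in>Y. \<exists>z\<in>Z. \<exists>u. atom_le_comp u y z \<and> atom_le_comp w x u)" for w
    by (auto simp: comp_24_65_def)
  ultimately show "comp_24_65 (comp_24_65 X Y) Z = comp_24_65 X (comp_24_65 Y Z)"
    by (simp add: set_eq_iff atom_le_comp_assoc)
  show "comp_24_65 (sup X Y) Z = sup (comp_24_65 X Z) (comp_24_65 Y Z)"
    by (auto simp: comp_24_65_def)
  show "comp_24_65 X Idt_24_65 = X"
    by (auto simp: comp_24_65_def Idt_24_65_def atom_le_comp_def)
  show "conv_24_65 (comp_24_65 X Y) = comp_24_65 (conv_24_65 Y) (conv_24_65 X)"
    unfolding comp_24_65_def conv_24_65_def using atom_le_comp_commute by blast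
  show "sup (- Y) (comp_24_65 (conv_24_65 X) (- comp_24_65 X Y)) = - Y"
    unfolding comp_24_65_def conv_24_65_def using atom_le_comp_cycle by blast
qed (simp_all add: conv_24_65_def)


section \<open>Deterministic multi-tape Turing machines and the class P\<close>

datatype move = Left | Stay | Right

text \<open>States are the numbers below \<open>num_states\<close>, with initial state \<open>0\<close>; tape symbols are the
  numbers below \<open>num_symbols\<close>: \<open>0\<close> is the blank, and \<open>1\<close> and \<open>2\<close> are the input
  symbols for the bits \<open>False\<close> and \<open>True\<close>.\<close>

record tm =
  num_tapes :: nat
  num_states :: nat
  num_symbols :: nat
  accept_state :: nat
  reject_state :: nat
  delta :: "nat \<Rightarrow> nat list \<Rightarrow> nat \<times> (nat \<times> move) list"

text \<open>Only the values of \<open>delta\<close> on the finite domain of states and tuples of tape symbols matter.\<close>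

definition wf_tm :: "tm \<Rightarrow> bool" where
  "wf_tm M \<longleftrightarrow>
     1 \<le> num_tapes M \<and> 3 \<le> num_symbols M \<and>
     accept_state M < num_states M \<and> reject_state M < num_states M \<and>
     accept_state M \<noteq> reject_state M \<and>
     (\<forall>q ss. q < num_states M \<longrightarrow> length ss = num_tapes M \<longrightarrow> set ss \<subseteq> {..<num_symbols M} \<longrightarrow>
        (case delta M q ss of (q', acts) \<Rightarrow>
           q' < num_states M \<and> length acts = num_tapes M \<and>
           fst ` set acts \<subseteq> {..<num_symbols M}))"

text \<open>Tapes are infinite in both directions and come with the position of the head.\<close>

type_synonym tape = "(int \<Rightarrow> nat) \<times> int"
type_synonym config = "nat \<times> tape list"

definition read_tape :: "tape \<Rightarrow> nat" where
  "read_tape t = fst t (snd t)"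

fun act :: "nat \<times> move \<Rightarrow> tape \<Rightarrow> tape" where
  "act (s, m) (t, p) =
     (t(p := s), case m of Left \<Rightarrow> p - 1 | Stay \<Rightarrow> p | Right \<Rightarrow> p + 1)"

fun step :: "tm \<Rightarrow> config \<Rightarrow> config" where
  "step M (q, ts) =
     (if q = accept_state M \<or> q = reject_state M then (q, ts)
      else case delta M q (map read_tape ts) of (q', acts) \<Rightarrow> (q', map2 act acts ts))"

definition input_tape :: "bool list \<Rightarrow> tape" where
  "input_tape w =
     (\<lambda>i. if 0 \<le> i \<and> i < int (length w) then (if w ! nat i then 2 else 1) else 0, 0)"

definition init_config :: "tm \<Rightarrow> bool list \<Rightarrow> config" where
  "init_config M w = (0, input_tape w # replicate (num_tapes M - 1) (\<lambda>_. 0, 0))"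

definition decides_in_time :: "tm \<Rightarrow> bool list set \<Rightarrow> (nat \<Rightarrow> nat) \<Rightarrow> bool" where
  "decides_in_time M L T \<longleftrightarrow>
     (\<forall>w. \<exists>t \<le> T (length w).
        fst ((step M ^^ t) (init_config M w)) =
          (if w \<in> L then accept_state M else reject_state M))"

definition in_P :: "bool list set \<Rightarrow> bool" where
  "in_P L \<longleftrightarrow> (\<exists>M (p :: nat poly). wf_tm M \<and> decides_in_time M L (poly p))"


section \<open>The network satisfaction problem of $24_{65}$ as a language\<close>

text \<open>A network with \<open>n\<close> vertices, which we take to be \<open>0, \<dots>, n - 1\<close>, is written as \<open>n\<close> in
  unary, followed by the \<open>n \<times> n\<close> matrix of labels in row-major order.\<close>

definition encode_label :: "atom set \<Rightarrow> bool list" where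
  "encode_label X = [Idt \<in> X, At_a \<in> X, At_b \<in> X, At_c \<in> X]"

definition encode_network :: "nat \<Rightarrow> (nat \<Rightarrow> nat \<Rightarrow> atom set) \<Rightarrow> bool list" where
  "encode_network n f =
     replicate n True @ False #
     concat (map (\<lambda>i. concat (map (\<lambda>j. encode_label (f i j)) [0..<n])) [0..<n])"

definition NSP_24_65 :: "'u itself \<Rightarrow> bool list set" where
  "NSP_24_65 U = {encode_network n f | n f. ra_24_65.satisfiable U {..<n} f}"

end

theory Submission
  imports Defs "HOL-Library.Countable_Set"
begin

text \<open>A network is satisfiable iff its vertices admit a choice of atoms from the labels that, up to
  identification of vertices along \<open>Idt\<close>, is an edge colouring without rainbow triangles. Indeed
  such a colouring can be placed at one level of an ultrametric space all of whose other levels carry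
  a single colour, and if each colour occurs above and below every level, this is a representation.

  By a theorem of Gallai, a colouring without rainbow triangles of at least two vertices has a colour
  \<open>c\<close> whose graph is disconnected, and all edges between two components of \<open>c\<close> have the same colour.
  Conversely, arbitrary choices of a colour other than \<open>c\<close> for any two classes of a partition never
  produce a rainbow triangle. There is a finest partition that allows such choices: start with
  singletons and merge two classes as long as the labels between them have no colour other than \<open>c\<close> in
  common. So it is safe to replace a class by its finest partition for any \<open>c\<close>, and to proceed with
  the classes obtained. The network is satisfiable iff, when no class can be split any more, \<open>Idt\<close> is
  in all labels within the classes.

  All steps of this algorithm are sweeps over an \<open>n \<times> n\<close> matrix which combine the entries \<open>(x, z)\<close>
  and \<open>(y, z)\<close> into the entry \<open>(x, y)\<close>. On a Turing machine with several copies of the matrix such a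
  sweep needs no random access: all heads move by one cell at a time.\<close>

section \<open>While programs on tapes\<close>

text \<open>Two facts make the greedy refinement correct. At every stage the current classes have a
  colouring that respects all labels between them, whether or not the network is satisfiable: this
  is trivial for the single class at the start and survives each refinement. So a run that ends with
  \<open>Idt\<close> in all labels inside the classes has found a solution in which each class is
  contracted to a point. Conversely, a given solution need not fit the partitions chosen on the way.
  It is consulted only when no class splits any more: if a label inside a class lacked
  \<open>Idt\<close>, Gallai's theorem would split that class into components of the solution, and
  the finest partition would have to refine this splitting. Whether two classes still share a colour
  depends on all pairs of vertices between them. Therefore the atoms forbidden between classes are
  propagated together with the merged pairs, and both are computed as one least fixed point. The
  result is used only through two properties: it allows the choices, and it lies inside every
  partition that does.\<close>

datatype cmd =
    Do "(nat \<Rightarrow> nat) \<Rightarrow> nat \<Rightarrow> nat \<times> move"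
  | Seq cmd cmd (infixr ";;" 60)
  | While "(nat \<Rightarrow> nat) \<Rightarrow> bool" cmd

type_synonym store = "nat \<Rightarrow> tape"

definition reads :: "store \<Rightarrow> nat \<Rightarrow> nat" where
  "reads ts i = read_tape (ts i)"

definition do_acts :: "((nat \<Rightarrow> nat) \<Rightarrow> nat \<Rightarrow> nat \<times> move) \<Rightarrow> store \<Rightarrow> store" where
  "do_acts F ts = (\<lambda>i. act (F (reads ts) i) (ts i))"

definition nop :: "(nat \<Rightarrow> nat) \<Rightarrow> nat \<Rightarrow> nat \<times> move" where
  "nop r i = (r i, Stay)"

text \<open>The counts are those of the compiled machine: one step for each test of a loop and one
  for the jump back behind its body.\<close>

inductive exec :: "cmd \<Rightarrow> store \<Rightarrow> nat \<Rightarrow> store \<Rightarrow> bool" where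
  exec_Do: "exec (Do F) ts 1 (do_acts F ts)"
| exec_Seq: "exec c ts t ts' \<Longrightarrow> exec d ts' u ts'' \<Longrightarrow> exec (c ;; d) ts (t + u) ts''"
| exec_While_False: "\<not> P (reads ts) \<Longrightarrow> exec (While P c) ts 1 ts"
| exec_While_True: "P (reads ts) \<Longrightarrow> exec c ts t ts' \<Longrightarrow> exec (While P c) ts' u ts'' \<Longrightarrow>
    exec (While P c) ts (t + u + 2) ts''"

text \<open>Actions and tests are functions of an infinite family of symbols. A machine with
  \<open>K\<close> tapes and \<open>S\<close> symbols can perform them only if they depend on the
  first \<open>K\<close> symbols and write symbols below \<open>S\<close>.\<close>

fun wf_cmd :: "nat \<Rightarrow> nat \<Rightarrow> cmd \<Rightarrow> bool" where
  "wf_cmd K S (Do F) \<longleftrightarrow>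
     (\<forall>r r'. (\<forall>j<K. r j = r' j) \<longrightarrow> (\<forall>i<K. F r i = F r' i)) \<and>
     (\<forall>r. (\<forall>j<K. r j < S) \<longrightarrow> (\<forall>i<K. fst (F r i) < S))"
| "wf_cmd K S (c ;; d) \<longleftrightarrow> wf_cmd K S c \<and> wf_cmd K S d"
| "wf_cmd K S (While P c) \<longleftrightarrow>
     (\<forall>r r'. (\<forall>j<K. r j = r' j) \<longrightarrow> P r = P r') \<and> wf_cmd K S c"

section \<open>Compilation of while programs to Turing machines\<close>

fun csize :: "cmd \<Rightarrow> nat" where
  "csize (Do F) = 1"
| "csize (c ;; d) = csize c + csize d"
| "csize (While P c) = csize c + 2"

type_synonym instr = "(nat \<Rightarrow> nat) \<Rightarrow> nat \<times> (nat \<Rightarrow> nat \<times> move)"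

text \<open>The code for a command placed at address \<open>q\<close> ends by jumping to \<open>q + csize c\<close>.\<close>

fun code :: "nat \<Rightarrow> cmd \<Rightarrow> instr list" where
  "code q (Do F) = [\<lambda>r. (q + 1, F r)]"
| "code q (c ;; d) = code q c @ code (q + csize c) d"
| "code q (While P c) =
     (\<lambda>r. (if P r then q + 1 else q + csize c + 2, nop r)) # code (q + 1) c @ [\<lambda>r. (q, nop r)]"

lemma length_code [simp]: "length (code q c) = csize c"
  by (induction c arbitrary: q) auto

definition wf_instr :: "nat \<Rightarrow> nat \<Rightarrow> nat \<Rightarrow> instr \<Rightarrow> bool" where
  "wf_instr K S N I \<longleftrightarrow>
     (\<forall>r r'. (\<forall>j<K. r j = r' j) \<longrightarrow> fst (I r) = fst (I r') \<and> (\<forall>i<K. snd (I r) i = snd (I r') i)) \<and>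
     (\<forall>r. fst (I r) \<le> N \<and> ((\<forall>j<K. r j < S) \<longrightarrow> (\<forall>i<K. fst (snd (I r) i) < S)))"

lemma wf_code:
  "wf_cmd K S c \<Longrightarrow> q + csize c \<le> N \<Longrightarrow> \<forall>I\<in>set (code q c). wf_instr K S N I"
proof (induction c arbitrary: q)
  case (Seq c d)
  then show ?case
    using Seq.IH(1)[of q] Seq.IH(2)[of "q + csize c"] by auto
next
  case (While P c)
  have "\<forall>I\<in>set (code (Suc q) c). wf_instr K S N I"
    using While.IH[of "Suc q"] While.prems by simp
  moreover have "wf_instr K S N (\<lambda>r. (if P r then q + 1 else q + csize c + 2, nop r))"
    unfolding wf_instr_def
  proof (intro conjI allI impI)
    fix r r' :: "nat \<Rightarrow> nat"
    assume "\<forall>j<K. r j = r' j"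
    then have "P r = P r'" using While.prems(1) by simp
    then show "fst (if P r then q + 1 else q + csize c + 2, nop r) =
        fst (if P r' then q + 1 else q + csize c + 2, nop r')" by simp
  qed (use While.prems(2) in \<open>auto simp: nop_def\<close>)
  moreover have "wf_instr K S N (\<lambda>r. (q, nop r))"
    using While.prems(2) by (auto simp: wf_instr_def nop_def)
  ultimately show ?case
    by simp
qed (auto simp: wf_instr_def)

text \<open>States below \<open>csize c\<close> are addresses in the code. The code ends at address
  \<open>csize c\<close>, where one further step evaluates \<open>acc\<close> and enters one of the
  two halting states.\<close>

definition tm_of :: "nat \<Rightarrow> nat \<Rightarrow> cmd \<Rightarrow> ((nat \<Rightarrow> nat) \<Rightarrow> bool) \<Rightarrow> tm" where
  "tm_of K S c acc =
     \<lparr>num_tapes = K, num_states = csize c + 3, num_symbols = S,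
      accept_state = csize c + 1, reject_state = csize c + 2,
      delta = (\<lambda>q ss. let r = (\<lambda>i. if i < K then ss ! i else 0) in
        if q < csize c then (fst ((code 0 c ! q) r), map (snd ((code 0 c ! q) r)) [0..<K])
        else (if acc r then csize c + 1 else csize c + 2, map (nop r) [0..<K]))\<rparr>"

lemma wf_tm_of:
  assumes "wf_cmd K S c" "1 \<le> K" "3 \<le> S"
  shows "wf_tm (tm_of K S c acc)"
proof -
  have *: "wf_instr K S (csize c) (code 0 c ! q)" if "q < csize c" for q
    using wf_code[OF assms(1), of 0 "csize c"] that by simp
  have le: "fst ((code 0 c ! q) r) < csize c + 3" if "q < csize c" for q r
  proof -
    have "fst ((code 0 c ! q) r) \<le> csize c"
      using *[OF that] by (auto simp: wf_instr_def)
    then show ?thesis by simp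
  qed
  have sym: "fst ` snd ((code 0 c ! q) (\<lambda>i. if i < K then ss ! i else 0)) ` {0..<K} \<subseteq> {..<S}"
    if "q < csize c" "length ss = K" "set ss \<subseteq> {..<S}" for q ss
  proof -
    have "\<forall>j<K. (if j < K then ss ! j else 0) < S"
      using that(2,3) by (auto simp: set_conv_nth)
    with *[OF that(1)] show ?thesis
      unfolding wf_instr_def by auto
  qed
  show ?thesis
    using assms(2,3) le sym
    unfolding wf_tm_def tm_of_def Let_def
    by (auto simp: nop_def subset_iff set_conv_nth Let_def split: if_splits)
qed

definition tapes :: "nat \<Rightarrow> store \<Rightarrow> tape list" where
  "tapes K ts = map ts [0..<K]"

lemma map2_acts: "map2 act (map F [0..<K]) (tapes K ts) = tapes K (\<lambda>i. act (F i) (ts i))"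
  unfolding tapes_def by (rule nth_equalityI) auto

lemma step_instr:
  assumes "wf_cmd K S c" "q < csize c" "(code 0 c ! q) (reads ts) = (q', F)"
  shows "step (tm_of K S c acc) (q, tapes K ts) = (q', tapes K (\<lambda>i. act (F i) (ts i)))"
proof -
  define r where "r = (\<lambda>i. if i < K then map read_tape (tapes K ts) ! i else 0)"
  have wf: "wf_instr K S (csize c) (code 0 c ! q)"
    using wf_code[OF assms(1), of 0 "csize c"] assms(2) by simp
  have agree: "\<forall>j<K. r j = reads ts j"
    by (simp add: r_def tapes_def reads_def)
  have "fst ((code 0 c ! q) r) = fst ((code 0 c ! q) (reads ts)) \<and>
      (\<forall>i<K. snd ((code 0 c ! q) r) i = snd ((code 0 c ! q) (reads ts)) i)"
    using wf agree unfolding wf_instr_def by blast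
  then have 1: "fst ((code 0 c ! q) r) = q'" and "\<forall>i<K. snd ((code 0 c ! q) r) i = F i"
    using assms(3) by simp_all
  then have 2: "map (snd ((code 0 c ! q) r)) [0..<K] = map F [0..<K]"
    by (intro map_cong) simp_all
  have "delta (tm_of K S c acc) q (map read_tape (tapes K ts)) = (q', map F [0..<K])"
    unfolding tm_of_def Let_def tm.select_convs r_def[symmetric] 1 2 if_P[OF assms(2)] ..
  moreover have "q \<noteq> accept_state (tm_of K S c acc)" "q \<noteq> reject_state (tm_of K S c acc)"
    using assms(2) by (simp_all add: tm_of_def)
  ultimately show ?thesis
    by (simp add: map2_acts)
qed

lemma act_read [simp]: "act (read_tape t, Stay) t = t"
  by (cases t) (simp add: read_tape_def)

lemma act_nop [simp]: "act (nop (reads ts) i) (ts i) = ts i"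
  by (simp add: nop_def reads_def)

text \<open>The surrounding code \<open>xs\<close> and \<open>ys\<close> is arbitrary because the
  induction descends to commands in the middle of the program. It is an induction on the execution,
  since a loop runs the same code several times.\<close>

lemma step_exec:
  assumes "exec d ts t ts'" "wf_cmd K S c"
    and "code 0 c = xs @ code (length xs) d @ ys"
  shows "(step (tm_of K S c acc) ^^ t) (length xs, tapes K ts) = (length xs + csize d, tapes K ts')"
  using assms(1,3)
proof (induction arbitrary: xs ys rule: exec.induct)
  case (exec_Do F ts)
  have "length xs < csize c"
    using arg_cong[OF exec_Do, of length] by simp
  then show ?case
    using step_instr[OF assms(2), of "length xs" ts "length xs + 1" "F (reads ts)"] exec_Do
    by (simp add: nth_append do_acts_def)
next
  case (exec_Seq e ts t ts' f u ts'')
  show ?case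
    using exec_Seq.IH(1)[of xs "code (length xs + csize e) f @ ys"]
      exec_Seq.IH(2)[of "xs @ code (length xs) e" ys] exec_Seq.prems
    by (simp add: funpow_add add.commute[of t] add.assoc)
next
  case (exec_While_False P ts e)
  have "length xs < csize c"
    using arg_cong[OF exec_While_False(2), of length] by simp
  then show ?case
    using step_instr[OF assms(2), of "length xs" ts "length xs + csize e + 2" "nop (reads ts)"]
      exec_While_False
    by (simp add: nth_append)
next
  case (exec_While_True P ts e t ts' u ts'')
  let ?M = "tm_of K S c acc"
  have len: "length xs + csize e + 1 < csize c"
    using arg_cong[OF exec_While_True.prems, of length] by simp
  have 1: "step ?M (length xs, tapes K ts) = (length xs + 1, tapes K ts)"
    using step_instr[OF assms(2), of "length xs" ts "length xs + 1" "nop (reads ts)"]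
      exec_While_True.hyps(1) exec_While_True.prems len
    by (simp add: nth_append)
  have 2: "(step ?M ^^ t) (length xs + 1, tapes K ts) = (length xs + 1 + csize e, tapes K ts')"
    using exec_While_True.IH(1)[of "xs @ [code (length xs) (While P e) ! 0]"
        "[\<lambda>r. (length xs, nop r)] @ ys"] exec_While_True.prems
    by simp
  have "code 0 c ! (length xs + 1 + csize e) = (\<lambda>r. (length xs, nop r))"
    unfolding exec_While_True.prems by (simp add: nth_append)
  then have 3: "step ?M (length xs + 1 + csize e, tapes K ts') = (length xs, tapes K ts')"
    using step_instr[OF assms(2), of "length xs + 1 + csize e" ts' "length xs" "nop (reads ts')"] len
    by simp
  have "t + u + 2 = u + (1 + (t + 1))"
    by simp
  then have "(step ?M ^^ (t + u + 2)) = (step ?M ^^ u) \<circ> ((step ?M ^^ 1) \<circ> ((step ?M ^^ t) \<circ> (step ?M ^^ 1)))"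
    by (simp only: funpow_add)
  then show ?case
    using 1 2 3 exec_While_True.IH(2)[OF exec_While_True.prems] by simp
qed

lemma step_tm_of_final:
  assumes "exec c ts t ts'" "wf_cmd K S c"
    and "\<And>r r'. \<forall>j<K. r j = r' j \<Longrightarrow> acc r = acc r'"
  shows "fst ((step (tm_of K S c acc) ^^ Suc t) (0, tapes K ts)) =
    (if acc (reads ts') then csize c + 1 else csize c + 2)"
proof -
  have "acc (\<lambda>i. if i < K then map read_tape (tapes K ts') ! i else 0) = acc (reads ts')"
    by (rule assms(3)) (simp add: tapes_def reads_def)
  then show ?thesis
    using step_exec[OF assms(1,2), of "[]" "[]" acc]
    by (simp add: tm_of_def Let_def)
qed

section \<open>Time bounds for while programs\<close>

definition runs :: "cmd \<Rightarrow> store \<Rightarrow> nat \<Rightarrow> store \<Rightarrow> bool" where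
  "runs c ts T ts' \<longleftrightarrow> (\<exists>t\<le>T. exec c ts t ts')"

lemma runs_Do: "ts' = do_acts F ts \<Longrightarrow> runs (Do F) ts 1 ts'"
  using exec_Do runs_def by blast

lemma runs_Seq: "runs c ts T ts' \<Longrightarrow> runs d ts' U ts'' \<Longrightarrow> runs (c ;; d) ts (T + U) ts''"
  unfolding runs_def using exec_Seq add_le_mono by blast

lemma runs_mono: "runs c ts T ts' \<Longrightarrow> T \<le> U \<Longrightarrow> runs c ts U ts'"
  unfolding runs_def using le_trans by blast

text \<open>The sequence \<open>\<sigma>\<close> lists the stores between the rounds and thus
  replaces a loop invariant. The last summand \<open>1\<close> pays for the failing test.\<close>

lemma runs_While:
  assumes "\<And>i. i < k \<Longrightarrow> P (reads (\<sigma> i)) \<and> runs c (\<sigma> i) T (\<sigma> (Suc i))"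
    and "\<not> P (reads (\<sigma> k))"
  shows "runs (While P c) (\<sigma> 0) (k * (T + 2) + 1) (\<sigma> k)"
  using assms
proof (induction k arbitrary: \<sigma>)
  case 0
  then show ?case
    using exec_While_False[of P "\<sigma> 0" c] by (auto simp: runs_def)
next
  case (Suc k)
  have "runs (While P c) (\<sigma> 1) (k * (T + 2) + 1) (\<sigma> (Suc k))"
    using Suc.IH[of "\<lambda>i. \<sigma> (Suc i)"] Suc.prems by simp
  then obtain u where u: "u \<le> k * (T + 2) + 1" "exec (While P c) (\<sigma> 1) u (\<sigma> (Suc k))"
    by (auto simp: runs_def)
  obtain t where t: "t \<le> T" "exec c (\<sigma> 0) t (\<sigma> 1)"
    using Suc.prems(1)[of 0] by (auto simp: runs_def)
  have "exec (While P c) (\<sigma> 0) (t + u + 2) (\<sigma> (Suc k))"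
    using exec_While_True[OF _ t(2) u(2)] Suc.prems(1)[of 0] by simp
  then show ?case
    unfolding runs_def using u(1) t(1) by (intro exI[of _ "t + u + 2"]) auto
qed

lemma poly_nat_mono: "x \<le> y \<Longrightarrow> poly p x \<le> poly p (y :: nat)"
  by (induction p) (auto intro: add_mono mult_mono)

lemma in_P_runs:
  assumes wf: "wf_cmd K S c" "1 \<le> K" "3 \<le> S"
    and acc: "\<And>r r'. \<forall>j<K. r j = r' j \<Longrightarrow> acc r = acc r'"
    and runs: "\<And>w. \<exists>ts. runs c ((\<lambda>_. (\<lambda>_. 0, 0))(0 := input_tape w)) (poly p (length w)) ts \<and>
      (acc (reads ts) \<longleftrightarrow> w \<in> L)"
  shows "in_P L"
proof -
  let ?M = "tm_of K S c acc"
  have "decides_in_time ?M L (poly (p + 1))"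
    unfolding decides_in_time_def
  proof
    fix w
    obtain ts t where ts: "exec c ((\<lambda>_. (\<lambda>_. 0, 0))(0 := input_tape w)) t ts"
      "t \<le> poly p (length w)" "acc (reads ts) \<longleftrightarrow> w \<in> L"
      using runs[of w] by (auto simp: runs_def)
    have "init_config ?M w = (0, tapes K ((\<lambda>_. (\<lambda>_. 0, 0))(0 := input_tape w)))"
      unfolding init_config_def tapes_def tm_of_def
      using wf(2) by (auto intro!: nth_equalityI simp: nth_Cons')
    with step_tm_of_final[OF ts(1) wf(1) acc] ts(2,3)
    show "\<exists>t\<le>poly (p + 1) (length w).
        fst ((step ?M ^^ t) (init_config ?M w)) =
          (if w \<in> L then accept_state ?M else reject_state ?M)"
      by (intro exI[of _ "Suc t"]) (auto simp: tm_of_def)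
  qed
  with wf_tm_of[OF wf] show ?thesis
    unfolding in_P_def by blast
qed

section \<open>Sweep programs on square matrices\<close>

datatype 'c prog =
    Pass "'c \<Rightarrow> 'c \<Rightarrow> 'c \<Rightarrow> 'c"
  | PSeq "'c prog" "'c prog"
  | Loop "'c prog"

text \<open>The first two arguments of \<open>g\<close> always come from the old matrix, and only
  the entry itself accumulates. The machine achieves this by writing on just one of its three copies
  during a sweep.\<close>

fun sem :: "nat \<Rightarrow> 'c prog \<Rightarrow> (nat \<Rightarrow> nat \<Rightarrow> 'c) \<Rightarrow> nat \<Rightarrow> nat \<Rightarrow> 'c" where
  "sem n (Pass g) M = (\<lambda>x y. fold (\<lambda>z m. g (M x z) (M y z) m) [0..<n] (M x y))"
| "sem n (PSeq p q) M = sem n q (sem n p M)"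
| "sem n (Loop p) M = (sem n p ^^ n) M"

fun depth :: "'c prog \<Rightarrow> nat" where
  "depth (Pass g) = 0"
| "depth (PSeq p q) = max (depth p) (depth q)"
| "depth (Loop p) = Suc (depth p)"

text \<open>The offset keeps cells apart from the blank, the two input bits and the separator, so
  that a cell is recognized by a symbol above \<open>3\<close>.\<close>

definition cell_sym :: "'c::countable \<Rightarrow> nat" where
  "cell_sym c = 4 + to_nat c"

definition sym_cell :: "nat \<Rightarrow> 'c::countable" where
  "sym_cell s = from_nat (s - 4)"

lemma sym_cell_cell_sym [simp]: "sym_cell (cell_sym c) = c"
  by (simp add: sym_cell_def cell_sym_def)

lemma cell_sym_neq [simp]: "cell_sym c \<noteq> 0" "cell_sym c \<noteq> Suc 0" "cell_sym c \<noteq> 2" "cell_sym c \<noteq> 3"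
  by (simp_all add: cell_sym_def)

lemma cell_sym_greater [simp]: "0 < cell_sym c" "3 < cell_sym c"
  by (simp_all add: cell_sym_def)

text \<open>A matrix is stored row by row, each row being followed by the separator symbol \<open>3\<close>;
  \<open>pos n x y\<close> is the position of its entry \<open>(x, y)\<close>.\<close>

definition pos :: "nat \<Rightarrow> nat \<Rightarrow> nat \<Rightarrow> int" where
  "pos n x y = int (x * Suc n + y)"

definition msym :: "nat \<Rightarrow> (nat \<Rightarrow> nat \<Rightarrow> 'c::countable) \<Rightarrow> int \<Rightarrow> nat" where
  "msym n M i = (let k = nat i in
     if k mod Suc n = n then 3 else cell_sym (M (k div Suc n) (k mod Suc n)))"

definition mtape :: "nat \<Rightarrow> (nat \<Rightarrow> nat \<Rightarrow> 'c::countable) \<Rightarrow> int \<Rightarrow> nat" where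
  "mtape n M i = (if 0 \<le> i \<and> i < pos n n 0 then msym n M i else 0)"

lemma pos_Suc [simp]: "pos n x y + 1 = pos n x (Suc y)"
  by (simp add: pos_def)

lemma pos_Suc_n [simp]: "pos n x (Suc n) = pos n (Suc x) 0"
  by (simp add: pos_def)

lemma pos_0 [simp]: "pos n 0 0 = 0"
  by (simp add: pos_def)

lemma pos_ge_0 [simp]: "0 \<le> pos n x y"
  by (simp add: pos_def)

lemma pos_less: 
  assumes "x < n" "y \<le> n"
  shows "pos n x y < pos n n 0"
proof -
  have "x * Suc n + y < Suc x * Suc n" using assms(2) by simp
  also have "\<dots> \<le> n * Suc n" using assms(1) by (intro mult_le_mono1) simp
  finally show ?thesis by (simp only: pos_def of_nat_less_iff add_0_right)
qed

lemma msym_cell [simp]: "y < n \<Longrightarrow> msym n M (pos n x y) = cell_sym (M x y)"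
proof -
  assume "y < n"
  moreover from this have "(x * Suc n + y) div Suc n = x" "(x * Suc n + y) mod Suc n = y"
    by (metis div_mult_self3 div_less less_SucI add.right_neutral nat.distinct(1) add.commute,
        metis mod_mult_self3 mod_less less_SucI)
  ultimately show ?thesis
    unfolding msym_def pos_def Let_def nat_int by simp
qed

lemma msym_sep [simp]: "msym n M (pos n x n) = 3"
proof -
  have "(x * Suc n + n) mod Suc n = n"
    by (metis mod_mult_self3 mod_less lessI)
  then show ?thesis
    unfolding msym_def pos_def Let_def nat_int by simp
qed

lemma msym_pos [simp]: "msym n M i \<noteq> 0"
  by (simp add: msym_def Let_def)

lemma mtape_cell [simp]: "x < n \<Longrightarrow> y < n \<Longrightarrow> mtape n M (pos n x y) = cell_sym (M x y)"
  using pos_less[of x n y] by (simp add: mtape_def)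

lemma mtape_sep [simp]: "x < n \<Longrightarrow> mtape n M (pos n x n) = 3"
  using pos_less[of x n n] by (simp add: mtape_def)

lemma mtape_end [simp]: "mtape n M (pos n n 0) = 0"
  by (simp add: mtape_def)

lemma mtape_neg [simp]: "i < 0 \<Longrightarrow> mtape n M i = 0"
  by (simp add: mtape_def)

lemma mtape_eq_0_iff: "mtape n M i = 0 \<longleftrightarrow> i < 0 \<or> pos n n 0 \<le> i"
  by (auto simp: mtape_def)

lemma mtape_left_cell:
  assumes "x < n" "i < n"
  shows "mtape n M (pos n x n - 1 - int i) = cell_sym (M x (n - 1 - i))"
proof -
  have "pos n x n - 1 - int i = pos n x (n - 1 - i)"
    using assms(2) by (simp add: pos_def)
  then show ?thesis using assms by simp
qed

text \<open>To the left of a row stands the separator of the previous row or, for the first row, a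
  blank. Both stop the scan back to the start of the row.\<close>

lemma mtape_left_end:
  assumes "x < n"
  shows "mtape n M (pos n x 0 - 1) \<le> 3"
proof (cases x)
  case (Suc x')
  then have "pos n x 0 - 1 = pos n x' n" by (simp add: pos_def)
  then show ?thesis using assms Suc by simp
qed simp

text \<open>The content of a tape that is being overwritten: from left to right with
  \<open>t\<close> in a sweep and while loading, from right to left with \<open>t'\<close> while
  copying.\<close>

definition mix :: "int \<Rightarrow> (int \<Rightarrow> nat) \<Rightarrow> (int \<Rightarrow> nat) \<Rightarrow> int \<Rightarrow> nat" where
  "mix k t t' i = (if i < k then t i else t' i)"

lemma mix_upd: "(mix k t t')(k := t k) = mix (k + 1) t t'"
  by (auto simp: mix_def fun_eq_iff)

lemma mix_upd': "(mix (k + 1) t t')(k := t' k) = mix k t t'"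
  by (auto simp: mix_def fun_eq_iff)

lemma mix_same: "t k = t' k \<Longrightarrow> mix (k + 1) t t' = mix k t t'"
  by (auto simp: mix_def fun_eq_iff)

lemma mix_at [simp]: "mix k t t' k = t' k"
  by (simp add: mix_def)

section \<open>A sweep as a while program\<close>

definition mk :: "store \<Rightarrow> tape \<Rightarrow> tape \<Rightarrow> tape \<Rightarrow> store" where
  "mk b ta tb tc = b(1 := ta, 2 := tb, 3 := tc)"

definition Do3 :: "((nat \<Rightarrow> nat) \<Rightarrow> nat \<times> move) \<Rightarrow> ((nat \<Rightarrow> nat) \<Rightarrow> nat \<times> move) \<Rightarrow>
    ((nat \<Rightarrow> nat) \<Rightarrow> nat \<times> move) \<Rightarrow> cmd" where
  "Do3 f g h = Do (\<lambda>r. (nop r)(1 := f r, 2 := g r, 3 := h r))"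

lemma reads_mk [simp]:
  "reads (mk b ta tb tc) (Suc 0) = read_tape ta"
  "reads (mk b ta tb tc) 2 = read_tape tb"
  "reads (mk b ta tb tc) 3 = read_tape tc"
  "5 \<le> d \<Longrightarrow> reads (mk b ta tb tc) d = read_tape (b d)"
  by (simp_all add: reads_def mk_def)

lemma read_tape_pair [simp]: "read_tape (t, p) = t p"
  by (simp add: read_tape_def)

lemma runs_Do3:
  assumes "ts = mk b ta tb tc" "r = reads ts"
    and "ts' = mk b (act (f r) ta) (act (g r) tb) (act (h r) tc)"
  shows "runs (Do3 f g h) ts 1 ts'"
  unfolding Do3_def
proof (rule runs_Do)
  show "ts' = do_acts (\<lambda>r. (nop r)(1 := f r, 2 := g r, 3 := h r)) ts"
    unfolding assms(3) do_acts_def assms(2)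
  proof
    fix i
    have "act (nop (reads ts) i) (b i) = b i" if "i \<noteq> 1" "i \<noteq> 2" "i \<noteq> 3"
      using that act_nop[of ts i] by (simp add: assms(1) mk_def del: act_nop)
    then show "mk b (act (f (reads ts)) ta) (act (g (reads ts)) tb) (act (h (reads ts)) tc) i =
       act (((nop (reads ts))(1 := f (reads ts), 2 := g (reads ts), 3 := h (reads ts))) i) (ts i)"
      by (simp add: assms(1) mk_def)
  qed
qed

lemma wf_Do3:
  assumes "3 < K"
    and "\<And>r r'. \<forall>j<K. r j = r' j \<Longrightarrow> f r = f r' \<and> g r = g r' \<and> h r = h r'"
    and "\<And>r. \<forall>j<K. r j < S \<Longrightarrow> fst (f r) < S \<and> fst (g r) < S \<and> fst (h r) < S"
  shows "wf_cmd K S (Do3 f g h)"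
  unfolding Do3_def wf_cmd.simps
proof (intro conjI allI impI)
  fix r r' :: "nat \<Rightarrow> nat" and i assume "\<forall>j<K. r j = r' j" "i < K"
  then show "((nop r)(1 := f r, 2 := g r, 3 := h r)) i = ((nop r')(1 := f r', 2 := g r', 3 := h r')) i"
    using assms(2)[of r r'] by (simp add: nop_def)
next
  fix r :: "nat \<Rightarrow> nat" and i assume "\<forall>j<K. r j < S" "i < K"
  then show "fst (((nop r)(1 := f r, 2 := g r, 3 := h r)) i) < S"
    using assms(3)[of r] by (simp add: nop_def)
qed

abbreviation go :: "nat \<Rightarrow> move \<Rightarrow> (nat \<Rightarrow> nat) \<Rightarrow> nat \<times> move" where
  "go i m r \<equiv> (r i, m)"

text \<open>The entries \<open>(x, z)\<close>, \<open>(y, z)\<close> and \<open>(x, y)\<close> are read on the tapes \<open>1\<close>, \<open>2\<close> and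
  \<open>3\<close>, so that all heads move by one cell at a time; the new matrix is written on tape \<open>3\<close>
  and finally copied to the other two tapes.\<close>

definition pass_row :: "('c::countable \<Rightarrow> 'c \<Rightarrow> 'c \<Rightarrow> 'c) \<Rightarrow> cmd" where
  "pass_row g =
     While (\<lambda>r. r 3 \<noteq> 3)
       (While (\<lambda>r. r 1 \<noteq> 3)
         (Do3 (go 1 Right) (go 2 Right)
           (\<lambda>r. (cell_sym (g (sym_cell (r 1)) (sym_cell (r 2)) (sym_cell (r 3))), Stay))) ;;
        Do3 (go 1 Left) (go 2 Right) (go 3 Right) ;;
        While (\<lambda>r. 3 < r 1) (Do3 (go 1 Left) (go 2 Stay) (go 3 Stay)) ;;
        Do3 (go 1 Right) (go 2 Stay) (go 3 Stay))"

definition pass_next_row :: cmd where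
  "pass_next_row =
     While (\<lambda>r. r 1 \<noteq> 3) (Do3 (go 1 Right) (go 2 Stay) (go 3 Stay)) ;;
     Do3 (go 1 Right) (go 2 Left) (go 3 Right) ;;
     While (\<lambda>r. r 2 \<noteq> 0) (Do3 (go 1 Stay) (go 2 Left) (go 3 Stay)) ;;
     Do3 (go 1 Stay) (go 2 Right) (go 3 Stay)"

text \<open>In the second loop \<open>go 3 Left\<close> is the action on all three tapes; it writes
  the symbol read on tape \<open>3\<close> and so replaces the old entries on tapes \<open>1\<close>
  and \<open>2\<close>.\<close>

definition pass_copy :: cmd where
  "pass_copy =
     While (\<lambda>r. r 2 \<noteq> 0) (Do3 (go 1 Stay) (go 2 Right) (go 3 Stay)) ;;
     Do3 (go 1 Left) (go 2 Left) (go 3 Left) ;;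
     While (\<lambda>r. r 3 \<noteq> 0) (Do3 (go 3 Left) (go 3 Left) (go 3 Left)) ;;
     Do3 (go 1 Right) (go 2 Right) (go 3 Right)"

definition pass_cmd :: "('c::countable \<Rightarrow> 'c \<Rightarrow> 'c \<Rightarrow> 'c) \<Rightarrow> cmd" where
  "pass_cmd g = While (\<lambda>r. r 3 \<noteq> 0) (pass_row g ;; pass_next_row) ;; pass_copy"

lemma runs_eq: "runs c ts T ts' \<Longrightarrow> ts = us \<Longrightarrow> T = U \<Longrightarrow> ts' = us' \<Longrightarrow> runs c us U us'"
  by simp

lemma runs_row_entry:
  assumes "x < n" "y < n" and f: "f = (\<lambda>z m. g (M x z) (M y z) m)"
    and C: "C (pos n x y) = cell_sym (M x y)"
  shows "runs (While (\<lambda>r. r 1 \<noteq> 3)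
         (Do3 (go 1 Right) (go 2 Right)
           (\<lambda>r. (cell_sym (g (sym_cell (r 1)) (sym_cell (r 2)) (sym_cell (r 3))), Stay))))
     (mk b (mtape n M, pos n x 0) (mtape n M, pos n y 0) (C, pos n x y)) (n * 3 + 1)
     (mk b (mtape n M, pos n x n) (mtape n M, pos n y n)
       (C(pos n x y := cell_sym (fold f [0..<n] (M x y))), pos n x y))"
proof -
  define \<sigma> where "\<sigma> z = mk b (mtape n M, pos n x z) (mtape n M, pos n y z)
       (C(pos n x y := cell_sym (fold f [0..<z] (M x y))), pos n x y)" for z
  have "runs (While (\<lambda>r. r 1 \<noteq> 3)
         (Do3 (go 1 Right) (go 2 Right)
           (\<lambda>r. (cell_sym (g (sym_cell (r 1)) (sym_cell (r 2)) (sym_cell (r 3))), Stay))))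
         (\<sigma> 0) (n * (1 + 2) + 1) (\<sigma> n)"
  proof (rule runs_While, rule conjI)
    fix z assume "z < n"
    then show "reads (\<sigma> z) 1 \<noteq> 3"
      using assms(1) by (simp add: \<sigma>_def)
    show "runs (Do3 (go 1 Right) (go 2 Right)
           (\<lambda>r. (cell_sym (g (sym_cell (r 1)) (sym_cell (r 2)) (sym_cell (r 3))), Stay)))
         (\<sigma> z) 1 (\<sigma> (Suc z))"
      by (rule runs_Do3[OF \<sigma>_def refl])
        (use assms(1,2) \<open>z < n\<close> in \<open>simp add: \<sigma>_def f fun_upd_idem\<close>)
  qed (use assms(1) in \<open>simp add: \<sigma>_def\<close>)
  then show ?thesis
    by (rule runs_eq) (use C in \<open>simp_all add: \<sigma>_def fun_upd_idem\<close>)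
qed

lemma runs_row_back:
  assumes "x < n"
  shows "runs (While (\<lambda>r. 3 < r 1) (Do3 (go 1 Left) (go 2 Stay) (go 3 Stay)))
    (mk b (mtape n M, pos n x n - 1) tb tc) (n * 3 + 1) (mk b (mtape n M, pos n x 0 - 1) tb tc)"
proof -
  define \<sigma> where "\<sigma> i = mk b (mtape n M, pos n x n - 1 - int i) tb tc" for i
  have "runs (While (\<lambda>r. 3 < r 1) (Do3 (go 1 Left) (go 2 Stay) (go 3 Stay)))
     (\<sigma> 0) (n * (1 + 2) + 1) (\<sigma> n)"
  proof (rule runs_While, rule conjI)
    fix i assume "i < n"
    then show "3 < reads (\<sigma> i) 1"
      using assms by (simp add: \<sigma>_def mtape_left_cell)
    show "runs (Do3 (go 1 Left) (go 2 Stay) (go 3 Stay)) (\<sigma> i) 1 (\<sigma> (Suc i))"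
      by (rule runs_Do3[OF \<sigma>_def refl]) (cases tb; cases tc; simp add: \<sigma>_def algebra_simps)
  next
    have eq: "pos n x n - 1 - int n = pos n x 0 - 1" by (simp add: pos_def)
    show "\<not> 3 < reads (\<sigma> n) 1"
      unfolding \<sigma>_def eq using mtape_left_end[OF assms, of M] by simp
  qed
  then show ?thesis
    by (rule runs_eq) (simp_all add: \<sigma>_def pos_def algebra_simps)
qed

text \<open>Tape \<open>1\<close> runs through row \<open>x\<close> once for each \<open>y\<close>,
  but tape \<open>2\<close> passes through the whole matrix only once, because the rows
  \<open>y\<close> are needed in the order in which they are stored.\<close>

lemma runs_pass_row:
  assumes "x < n" and M': "M' = sem n (Pass g) M"
  shows "runs (pass_row g)
    (mk b (mtape n M, pos n x 0) (mtape n M, 0) (mix (pos n x 0) (mtape n M') (mtape n M), pos n x 0))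
    (n * (6 * n + 6) + 1)
    (mk b (mtape n M, pos n x 0) (mtape n M, pos n n 0)
      (mix (pos n x n) (mtape n M') (mtape n M), pos n x n))"
proof -
  define \<sigma> where "\<sigma> y = mk b (mtape n M, pos n x 0) (mtape n M, pos n y 0)
      (mix (pos n x y) (mtape n M') (mtape n M), pos n x y)" for y
  have "runs (pass_row g) (\<sigma> 0) (n * (((n * 3 + 1) + (1 + ((n * 3 + 1) + 1))) + 2) + 1) (\<sigma> n)"
    unfolding pass_row_def
  proof (rule runs_While, rule conjI)
    fix y assume y: "y < n"
    show "reads (\<sigma> y) 3 \<noteq> 3"
      using assms(1) y by (simp add: \<sigma>_def)
    let ?C = "(mix (pos n x y) (mtape n M') (mtape n M))(pos n x y :=
        cell_sym (fold (\<lambda>z m. g (M x z) (M y z) m) [0..<n] (M x y)))"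
    have C: "?C = mix (pos n x (Suc y)) (mtape n M') (mtape n M)"
      using assms(1) y mix_upd[of "pos n x y" "mtape n M'" "mtape n M"] by (simp add: M')
    show "runs (While (\<lambda>r. r 1 \<noteq> 3)
         (Do3 (go 1 Right) (go 2 Right)
           (\<lambda>r. (cell_sym (g (sym_cell (r 1)) (sym_cell (r 2)) (sym_cell (r 3))), Stay))) ;;
        Do3 (go 1 Left) (go 2 Right) (go 3 Right) ;;
        While (\<lambda>r. 3 < r 1) (Do3 (go 1 Left) (go 2 Stay) (go 3 Stay)) ;;
        Do3 (go 1 Right) (go 2 Stay) (go 3 Stay))
        (\<sigma> y) ((n * 3 + 1) + (1 + ((n * 3 + 1) + 1))) (\<sigma> (Suc y))"
    proof (rule runs_Seq[OF _ runs_Seq[OF _ runs_Seq]])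
      show "runs (While (\<lambda>r. r 1 \<noteq> 3)
         (Do3 (go 1 Right) (go 2 Right)
           (\<lambda>r. (cell_sym (g (sym_cell (r 1)) (sym_cell (r 2)) (sym_cell (r 3))), Stay))))
         (\<sigma> y) (n * 3 + 1) (mk b (mtape n M, pos n x n) (mtape n M, pos n y n) (?C, pos n x y))"
        unfolding \<sigma>_def by (rule runs_row_entry) (use assms(1) y in simp_all)
      show "runs (Do3 (go 1 Left) (go 2 Right) (go 3 Right))
         (mk b (mtape n M, pos n x n) (mtape n M, pos n y n) (?C, pos n x y)) 1
         (mk b (mtape n M, pos n x n - 1) (mtape n M, pos n (Suc y) 0)
            (mix (pos n x (Suc y)) (mtape n M') (mtape n M), pos n x (Suc y)))"
        unfolding C[symmetric] by (rule runs_Do3[OF refl refl]) (simp add: fun_upd_idem)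
      show "runs (While (\<lambda>r. 3 < r 1) (Do3 (go 1 Left) (go 2 Stay) (go 3 Stay)))
         (mk b (mtape n M, pos n x n - 1) (mtape n M, pos n (Suc y) 0)
            (mix (pos n x (Suc y)) (mtape n M') (mtape n M), pos n x (Suc y))) (n * 3 + 1)
         (mk b (mtape n M, pos n x 0 - 1) (mtape n M, pos n (Suc y) 0)
            (mix (pos n x (Suc y)) (mtape n M') (mtape n M), pos n x (Suc y)))"
        by (rule runs_row_back[OF assms(1)])
      show "runs (Do3 (go 1 Right) (go 2 Stay) (go 3 Stay))
         (mk b (mtape n M, pos n x 0 - 1) (mtape n M, pos n (Suc y) 0)
            (mix (pos n x (Suc y)) (mtape n M') (mtape n M), pos n x (Suc y))) 1 (\<sigma> (Suc y))"
        by (rule runs_Do3[OF refl refl]) (simp add: \<sigma>_def fun_upd_idem)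
    qed
  qed (use assms(1) in \<open>simp add: \<sigma>_def\<close>)
  then show ?thesis
    by (rule runs_eq) (simp_all add: \<sigma>_def algebra_simps)
qed

lemma runs_tape2_left:
  "runs (While (\<lambda>r. r 2 \<noteq> 0) (Do3 (go 1 Stay) (go 2 Left) (go 3 Stay)))
    (mk b ta (mtape n M, pos n n 0 - 1) tc) (n * Suc n * 3 + 1) (mk b ta (mtape n M, - 1) tc)"
proof -
  define \<sigma> where "\<sigma> i = mk b ta (mtape n M, pos n n 0 - 1 - int i) tc" for i
  have "runs (While (\<lambda>r. r 2 \<noteq> 0) (Do3 (go 1 Stay) (go 2 Left) (go 3 Stay)))
     (\<sigma> 0) (n * Suc n * (1 + 2) + 1) (\<sigma> (n * Suc n))"
  proof (rule runs_While, rule conjI)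
    fix i assume "i < n * Suc n"
    then have "int i < pos n n 0" unfolding pos_def of_nat_less_iff by simp
    then show "reads (\<sigma> i) 2 \<noteq> 0"
      by (simp add: \<sigma>_def mtape_eq_0_iff)
    show "runs (Do3 (go 1 Stay) (go 2 Left) (go 3 Stay)) (\<sigma> i) 1 (\<sigma> (Suc i))"
      by (rule runs_Do3[OF \<sigma>_def refl]) (cases ta; cases tc; simp add: \<sigma>_def algebra_simps)
  qed (simp add: \<sigma>_def pos_def)
  then show ?thesis
    by (rule runs_eq) (simp_all add: \<sigma>_def pos_def)
qed

lemma runs_tape2_right:
  "runs (While (\<lambda>r. r 2 \<noteq> 0) (Do3 (go 1 Stay) (go 2 Right) (go 3 Stay)))
    (mk b ta (mtape n M, 0) tc) (n * Suc n * 3 + 1) (mk b ta (mtape n M, pos n n 0) tc)"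
proof -
  define \<sigma> where "\<sigma> i = mk b ta (mtape n M, int i) tc" for i
  have "runs (While (\<lambda>r. r 2 \<noteq> 0) (Do3 (go 1 Stay) (go 2 Right) (go 3 Stay)))
     (\<sigma> 0) (n * Suc n * (1 + 2) + 1) (\<sigma> (n * Suc n))"
  proof (rule runs_While, rule conjI)
    fix i assume "i < n * Suc n"
    then have "int i < pos n n 0" unfolding pos_def of_nat_less_iff by simp
    then show "reads (\<sigma> i) 2 \<noteq> 0"
      by (simp add: \<sigma>_def mtape_eq_0_iff)
    show "runs (Do3 (go 1 Stay) (go 2 Right) (go 3 Stay)) (\<sigma> i) 1 (\<sigma> (Suc i))"
      by (rule runs_Do3[OF \<sigma>_def refl]) (cases ta; cases tc; simp add: \<sigma>_def algebra_simps)
  qed (simp add: \<sigma>_def pos_def mtape_eq_0_iff)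
  then show ?thesis
    by (rule runs_eq) (simp_all add: \<sigma>_def pos_def)
qed

lemma runs_pass_next_row:
  assumes "x < n"
  shows "runs pass_next_row
    (mk b (mtape n M, pos n x 0) (mtape n M, pos n n 0) (C, pos n x n))
    (3 * (n * Suc n) + 3 * n + 4)
    (mk b (mtape n M, pos n (Suc x) 0) (mtape n M, 0) (C, pos n (Suc x) 0))"
proof -
  define \<sigma> where "\<sigma> z = mk b (mtape n M, pos n x z) (mtape n M, pos n n 0) (C, pos n x n)" for z
  have 1: "runs (While (\<lambda>r. r 1 \<noteq> 3) (Do3 (go 1 Right) (go 2 Stay) (go 3 Stay)))
      (\<sigma> 0) (n * (1 + 2) + 1) (\<sigma> n)"
  proof (rule runs_While, rule conjI)
    fix z assume "z < n"
    then show "reads (\<sigma> z) 1 \<noteq> 3"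
      using assms(1) by (simp add: \<sigma>_def)
    show "runs (Do3 (go 1 Right) (go 2 Stay) (go 3 Stay)) (\<sigma> z) 1 (\<sigma> (Suc z))"
      by (rule runs_Do3[OF \<sigma>_def refl]) (use \<open>z < n\<close> assms in \<open>simp add: \<sigma>_def fun_upd_idem\<close>)
  qed (use assms(1) in \<open>simp add: \<sigma>_def\<close>)
  have "runs pass_next_row (\<sigma> 0) ((n * (1 + 2) + 1) + (1 + ((n * Suc n * 3 + 1) + 1)))
    (mk b (mtape n M, pos n (Suc x) 0) (mtape n M, 0) (C, pos n (Suc x) 0))"
    unfolding pass_next_row_def
  proof (rule runs_Seq[OF 1 runs_Seq[OF _ runs_Seq[OF runs_tape2_left]]])
    show "runs (Do3 (go 1 Right) (go 2 Left) (go 3 Right)) (\<sigma> n) 1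
      (mk b (mtape n M, pos n (Suc x) 0) (mtape n M, pos n n 0 - 1) (C, pos n (Suc x) 0))"
      by (rule runs_Do3[OF \<sigma>_def refl]) (simp add: \<sigma>_def fun_upd_idem)
    show "runs (Do3 (go 1 Stay) (go 2 Right) (go 3 Stay))
      (mk b (mtape n M, pos n (Suc x) 0) (mtape n M, - 1) (C, pos n (Suc x) 0)) 1
      (mk b (mtape n M, pos n (Suc x) 0) (mtape n M, 0) (C, pos n (Suc x) 0))"
      by (rule runs_Do3[OF refl refl]) (simp add: fun_upd_idem)
  qed
  then show ?thesis
    by (rule runs_eq) (simp_all add: \<sigma>_def algebra_simps)
qed

lemma mix_all: "mix (pos n n 0) (mtape n M') (mtape n M) = mtape n M'"
  by (auto simp: mix_def mtape_def fun_eq_iff)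

lemma runs_pass_copy:
  "runs pass_copy
    (mk b (mtape n M, pos n n 0) (mtape n M, 0) (mtape n M', pos n n 0))
    (6 * (n * Suc n) + 4)
    (mk b (mtape n M', 0) (mtape n M', 0) (mtape n M', 0))"
proof -
  let ?N = "n * Suc n"
  have N: "pos n n 0 = int ?N" by (simp add: pos_def)
  define \<sigma> where "\<sigma> i = (let A = (mix (int ?N - int i) (mtape n M) (mtape n M'), int ?N - 1 - int i) in
    mk b A A (mtape n M', int ?N - 1 - int i))" for i
  have 1: "runs (While (\<lambda>r. r 3 \<noteq> 0) (Do3 (go 3 Left) (go 3 Left) (go 3 Left)))
      (\<sigma> 0) (?N * (1 + 2) + 1) (\<sigma> ?N)"
  proof (rule runs_While, rule conjI)
    fix i assume i: "i < ?N"
    show "reads (\<sigma> i) 3 \<noteq> 0"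
      unfolding \<sigma>_def Let_def reads_mk read_tape_pair mtape_eq_0_iff N using i by linarith
    define p where "p = int ?N - 1 - int i"
    have p: "int ?N - int i = p + 1" "int ?N - 1 - int i = p"
      unfolding p_def by linarith+
    have s: "\<sigma> i = mk b (mix (p + 1) (mtape n M) (mtape n M'), p)
        (mix (p + 1) (mtape n M) (mtape n M'), p) (mtape n M', p)"
      unfolding \<sigma>_def Let_def p by simp
    have q: "int ?N - int (Suc i) = p" "int ?N - 1 - int (Suc i) = p - 1"
      unfolding p_def by linarith+
    have s': "\<sigma> (Suc i) = mk b (mix p (mtape n M) (mtape n M'), p - 1)
        (mix p (mtape n M) (mtape n M'), p - 1) (mtape n M', p - 1)"
      unfolding \<sigma>_def Let_def q by simp
    show "runs (Do3 (go 3 Left) (go 3 Left) (go 3 Left)) (\<sigma> i) 1 (\<sigma> (Suc i))"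
      by (rule runs_Do3[OF s refl]) (simp add: s s' mix_upd' fun_upd_idem)
  qed (simp add: \<sigma>_def Let_def mtape_eq_0_iff)
  have "runs pass_copy
    (mk b (mtape n M, pos n n 0) (mtape n M, 0) (mtape n M', pos n n 0))
    ((?N * 3 + 1) + (1 + ((?N * (1 + 2) + 1) + 1)))
    (mk b (mtape n M', 0) (mtape n M', 0) (mtape n M', 0))"
    unfolding pass_copy_def
  proof (rule runs_Seq[OF runs_tape2_right runs_Seq[OF _ runs_Seq[OF 1]]])
    have "mix (pos n n 0) (mtape n M) (mtape n M') = mtape n M"
      by (rule mix_all)
    then have s: "\<sigma> 0 = mk b (mtape n M, pos n n 0 - 1) (mtape n M, pos n n 0 - 1) (mtape n M', pos n n 0 - 1)"
      unfolding \<sigma>_def Let_def N by (simp del: of_nat_mult)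
    show "runs (Do3 (go 1 Left) (go 2 Left) (go 3 Left))
       (mk b (mtape n M, pos n n 0) (mtape n M, pos n n 0) (mtape n M', pos n n 0)) 1 (\<sigma> 0)"
      by (rule runs_Do3[OF refl refl]) (simp add: s fun_upd_idem)
    have "mix 0 (mtape n M) (mtape n M') = mtape n M'"
      by (auto simp: mix_def mtape_def fun_eq_iff)
    then have s: "\<sigma> ?N = mk b (mtape n M', - 1) (mtape n M', - 1) (mtape n M', - 1)"
      unfolding \<sigma>_def Let_def by simp
    show "runs (Do3 (go 1 Right) (go 2 Right) (go 3 Right)) (\<sigma> ?N) 1
       (mk b (mtape n M', 0) (mtape n M', 0) (mtape n M', 0))"
      unfolding s by (rule runs_Do3[OF refl refl]) (simp add: fun_upd_idem)
  qed
  then show ?thesis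
    by (rule runs_eq) (simp_all add: algebra_simps)
qed

text \<open>Cubic in \<open>n\<close>: each of the \<open>n * n\<close> entries is combined with
  \<open>n\<close> values of \<open>z\<close>; rewinding and copying contribute no higher
  order.\<close>

definition pass_time :: "nat poly" where
  "pass_time = [:0, 1:] * ([:0, 1:] * [:6, 6:] + [:1:] + [:0, 3:] * [:1, 1:] + [:4, 3:] + [:2:]) +
     [:1:] + [:0, 6:] * [:1, 1:] + [:4:]"

lemma poly_pass_time: "poly pass_time n =
  (n * ((n * (6 * n + 6) + 1) + (3 * (n * Suc n) + 3 * n + 4) + 2) + 1) + (6 * (n * Suc n) + 4)"
  by (simp add: pass_time_def algebra_simps)

lemma runs_pass_cmd:
  assumes M': "M' = sem n (Pass g) M"
  shows "runs (pass_cmd g) (mk b (mtape n M, 0) (mtape n M, 0) (mtape n M, 0)) (poly pass_time n)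
    (mk b (mtape n M', 0) (mtape n M', 0) (mtape n M', 0))"
  unfolding poly_pass_time pass_cmd_def
proof (rule runs_Seq[OF _ runs_pass_copy])
  define \<sigma> where "\<sigma> x = mk b (mtape n M, pos n x 0) (mtape n M, 0)
      (mix (pos n x 0) (mtape n M') (mtape n M), pos n x 0)" for x
  have "runs (While (\<lambda>r. r 3 \<noteq> 0) (pass_row g ;; pass_next_row)) (\<sigma> 0)
    (n * ((n * (6 * n + 6) + 1) + (3 * (n * Suc n) + 3 * n + 4) + 2) + 1) (\<sigma> n)"
  proof (rule runs_While, rule conjI)
    fix x assume x: "x < n"
    show "reads (\<sigma> x) 3 \<noteq> 0"
      using x pos_less[of x n 0] by (simp add: \<sigma>_def mtape_eq_0_iff)
    have "mix (pos n x n) (mtape n M') (mtape n M) = mix (pos n (Suc x) 0) (mtape n M') (mtape n M)"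
      using mix_same[of "mtape n M'" "pos n x n" "mtape n M"] x by simp
    then show "runs (pass_row g ;; pass_next_row) (\<sigma> x)
       ((n * (6 * n + 6) + 1) + (3 * (n * Suc n) + 3 * n + 4)) (\<sigma> (Suc x))"
      using runs_Seq[OF runs_pass_row[OF x M', of b] runs_pass_next_row[OF x]]
      by (simp add: \<sigma>_def)
  qed (simp add: \<sigma>_def)
  moreover have "mix 0 (mtape n M') (mtape n M) = mtape n M"
    by (auto simp: mix_def mtape_def fun_eq_iff)
  ultimately show "runs (While (\<lambda>r. r 3 \<noteq> 0) (pass_row g ;; pass_next_row))
     (mk b (mtape n M, 0) (mtape n M, 0) (mtape n M, 0))
     (n * ((n * (6 * n + 6) + 1) + (3 * (n * Suc n) + 3 * n + 4) + 2) + 1)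
     (mk b (mtape n M, pos n n 0) (mtape n M, 0) (mtape n M', pos n n 0))"
    by (simp add: \<sigma>_def mix_all)
qed

section \<open>Loops of sweeps\<close>

definition counter :: "nat \<Rightarrow> int \<Rightarrow> nat" where
  "counter n i = (if 0 \<le> i \<and> i < int n then 1 else 0)"

definition move_head :: "nat \<Rightarrow> move \<Rightarrow> cmd" where
  "move_head d m = Do (\<lambda>r. (nop r)(d := (r d, m)))"

text \<open>Tape \<open>0\<close> contains the input, tapes \<open>1\<close> to \<open>3\<close> contain the matrix, and tape \<open>5 + d\<close> is the
  counter of the loops whose bodies have depth \<open>d\<close>; it has \<open>n\<close> marks, which the loop traverses.\<close>

fun prog_cmd :: "'c::countable prog \<Rightarrow> cmd" where
  "prog_cmd (Pass g) = pass_cmd g"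
| "prog_cmd (PSeq p q) = prog_cmd p ;; prog_cmd q"
| "prog_cmd (Loop p) = (let d = 5 + depth p in
     While (\<lambda>r. r d = 1) (prog_cmd p ;; move_head d Right) ;;
     move_head d Left ;; While (\<lambda>r. r d = 1) (move_head d Left) ;; move_head d Right)"

fun prog_time :: "'c prog \<Rightarrow> nat poly" where
  "prog_time (Pass g) = pass_time"
| "prog_time (PSeq p q) = prog_time p + prog_time q"
| "prog_time (Loop p) = [:0, 1:] * (prog_time p + [:3:]) + [:4, 3:]"

lemma runs_move_head:
  assumes "5 \<le> d" "b d = (t, i)" "b' = b(d := act (t i, m) (t, i))"
  shows "runs (move_head d m) (mk b ta tb tc) 1 (mk b' ta tb tc)"
  unfolding move_head_def
proof (rule runs_Do)
  have "do_acts (\<lambda>r. (nop r)(d := (r d, m))) ts = ts(d := act (reads ts d, m) (ts d))" for ts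
    by (auto simp: do_acts_def fun_eq_iff)
  moreover have "mk b ta tb tc d = (t, i)" "mk b' ta tb tc = (mk b ta tb tc)(d := act (t i, m) (t, i))"
    using assms by (auto simp: mk_def fun_eq_iff)
  ultimately show "mk b' ta tb tc = do_acts (\<lambda>r. (nop r)(d := (r d, m))) (mk b ta tb tc)"
    by (simp add: reads_def)
qed

text \<open>Each loop rewinds its counter before it ends, and its body uses only counters of smaller
  depth. So the hypothesis on \<open>b\<close> holds again whenever a body is restarted.\<close>

lemma runs_prog_cmd:
  fixes p :: "'c::countable prog"
  assumes "\<And>d. d < depth p \<Longrightarrow> b (5 + d) = (counter n, 0)"
  shows "runs (prog_cmd p) (mk b (mtape n M, 0) (mtape n M, 0) (mtape n M, 0)) (poly (prog_time p) n)
    (mk b (mtape n (sem n p M), 0) (mtape n (sem n p M), 0) (mtape n (sem n p M), 0))"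
  using assms
proof (induction p arbitrary: b M)
  case (Pass g)
  then show ?case using runs_pass_cmd[OF refl] by simp
next
  case (PSeq p q)
  then show ?case
    using runs_Seq[OF PSeq.IH(1)[of b M] PSeq.IH(2)[of b "sem n p M"]] by simp
next
  case (Loop p)
  define d where "d = 5 + depth p"
  have bd: "b d = (counter n, 0)"
    using Loop.prems[of "depth p"] by (simp add: d_def)
  define mm where "mm b i = (let t = (mtape n ((sem n p ^^ i) M), 0) in mk b t t t)" for b i
  define \<sigma> where "\<sigma> i = mm (b(d := (counter n, int i))) i" for i
  define \<tau> where "\<tau> i = mm (b(d := (counter n, int n - 1 - int i))) n" for i
  have d: "5 \<le> d" by (simp add: d_def)
  have 1: "runs (While (\<lambda>r. r d = 1) (prog_cmd p ;; move_head d Right)) (\<sigma> 0)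
      (n * (poly (prog_time p) n + 1 + 2) + 1) (\<sigma> n)"
  proof (rule runs_While, rule conjI)
    fix i assume i: "i < n"
    then show "reads (\<sigma> i) d = 1"
      using d by (simp add: \<sigma>_def mm_def Let_def counter_def)
    show "runs (prog_cmd p ;; move_head d Right) (\<sigma> i) (poly (prog_time p) n + 1) (\<sigma> (Suc i))"
    proof (rule runs_Seq)
      show "runs (prog_cmd p) (\<sigma> i) (poly (prog_time p) n) (mm (b(d := (counter n, int i))) (Suc i))"
      proof -
        have "(b(d := (counter n, int i))) (5 + d') = (counter n, 0)" if "d' < depth p" for d'
          using Loop.prems[of d'] that by (simp add: d_def)
        from Loop.IH[where b = "b(d := (counter n, int i))" and M = "(sem n p ^^ i) M", OF this] show ?thesis
          by (simp add: \<sigma>_def mm_def Let_def del: fun_upd_apply)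
      qed
      show "runs (move_head d Right) (mm (b(d := (counter n, int i))) (Suc i)) 1 (\<sigma> (Suc i))"
        unfolding \<sigma>_def mm_def Let_def
        by (rule runs_move_head[OF d fun_upd_same]) (auto simp: add.commute)
    qed
  qed (use d in \<open>simp add: \<sigma>_def mm_def Let_def counter_def\<close>)
  have 2: "runs (move_head d Left) (\<sigma> n) 1 (\<tau> 0)"
    unfolding \<sigma>_def \<tau>_def mm_def Let_def by (rule runs_move_head[OF d fun_upd_same]) auto
  have 3: "runs (While (\<lambda>r. r d = 1) (move_head d Left)) (\<tau> 0) (n * (1 + 2) + 1) (\<tau> n)"
  proof (rule runs_While, rule conjI)
    fix i assume i: "i < n"
    then show "reads (\<tau> i) d = 1"
      using d by (simp add: \<tau>_def mm_def Let_def counter_def)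
    show "runs (move_head d Left) (\<tau> i) 1 (\<tau> (Suc i))"
      unfolding \<tau>_def mm_def Let_def by (rule runs_move_head[OF d fun_upd_same]) (auto simp: algebra_simps)
  qed (use d in \<open>simp add: \<tau>_def mm_def Let_def counter_def\<close>)
  have 4: "runs (move_head d Right) (\<tau> n) 1 (mm b n)"
    unfolding \<tau>_def mm_def Let_def by (rule runs_move_head[OF d fun_upd_same]) (use bd in \<open>auto simp: fun_upd_idem\<close>)
  have "runs (prog_cmd (Loop p)) (\<sigma> 0)
      ((n * (poly (prog_time p) n + 1 + 2) + 1) + (1 + ((n * (1 + 2) + 1) + 1))) (mm b n)"
    unfolding prog_cmd.simps d_def[symmetric] Let_def
    by (intro runs_Seq[OF 1 runs_Seq[OF 2 runs_Seq[OF 3 4]]])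
  then show ?case
    by (rule runs_eq) (use bd in \<open>simp_all add: \<sigma>_def mm_def Let_def fun_upd_idem algebra_simps\<close>)
qed

lemma wf_pass_cmd:
  fixes g :: "'c::countable \<Rightarrow> 'c \<Rightarrow> 'c \<Rightarrow> 'c"
  assumes "3 < K" "\<And>c::'c. cell_sym c < S"
  shows "wf_cmd K S (pass_cmd g)"
proof -
  have lt: "Suc 0 < K" "2 < K" "3 < K" using assms(1) by auto
  have sym: "\<forall>j<K. r j = r' j \<Longrightarrow> r (Suc 0) = r' (Suc 0) \<and> r 2 = r' 2 \<and> r 3 = r' 3" for r r' :: "nat \<Rightarrow> nat"
    using lt by simp
  show ?thesis
    unfolding pass_cmd_def pass_row_def pass_next_row_def pass_copy_def wf_cmd.simps
    by (intro conjI wf_Do3[OF assms(1)] allI impI) (use assms(2) lt sym in \<open>simp_all\<close>)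
qed

lemma wf_move_head: "d < K \<Longrightarrow> wf_cmd K S (move_head d m)"
  by (auto simp: move_head_def nop_def)

lemma wf_prog_cmd:
  fixes p :: "'c::countable prog"
  assumes "\<And>c::'c. cell_sym c < S" "5 + depth p \<le> K"
  shows "wf_cmd K S (prog_cmd p)"
  using assms(2)
proof (induction p)
  case (Loop p)
  then show ?case
    by (simp add: Let_def wf_move_head)
qed (use assms(1) in \<open>simp_all add: wf_pass_cmd\<close>)

section \<open>Loading the input\<close>

text \<open>The number of vertices as the machine reads it, defined also for words that encode no
  network.\<close>

definition leading :: "bool list \<Rightarrow> nat" where
  "leading w = length (takeWhile id w)"

text \<open>Positions behind the end count as \<open>False\<close>, just as the machine treats a
  blank. Thus a matrix is loaded from every word, and a wrong length is detected only
  afterwards.\<close>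

definition input_bit :: "bool list \<Rightarrow> nat \<Rightarrow> bool" where
  "input_bit w k \<longleftrightarrow> k < length w \<and> w ! k"

definition inp :: "bool list \<Rightarrow> int \<Rightarrow> nat" where
  "inp w = fst (input_tape w)"

lemma inp_eq_2_iff: "inp w (int k) = 2 \<longleftrightarrow> input_bit w k"
  by (simp add: inp_def input_tape_def input_bit_def)

lemma inp_eq_0_iff: "inp w (int k) = 0 \<longleftrightarrow> length w \<le> k"
  by (simp add: inp_def input_tape_def)

lemma input_bit_leading: "k < leading w \<Longrightarrow> input_bit w k" "\<not> input_bit w (leading w)"
proof -
  have *: "leading w \<le> length w"
    by (simp add: leading_def length_takeWhile_le)
  show "input_bit w k" if "k < leading w"
    using that * nth_mem[of k "takeWhile id w"] set_takeWhileD[of _ id w]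
    by (fastforce simp: leading_def input_bit_def takeWhile_nth)
  show "\<not> input_bit w (leading w)"
    using nth_length_takeWhile[of id w] by (auto simp: leading_def input_bit_def)
qed

text \<open>\<open>Suc n\<close> skips the unary number with its terminating bit; each label takes
  four bits.\<close>

definition entry_pos :: "nat \<Rightarrow> nat \<Rightarrow> nat \<Rightarrow> nat" where
  "entry_pos n x y = Suc n + 4 * (x * n + y)"

text \<open>A matrix entry is computed from its four input bits one bit at a time; the argument of
  \<open>ini\<close> tells whether the entry lies on the diagonal.\<close>

definition load :: "(bool \<Rightarrow> 'c) \<Rightarrow> (nat \<Rightarrow> bool \<Rightarrow> 'c \<Rightarrow> 'c) \<Rightarrow> bool list \<Rightarrow> nat \<Rightarrow> nat \<Rightarrow> 'c" where
  "load ini upd w x y = (let q = entry_pos (leading w) x y in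
     upd 3 (input_bit w (q + 3)) (upd 2 (input_bit w (q + 2)) (upd 1 (input_bit w (q + 1)) (upd 0 (input_bit w q)
       (ini (x = y))))))"

text \<open>The three copies of the matrix are filled in parallel. All tapes from \<open>7\<close>
  on share one content, so the number of loop counters can stay open; tapes \<open>5\<close> and
  \<open>6\<close> also count rows and columns during loading.\<close>

definition ld :: "tape \<Rightarrow> tape \<Rightarrow> tape \<Rightarrow> tape \<Rightarrow> tape \<Rightarrow> tape \<Rightarrow> store" where
  "ld t0 m t4 t5 t6 t7 = (\<lambda>i. if i = 0 then t0 else if i \<le> 3 then m else if i = 4 then t4
     else if i = 5 then t5 else if i = 6 then t6 else t7)"

definition DoL :: "((nat \<Rightarrow> nat) \<Rightarrow> nat \<times> move) \<Rightarrow> ((nat \<Rightarrow> nat) \<Rightarrow> nat \<times> move) \<Rightarrow>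
    ((nat \<Rightarrow> nat) \<Rightarrow> nat \<times> move) \<Rightarrow> ((nat \<Rightarrow> nat) \<Rightarrow> nat \<times> move) \<Rightarrow>
    ((nat \<Rightarrow> nat) \<Rightarrow> nat \<times> move) \<Rightarrow> ((nat \<Rightarrow> nat) \<Rightarrow> nat \<times> move) \<Rightarrow> cmd" where
  "DoL f0 fm f4 f5 f6 f7 = Do (\<lambda>r i. if i = 0 then f0 r else if i \<le> 3 then fm r
     else if i = 4 then f4 r else if i = 5 then f5 r else if i = 6 then f6 r else f7 r)"

lemma reads_ld [simp]:
  "reads (ld t0 m t4 t5 t6 t7) 0 = read_tape t0"
  "reads (ld t0 m t4 t5 t6 t7) 3 = read_tape m"
  "reads (ld t0 m t4 t5 t6 t7) 4 = read_tape t4"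
  "reads (ld t0 m t4 t5 t6 t7) 5 = read_tape t5"
  "reads (ld t0 m t4 t5 t6 t7) 6 = read_tape t6"
  "reads (ld t0 m t4 t5 t6 t7) 7 = read_tape t7"
  by (simp_all add: reads_def ld_def)

lemma runs_DoL:
  assumes "ts = ld t0 m t4 t5 t6 t7" "r = reads ts"
    and "ts' = ld (act (f0 r) t0) (act (fm r) m) (act (f4 r) t4) (act (f5 r) t5) (act (f6 r) t6) (act (f7 r) t7)"
  shows "runs (DoL f0 fm f4 f5 f6 f7) ts 1 ts'"
  unfolding DoL_def by (rule runs_Do) (auto simp: do_acts_def assms(3,2) assms(1) ld_def)

lemma wf_DoL:
  assumes "7 < K"
    and "\<And>r r'. \<forall>j<K. r j = r' j \<Longrightarrow> f0 r = f0 r' \<and> fm r = fm r' \<and> f4 r = f4 r' \<and> f5 r = f5 r' \<and>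
      f6 r = f6 r' \<and> f7 r = f7 r'"
    and "\<And>r. \<forall>j<K. r j < S \<Longrightarrow> fst (f0 r) < S \<and> fst (fm r) < S \<and> fst (f4 r) < S \<and> fst (f5 r) < S \<and>
      fst (f6 r) < S \<and> fst (f7 r) < S"
  shows "wf_cmd K S (DoL f0 fm f4 f5 f6 f7)"
  unfolding DoL_def wf_cmd.simps
proof (intro conjI allI impI)
  fix r r' :: "nat \<Rightarrow> nat" and i assume "\<forall>j<K. r j = r' j" "i < K"
  then show "(if i = 0 then f0 r else if i \<le> 3 then fm r
     else if i = 4 then f4 r else if i = 5 then f5 r else if i = 6 then f6 r else f7 r) =
     (if i = 0 then f0 r' else if i \<le> 3 then fm r'
     else if i = 4 then f4 r' else if i = 5 then f5 r' else if i = 6 then f6 r' else f7 r')"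
    using assms(2)[of r r'] by simp
next
  fix r :: "nat \<Rightarrow> nat" and i assume "\<forall>j<K. r j < S" "i < K"
  then show "fst (if i = 0 then f0 r else if i \<le> 3 then fm r
     else if i = 4 then f4 r else if i = 5 then f5 r else if i = 6 then f6 r else f7 r) < S"
    using assms(3)[of r] by simp
qed

definition load_unary :: cmd where
  "load_unary =
     While (\<lambda>r. r 0 = 2)
       (DoL (go 0 Right) (go 3 Stay) (go 4 Stay) (\<lambda>_. (1, Right)) (\<lambda>_. (1, Right)) (\<lambda>_. (1, Right))) ;;
     DoL (go 0 Right) (go 3 Stay) (\<lambda>_. (1, Stay)) (go 5 Left) (go 6 Left) (go 7 Left) ;;
     While (\<lambda>r. r 5 = 1)
       (DoL (go 0 Stay) (go 3 Stay) (go 4 Stay) (go 5 Left) (go 6 Left) (go 7 Left)) ;;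
     DoL (go 0 Stay) (go 3 Stay) (go 4 Stay) (go 5 Right) (go 6 Right) (go 7 Right)"

definition load_bit :: "('c::countable \<Rightarrow> bool \<Rightarrow> 'c) \<Rightarrow> cmd" where
  "load_bit f = DoL (go 0 Right) (\<lambda>r. (cell_sym (f (sym_cell (r 3)) (r 0 = 2)), Stay))
     (go 4 Stay) (go 5 Stay) (go 6 Stay) (go 7 Stay)"

text \<open>Tape \<open>4\<close> has its only mark at position \<open>0\<close>, and its head is kept at position
  \<open>x - y\<close> in order to recognize the diagonal.\<close>

definition load_cell :: "(bool \<Rightarrow> 'c::countable) \<Rightarrow> (nat \<Rightarrow> bool \<Rightarrow> 'c \<Rightarrow> 'c) \<Rightarrow> cmd" where
  "load_cell ini upd =
     DoL (go 0 Stay) (\<lambda>r. (cell_sym (ini (r 4 = 1)), Stay)) (go 4 Stay) (go 5 Stay) (go 6 Stay) (go 7 Stay) ;;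
     load_bit (\<lambda>c b. upd 0 b c) ;; load_bit (\<lambda>c b. upd 1 b c) ;;
     load_bit (\<lambda>c b. upd 2 b c) ;; load_bit (\<lambda>c b. upd 3 b c) ;;
     DoL (go 0 Stay) (go 3 Right) (go 4 Left) (go 5 Stay) (go 6 Right) (go 7 Stay)"

definition load_row :: "(bool \<Rightarrow> 'c::countable) \<Rightarrow> (nat \<Rightarrow> bool \<Rightarrow> 'c \<Rightarrow> 'c) \<Rightarrow> cmd" where
  "load_row ini upd =
     While (\<lambda>r. r 6 = 1) (load_cell ini upd) ;;
     DoL (go 0 Stay) (\<lambda>_. (3, Right)) (go 4 Right) (go 5 Stay) (go 6 Left) (go 7 Stay) ;;
     While (\<lambda>r. r 6 = 1)
       (DoL (go 0 Stay) (go 3 Stay) (go 4 Right) (go 5 Stay) (go 6 Left) (go 7 Stay)) ;;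
     DoL (go 0 Stay) (go 3 Stay) (go 4 Stay) (go 5 Right) (go 6 Right) (go 7 Stay)"

text \<open>After the matrix has been loaded, the symbols around the head on the input tape tell whether the
  input has the right length; the outcome is recorded on tape \<open>4\<close>.\<close>

definition load_finish :: cmd where
  "load_finish =
     DoL (go 0 Stay) (go 3 Left) (go 4 Stay) (go 5 Left) (go 6 Stay) (go 7 Stay) ;;
     While (\<lambda>r. r 5 = 1)
       (DoL (go 0 Stay) (go 3 Stay) (go 4 Stay) (go 5 Left) (go 6 Stay) (go 7 Stay)) ;;
     DoL (go 0 Stay) (go 3 Stay) (go 4 Stay) (go 5 Right) (go 6 Stay) (go 7 Stay) ;;
     While (\<lambda>r. r 3 \<noteq> 0)
       (DoL (go 0 Stay) (go 3 Left) (go 4 Stay) (go 5 Stay) (go 6 Stay) (go 7 Stay)) ;;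
     DoL (go 0 Stay) (go 3 Right) (go 4 Stay) (go 5 Stay) (go 6 Stay) (go 7 Stay) ;;
     DoL (go 0 Left) (go 3 Stay) (\<lambda>r. (if r 0 = 0 then 0 else 2, Stay)) (go 5 Stay) (go 6 Stay) (go 7 Stay) ;;
     DoL (go 0 Stay) (go 3 Stay) (\<lambda>r. (if r 0 = 0 then 2 else r 4, Stay)) (go 5 Stay) (go 6 Stay) (go 7 Stay)"

abbreviation blank :: "int \<Rightarrow> nat" where
  "blank \<equiv> \<lambda>_. 0"

definition diag :: "int \<Rightarrow> nat" where
  "diag = blank(0 := 1)"

lemma counter_Suc: "(counter n)(int n := 1) = counter (Suc n)"
  by (auto simp: counter_def fun_eq_iff)

lemma counter_simps [simp]:
  "i < n \<Longrightarrow> counter n (int i) = 1"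
  "counter n (int n) = 0"
  "i < n \<Longrightarrow> counter n (int n - 1 - int i) = 1"
  "counter n (- 1) = 0"
  "counter 0 = blank"
  by (auto simp: counter_def)

lemma runs_load_unary:
  assumes n: "n = leading w"
  shows "runs load_unary ((\<lambda>_. (blank, 0))(0 := input_tape w)) (6 * n + 4)
    (ld (inp w, int (Suc n)) (blank, 0) (diag, 0) (counter n, 0) (counter n, 0) (counter n, 0))"
proof -
  define \<sigma> where "\<sigma> i = ld (inp w, int i) (blank, 0) (blank, 0)
    (counter i, int i) (counter i, int i) (counter i, int i)" for i
  define \<tau> where "\<tau> i = ld (inp w, int (Suc n)) (blank, 0) (diag, 0)
    (counter n, int n - 1 - int i) (counter n, int n - 1 - int i) (counter n, int n - 1 - int i)" for i
  have 1: "runs (While (\<lambda>r. r 0 = 2)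
       (DoL (go 0 Right) (go 3 Stay) (go 4 Stay) (\<lambda>_. (1, Right)) (\<lambda>_. (1, Right)) (\<lambda>_. (1, Right))))
       (\<sigma> 0) (n * (1 + 2) + 1) (\<sigma> n)"
  proof (rule runs_While, rule conjI)
    fix i assume "i < n"
    then show "reads (\<sigma> i) 0 = 2"
      by (simp add: \<sigma>_def inp_eq_2_iff n input_bit_leading)
    show "runs (DoL (go 0 Right) (go 3 Stay) (go 4 Stay) (\<lambda>_. (1, Right)) (\<lambda>_. (1, Right)) (\<lambda>_. (1, Right)))
        (\<sigma> i) 1 (\<sigma> (Suc i))"
      by (rule runs_DoL[OF \<sigma>_def refl]) (simp add: \<sigma>_def counter_Suc[unfolded One_nat_def] fun_upd_idem add.commute)
  qed (simp add: \<sigma>_def inp_eq_2_iff n input_bit_leading)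
  have 2: "runs (DoL (go 0 Right) (go 3 Stay) (\<lambda>_. (1, Stay)) (go 5 Left) (go 6 Left) (go 7 Left))
      (\<sigma> n) 1 (\<tau> 0)"
    by (rule runs_DoL[OF \<sigma>_def refl]) (simp add: \<sigma>_def \<tau>_def fun_upd_idem add.commute diag_def)
  have 3: "runs (While (\<lambda>r. r 5 = 1)
       (DoL (go 0 Stay) (go 3 Stay) (go 4 Stay) (go 5 Left) (go 6 Left) (go 7 Left)))
       (\<tau> 0) (n * (1 + 2) + 1) (\<tau> n)"
  proof (rule runs_While, rule conjI)
    fix i assume "i < n"
    then show "reads (\<tau> i) 5 = 1"
      by (simp add: \<tau>_def)
    show "runs (DoL (go 0 Stay) (go 3 Stay) (go 4 Stay) (go 5 Left) (go 6 Left) (go 7 Left))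
        (\<tau> i) 1 (\<tau> (Suc i))"
      by (rule runs_DoL[OF \<tau>_def refl]) (simp add: \<tau>_def fun_upd_idem algebra_simps)
  qed (simp add: \<tau>_def)
  have 4: "runs (DoL (go 0 Stay) (go 3 Stay) (go 4 Stay) (go 5 Right) (go 6 Right) (go 7 Right))
      (\<tau> n) 1 (ld (inp w, int (Suc n)) (blank, 0) (diag, 0) (counter n, 0) (counter n, 0) (counter n, 0))"
    by (rule runs_DoL[OF \<tau>_def refl]) (simp add: \<tau>_def fun_upd_idem)
  have "\<sigma> 0 = (\<lambda>_. (blank, 0))(0 := input_tape w)"
    by (auto simp: \<sigma>_def ld_def inp_def input_tape_def)
  then show ?thesis
    unfolding load_unary_def
    by (intro runs_eq[OF runs_Seq[OF 1 runs_Seq[OF 2 runs_Seq[OF 3 4]]]]) simp_all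
qed

context
  fixes ini :: "bool \<Rightarrow> 'c::countable" and upd :: "nat \<Rightarrow> bool \<Rightarrow> 'c \<Rightarrow> 'c"
    and w :: "bool list" and n :: nat and M :: "nat \<Rightarrow> nat \<Rightarrow> 'c"
  assumes n: "n = leading w" and M: "M = load ini upd w"
begin

definition lstate :: "nat \<Rightarrow> nat \<Rightarrow> store" where
  "lstate x y = ld (inp w, int (entry_pos n x y)) (mix (pos n x y) (mtape n M) blank, pos n x y)
     (diag, int x - int y) (counter n, int x) (counter n, int y) (counter n, 0)"

lemma runs_load_cell:
  assumes "x < n" "y < n"
  shows "runs (load_cell ini upd) (lstate x y) 6 (lstate x (Suc y))"
proof -
  define q where "q = entry_pos n x y"
  define C where "C = mix (pos n x y) (mtape n M) blank"
  define \<sigma> where "\<sigma> j c = ld (inp w, int (q + j)) (C(pos n x y := cell_sym c), pos n x y)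
     (diag, int x - int y) (counter n, int x) (counter n, int y) (counter n, 0)" for j and c :: 'c
  have 1: "runs (DoL (go 0 Stay) (\<lambda>r. (cell_sym (ini (r 4 = 1)), Stay)) (go 4 Stay) (go 5 Stay)
      (go 6 Stay) (go 7 Stay)) (lstate x y) 1 (\<sigma> 0 (ini (x = y)))"
    by (rule runs_DoL[OF lstate_def refl])
      (auto simp: lstate_def \<sigma>_def q_def C_def fun_upd_idem diag_def)
  have bit: "runs (load_bit f) (\<sigma> j c) 1 (\<sigma> (Suc j) (f c (input_bit w (q + j))))" for f j c
    unfolding load_bit_def
    by (rule runs_DoL[OF \<sigma>_def refl])
      (simp add: \<sigma>_def fun_upd_idem inp_eq_2_iff add.commute flip: of_nat_add)
  have c: "(C(pos n x y := cell_sym (M x y))) = mix (pos n x (Suc y)) (mtape n M) blank"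
    using mix_upd[of "pos n x y" "mtape n M" blank] assms by (simp add: C_def)
  have q: "entry_pos n x (Suc y) = q + 4"
    by (simp add: q_def entry_pos_def)
  have e: "int x - int y - 1 = int x - int (Suc y)" "int y + 1 = int (Suc y)"
      "int q + 4 = int (Suc (Suc (Suc (Suc q))))"
    by simp_all
  have 2: "runs (DoL (go 0 Stay) (go 3 Right) (go 4 Left) (go 5 Stay) (go 6 Right) (go 7 Stay))
      (\<sigma> (Suc (Suc (Suc (Suc 0)))) (M x y)) 1 (lstate x (Suc y))"
    by (rule runs_DoL[OF \<sigma>_def refl])
      (simp add: \<sigma>_def lstate_def q c[symmetric] fun_upd_idem e del: of_nat_Suc)
  have M': "M x y = upd 3 (input_bit w (q + Suc (Suc (Suc 0)))) (upd 2 (input_bit w (q + Suc (Suc 0)))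
       (upd 1 (input_bit w (q + Suc 0)) (upd 0 (input_bit w (q + 0)) (ini (x = y)))))"
    by (simp add: M load_def Let_def q_def n numeral_3_eq_3 numeral_2_eq_2)
  have "runs (load_cell ini upd) (lstate x y) (1 + (1 + (1 + (1 + (1 + 1))))) (lstate x (Suc y))"
    unfolding load_cell_def
    by (rule runs_Seq[OF 1 runs_Seq[OF bit[where f = "\<lambda>c b. upd 0 b c"]
      runs_Seq[OF bit[where f = "\<lambda>c b. upd 1 b c"] runs_Seq[OF bit[where f = "\<lambda>c b. upd 2 b c"]
      runs_Seq[OF bit[where f = "\<lambda>c b. upd 3 b c"] 2[unfolded M']]]]]])
  then show ?thesis by (rule runs_eq) simp_all
qed

text \<open>At the end of the row the head of tape \<open>4\<close> is at \<open>x - n\<close>; the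
  \<open>n + 1\<close> moves to the right made while the column counter is rewound bring it to
  \<open>Suc x\<close>, as needed for the next row.\<close>

lemma runs_load_row:
  assumes "x < n"
  shows "runs (load_row ini upd) (lstate x 0) (11 * n + 4) (lstate (Suc x) 0)"
proof -
  define \<tau> where "\<tau> i = ld (inp w, int (entry_pos n (Suc x) 0))
     (mix (pos n (Suc x) 0) (mtape n M) blank, pos n (Suc x) 0)
     (diag, int x - int n + 1 + int i) (counter n, int x) (counter n, int n - 1 - int i) (counter n, 0)" for i
  have 1: "runs (While (\<lambda>r. r 6 = 1) (load_cell ini upd)) (lstate x 0) (n * (6 + 2) + 1) (lstate x n)"
  proof (rule runs_While, rule conjI)
    fix y assume y: "y < n"
    then show "reads (lstate x y) 6 = 1" by (simp add: lstate_def)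
    show "runs (load_cell ini upd) (lstate x y) 6 (lstate x (Suc y))"
      by (rule runs_load_cell[OF assms y])
  qed (simp add: lstate_def)
  have c: "(mix (pos n x n) (mtape n M) blank)(pos n x n := 3) = mix (pos n (Suc x) 0) (mtape n M) blank"
    using mix_upd[of "pos n x n" "mtape n M" blank] assms by simp
  have q: "entry_pos n (Suc x) 0 = entry_pos n x n"
    by (simp add: entry_pos_def)
  have 2: "runs (DoL (go 0 Stay) (\<lambda>_. (3, Right)) (go 4 Right) (go 5 Stay) (go 6 Left) (go 7 Stay))
      (lstate x n) 1 (\<tau> 0)"
    by (rule runs_DoL[OF lstate_def refl])
      (simp add: lstate_def \<tau>_def q c fun_upd_idem)
  have 3: "runs (While (\<lambda>r. r 6 = 1)
       (DoL (go 0 Stay) (go 3 Stay) (go 4 Right) (go 5 Stay) (go 6 Left) (go 7 Stay)))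
       (\<tau> 0) (n * (1 + 2) + 1) (\<tau> n)"
  proof (rule runs_While, rule conjI)
    fix i assume "i < n"
    then show "reads (\<tau> i) 6 = 1"
      by (simp add: \<tau>_def)
    show "runs (DoL (go 0 Stay) (go 3 Stay) (go 4 Right) (go 5 Stay) (go 6 Left) (go 7 Stay))
        (\<tau> i) 1 (\<tau> (Suc i))"
      by (rule runs_DoL[OF \<tau>_def refl]) (simp add: \<tau>_def fun_upd_idem algebra_simps)
  qed (simp add: \<tau>_def)
  have 4: "runs (DoL (go 0 Stay) (go 3 Stay) (go 4 Stay) (go 5 Right) (go 6 Right) (go 7 Stay))
      (\<tau> n) 1 (lstate (Suc x) 0)"
    by (rule runs_DoL[OF \<tau>_def refl]) (simp add: \<tau>_def lstate_def fun_upd_idem algebra_simps)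
  show ?thesis
    unfolding load_row_def
    by (rule runs_eq[OF runs_Seq[OF 1 runs_Seq[OF 2 runs_Seq[OF 3 4]]]]) simp_all
qed

lemma runs_load_finish:
  "\<exists>t0 t4. runs load_finish (lstate n 0) (3 * n + 3 * (n * Suc n) + 7)
     (ld t0 (mtape n M, 0) t4 (counter n, 0) (counter n, 0) (counter n, 0)) \<and>
     (read_tape t4 = 0 \<longleftrightarrow> length w = Suc n + 4 * (n * n))"
proof -
  let ?p = "entry_pos n n 0" and ?N = "n * Suc n"
  have N: "pos n n 0 = int ?N" by (simp add: pos_def)
  have mix: "mix (pos n n 0) (mtape n M) blank = mtape n M"
    by (auto simp: mix_def mtape_def fun_eq_iff)
  define \<sigma> where "\<sigma> i = ld (inp w, int ?p) (mtape n M, pos n n 0 - 1)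
     (diag, int n) (counter n, int n - 1 - int i) (counter n, 0) (counter n, 0)" for i
  define \<tau> where "\<tau> i = ld (inp w, int ?p) (mtape n M, pos n n 0 - 1 - int i)
     (diag, int n) (counter n, 0) (counter n, 0) (counter n, 0)" for i
  \<comment> \<open>A blank at \<open>?p\<close> means that the input is not too long, a nonblank
    symbol just before \<open>?p\<close> that it is not too short. The outcome is \<open>0\<close>
    iff both hold.\<close>
  define s where "s = (if inp w (int ?p) = 0 then 0 else 2 :: nat)"
  define s' where "s' = (if inp w (int ?p - 1) = 0 then 2 else s)"
  have 1: "runs (DoL (go 0 Stay) (go 3 Left) (go 4 Stay) (go 5 Left) (go 6 Stay) (go 7 Stay))
      (lstate n 0) 1 (\<sigma> 0)"
    by (rule runs_DoL[OF lstate_def refl]) (simp add: lstate_def \<sigma>_def mix fun_upd_idem)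
  have 2: "runs (While (\<lambda>r. r 5 = 1)
       (DoL (go 0 Stay) (go 3 Stay) (go 4 Stay) (go 5 Left) (go 6 Stay) (go 7 Stay)))
       (\<sigma> 0) (n * (1 + 2) + 1) (\<sigma> n)"
  proof (rule runs_While, rule conjI)
    fix i assume "i < n"
    then show "reads (\<sigma> i) 5 = 1"
      by (simp add: \<sigma>_def)
    show "runs (DoL (go 0 Stay) (go 3 Stay) (go 4 Stay) (go 5 Left) (go 6 Stay) (go 7 Stay))
        (\<sigma> i) 1 (\<sigma> (Suc i))"
      by (rule runs_DoL[OF \<sigma>_def refl]) (simp add: \<sigma>_def fun_upd_idem algebra_simps)
  qed (simp add: \<sigma>_def)
  have 3: "runs (DoL (go 0 Stay) (go 3 Stay) (go 4 Stay) (go 5 Right) (go 6 Stay) (go 7 Stay))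
      (\<sigma> n) 1 (\<tau> 0)"
    by (rule runs_DoL[OF \<sigma>_def refl]) (simp add: \<sigma>_def \<tau>_def fun_upd_idem)
  have 4: "runs (While (\<lambda>r. r 3 \<noteq> 0)
       (DoL (go 0 Stay) (go 3 Left) (go 4 Stay) (go 5 Stay) (go 6 Stay) (go 7 Stay)))
       (\<tau> 0) (?N * (1 + 2) + 1) (\<tau> ?N)"
  proof (rule runs_While, rule conjI)
    fix i assume "i < ?N"
    then have "int i < pos n n 0" unfolding N of_nat_less_iff .
    then show "reads (\<tau> i) 3 \<noteq> 0"
      by (simp add: \<tau>_def mtape_eq_0_iff)
    show "runs (DoL (go 0 Stay) (go 3 Left) (go 4 Stay) (go 5 Stay) (go 6 Stay) (go 7 Stay))
        (\<tau> i) 1 (\<tau> (Suc i))"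
      by (rule runs_DoL[OF \<tau>_def refl]) (simp add: \<tau>_def fun_upd_idem algebra_simps)
  qed (simp add: \<tau>_def N mtape_eq_0_iff)
  have "pos n n 0 - 1 - int ?N = - 1"
    unfolding N by simp
  then have \<tau>: "\<tau> ?N = ld (inp w, int ?p) (mtape n M, - 1) (diag, int n) (counter n, 0) (counter n, 0) (counter n, 0)"
    unfolding \<tau>_def by (simp only:)
  have 5: "runs (DoL (go 0 Stay) (go 3 Right) (go 4 Stay) (go 5 Stay) (go 6 Stay) (go 7 Stay)) (\<tau> ?N) 1
      (ld (inp w, int ?p) (mtape n M, 0) (diag, int n) (counter n, 0) (counter n, 0) (counter n, 0))"
    unfolding \<tau> by (rule runs_DoL[OF refl refl]) (simp add: fun_upd_idem)
  have 6: "runs (DoL (go 0 Left) (go 3 Stay) (\<lambda>r. (if r 0 = 0 then 0 else 2, Stay)) (go 5 Stay) (go 6 Stay) (go 7 Stay))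
      (ld (inp w, int ?p) (mtape n M, 0) (diag, int n) (counter n, 0) (counter n, 0) (counter n, 0)) 1
      (ld (inp w, int ?p - 1) (mtape n M, 0) (diag(int n := s), int n) (counter n, 0) (counter n, 0) (counter n, 0))"
    by (rule runs_DoL[OF refl refl]) (simp add: s_def fun_upd_idem)
  have 7: "runs (DoL (go 0 Stay) (go 3 Stay) (\<lambda>r. (if r 0 = 0 then 2 else r 4, Stay)) (go 5 Stay) (go 6 Stay) (go 7 Stay))
      (ld (inp w, int ?p - 1) (mtape n M, 0) (diag(int n := s), int n) (counter n, 0) (counter n, 0) (counter n, 0)) 1
      (ld (inp w, int ?p - 1) (mtape n M, 0) (diag(int n := s'), int n) (counter n, 0) (counter n, 0) (counter n, 0))"
    by (rule runs_DoL[OF refl refl]) (simp add: s'_def fun_upd_idem)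
  have p: "?p = Suc n + 4 * (n * n)"
    by (simp add: entry_pos_def)
  have "int ?p - 1 = int (?p - 1)"
    unfolding p by simp
  then have "inp w (int ?p - 1) = 0 \<longleftrightarrow> length w \<le> ?p - 1"
    by (simp only: inp_eq_0_iff)
  then have "s' = 0 \<longleftrightarrow> length w \<le> ?p \<and> \<not> length w \<le> ?p - 1"
    unfolding s'_def s_def inp_eq_0_iff by simp
  also have "\<dots> \<longleftrightarrow> length w = Suc n + 4 * (n * n)"
    unfolding p by linarith
  finally have "s' = 0 \<longleftrightarrow> length w = Suc n + 4 * (n * n)" .
  moreover have "runs load_finish (lstate n 0) (3 * n + 3 * (n * Suc n) + 7)
     (ld (inp w, int ?p - 1) (mtape n M, 0) (diag(int n := s'), int n) (counter n, 0) (counter n, 0) (counter n, 0))"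
    unfolding load_finish_def
    by (rule runs_eq[OF runs_Seq[OF 1 runs_Seq[OF 2 runs_Seq[OF 3 runs_Seq[OF 4 runs_Seq[OF 5
      runs_Seq[OF 6 7]]]]]]]) simp_all
  ultimately show ?thesis
    by (intro exI[of _ "(inp w, int ?p - 1)"] exI[of _ "(diag(int n := s'), int n)"]) simp
qed

lemma runs_load:
  "\<exists>t0 t4. runs (load_unary ;; While (\<lambda>r. r 5 = 1) (load_row ini upd) ;; load_finish)
     ((\<lambda>_. (\<lambda>_. 0, 0))(0 := input_tape w))
     (14 * (n * n) + 18 * n + 12)
     (ld t0 (mtape n M, 0) t4 (counter n, 0) (counter n, 0) (counter n, 0)) \<and>
     (read_tape t4 = 0 \<longleftrightarrow> length w = Suc n + 4 * (n * n))"
proof -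
  have 0: "mix 0 (mtape n M) blank = blank"
    by (auto simp: mix_def fun_eq_iff)
  have 1: "runs load_unary ((\<lambda>_. (\<lambda>_. 0, 0))(0 := input_tape w)) (6 * n + 4) (lstate 0 0)"
    by (rule runs_eq[OF runs_load_unary[OF n]]) (simp_all add: lstate_def 0 entry_pos_def)
  have 2: "runs (While (\<lambda>r. r 5 = 1) (load_row ini upd)) (lstate 0 0) (n * (11 * n + 4 + 2) + 1) (lstate n 0)"
  proof (rule runs_While[where \<sigma> = "\<lambda>x. lstate x 0"], rule conjI)
    fix x assume x: "x < n"
    then show "reads (lstate x 0) 5 = 1" by (simp add: lstate_def)
    show "runs (load_row ini upd) (lstate x 0) (11 * n + 4) (lstate (Suc x) 0)"
      by (rule runs_load_row[OF x])
  qed (simp add: lstate_def)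
  obtain t0 t4 where 3: "runs load_finish (lstate n 0) (3 * n + 3 * (n * Suc n) + 7)
     (ld t0 (mtape n M, 0) t4 (counter n, 0) (counter n, 0) (counter n, 0))"
    and t4: "read_tape t4 = 0 \<longleftrightarrow> length w = Suc n + 4 * (n * n)"
    using runs_load_finish by (elim exE conjE)
  have "runs (load_unary ;; While (\<lambda>r. r 5 = 1) (load_row ini upd) ;; load_finish)
     ((\<lambda>_. (\<lambda>_. 0, 0))(0 := input_tape w))
     (14 * (n * n) + 18 * n + 12)
     (ld t0 (mtape n M, 0) t4 (counter n, 0) (counter n, 0) (counter n, 0))"
    by (rule runs_eq[OF runs_Seq[OF 1 runs_Seq[OF 2 3]]]) (simp_all add: algebra_simps)
  from this t4 show ?thesis by (intro exI conjI)
qed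

end

text \<open>The scan stops at the first bad cell or at the blank behind the matrix, so the symbol
  under the head is the verdict.\<close>

definition check_cmd :: "('c::countable \<Rightarrow> bool) \<Rightarrow> cmd" where
  "check_cmd ok = While (\<lambda>r. r 3 = 3 \<or> 3 < r 3 \<and> ok (sym_cell (r 3)))
     (Do3 (go 1 Stay) (go 2 Stay) (go 3 Right))"

lemma cell_pos:
  assumes "i < n * Suc n"
  obtains x y where "x < n" "y \<le> n" "int i = pos n x y"
proof
  show "i div Suc n < n" using assms by (simp add: less_mult_imp_div_less)
  show "i mod Suc n \<le> n" using mod_less_divisor[of "Suc n" i] by simp
  show "int i = pos n (i div Suc n) (i mod Suc n)"
    unfolding pos_def by (simp only: div_mult_mod_eq)
qed

lemma runs_check_cmd:
  "\<exists>tc. runs (check_cmd ok) (mk b ta tb (mtape n M, 0)) (n * Suc n * 3 + 1) (mk b ta tb tc) \<and>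
    (read_tape tc = 0 \<longleftrightarrow> (\<forall>x<n. \<forall>y<n. ok (M x y)))"
proof -
  define good where "good i \<longleftrightarrow> mtape n M (int i) = 3 \<or> 3 < mtape n M (int i) \<and> ok (sym_cell (mtape n M (int i)))" for i
  have "int (n * Suc n) = pos n n 0"
    by (simp add: pos_def)
  then have "\<not> good (n * Suc n)"
    by (simp only: good_def mtape_end) simp
  then obtain k where k: "\<not> good k" "\<And>i. i < k \<Longrightarrow> good i" "k \<le> n * Suc n"
    using exists_least_iff[of "\<lambda>i. \<not> good i"] by (metis not_le_imp_less)
  define \<sigma> where "\<sigma> i = mk b ta tb (mtape n M, int i)" for i
  have "runs (check_cmd ok) (\<sigma> 0) (k * (1 + 2) + 1) (\<sigma> k)"
    unfolding check_cmd_def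
  proof (rule runs_While, rule conjI)
    fix i assume "i < k"
    from k(2)[OF this] show "reads (\<sigma> i) 3 = 3 \<or> 3 < reads (\<sigma> i) 3 \<and> ok (sym_cell (reads (\<sigma> i) 3))"
      by (simp add: \<sigma>_def good_def)
    show "runs (Do3 (go 1 Stay) (go 2 Stay) (go 3 Right)) (\<sigma> i) 1 (\<sigma> (Suc i))"
      by (rule runs_Do3[OF \<sigma>_def refl]) (simp add: \<sigma>_def fun_upd_idem add.commute)
  qed (use k(1) in \<open>simp add: \<sigma>_def good_def\<close>)
  moreover have "k * (1 + 2) + 1 \<le> n * Suc n * 3 + 1"
    using k(3) by simp
  ultimately have 1: "runs (check_cmd ok) (\<sigma> 0) (n * Suc n * 3 + 1) (\<sigma> k)"
    by (rule runs_mono)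
  have "mtape n M (int k) = 0 \<longleftrightarrow> (\<forall>x<n. \<forall>y<n. ok (M x y))"
  proof
    assume "mtape n M (int k) = 0"
    then have "pos n n 0 \<le> int k"
      by (simp add: mtape_eq_0_iff)
    then have ge: "n * Suc n \<le> k"
      unfolding pos_def of_nat_le_iff by simp
    show "\<forall>x<n. \<forall>y<n. ok (M x y)"
    proof (intro allI impI)
      fix x y assume xy: "x < n" "y < n"
      then have "x * Suc n + y < k"
        using pos_less[of x n y] ge unfolding pos_def of_nat_less_iff by linarith
      from k(2)[OF this] xy show "ok (M x y)"
        by (simp add: good_def pos_def[symmetric] del: of_nat_add of_nat_mult of_nat_Suc mult_Suc_right)
    qed
  next
    assume ok: "\<forall>x<n. \<forall>y<n. ok (M x y)"
    have "good i" if "i < n * Suc n" for i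
    proof -
      obtain x y where "x < n" "y \<le> n" "int i = pos n x y"
        using \<open>i < n * Suc n\<close> by (rule cell_pos)
      then show ?thesis
        using ok by (cases "y = n") (simp_all add: good_def)
    qed
    with k(1,3) have "k = n * Suc n"
      using nat_less_le by blast
    then show "mtape n M (int k) = 0"
      by (simp add: mtape_eq_0_iff pos_def)
  qed
  then show ?thesis
    using 1 by (intro exI[of _ "(mtape n M, int k)"]) (simp add: \<sigma>_def)
qed

theorem in_P_sweep:
  fixes p :: "'c::finite prog"
  assumes L: "\<And>w. w \<in> L \<longleftrightarrow> length w = Suc (leading w) + 4 * (leading w * leading w) \<and>
    (\<forall>x<leading w. \<forall>y<leading w. ok (sem (leading w) p (load ini upd w) x y))"
  shows "in_P L"
proof -
  define c where "c = (load_unary ;; While (\<lambda>r. r 5 = 1) (load_row ini upd) ;; load_finish) ;;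
    prog_cmd p ;; check_cmd ok"
  \<comment> \<open>Loading needs the tapes \<open>0\<close> to \<open>7\<close>, the loops need
    \<open>5 + depth p\<close> tapes; the bound covers both.\<close>
  define K where "K = 8 + depth p"
  define S where "S = 5 + Max (range (to_nat :: 'c \<Rightarrow> nat))"
  \<comment> \<open>The outer polynomials are the times for loading and for the final scan.\<close>
  define T where "T = [:12, 18, 14:] + (prog_time p + [:1, 3, 3:])"
  have S: "cell_sym c < S" for c :: 'c
  proof -
    have "to_nat c \<le> Max (range (to_nat :: 'c \<Rightarrow> nat))"
      by (intro Max_ge) auto
    then show ?thesis unfolding cell_sym_def S_def by linarith
  qed
  have S5: "5 \<le> S" by (simp add: S_def)
  have lt: "0 < K" "Suc 0 < K" "2 < K" "3 < K" "4 < K" "5 < K" "6 < K" "7 < K"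
    by (simp_all add: K_def)
  have agree: "\<forall>j<K. r j = r' j \<Longrightarrow> r 0 = r' 0 \<and> r (Suc 0) = r' (Suc 0) \<and> r 2 = r' 2 \<and> r 3 = r' 3 \<and>
      r 4 = r' 4 \<and> r 5 = r' 5 \<and> r 6 = r' 6 \<and> r 7 = r' 7" for r r' :: "nat \<Rightarrow> nat"
    using lt by simp
  have wf: "wf_cmd K S c"
    unfolding c_def load_unary_def load_row_def load_cell_def load_bit_def load_finish_def
      check_cmd_def wf_cmd.simps(2,3)
    by (intro conjI wf_DoL[OF lt(8)] wf_Do3[OF lt(4)] wf_prog_cmd allI impI)
      (use S S5 lt agree in \<open>simp_all add: K_def\<close>)
  show ?thesis
  \<comment> \<open>Tape \<open>3\<close> shows a blank iff all cells are good, tape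
    \<open>4\<close> iff the length of the input is right.\<close>
  proof (rule in_P_runs[OF wf, where acc = "\<lambda>r. r 3 = 0 \<and> r 4 = 0" and p = T])
    fix w
    define n where "n = leading w"
    define M where "M = load ini upd w"
    obtain t0 t4 where 1: "runs (load_unary ;; While (\<lambda>r. r 5 = 1) (load_row ini upd) ;; load_finish)
       ((\<lambda>_. (\<lambda>_. 0, 0))(0 := input_tape w)) (14 * (n * n) + 18 * n + 12)
       (ld t0 (mtape n M, 0) t4 (counter n, 0) (counter n, 0) (counter n, 0))"
      and t4: "read_tape t4 = 0 \<longleftrightarrow> length w = Suc n + 4 * (n * n)"
      using runs_load[OF n_def M_def] by (elim exE conjE)
    define b where "b = ld t0 (mtape n M, 0) t4 (counter n, 0) (counter n, 0) (counter n, 0)"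
    define M' where "M' = sem n p M"
    have b: "b = mk b (mtape n M, 0) (mtape n M, 0) (mtape n M, 0)"
      by (auto simp: mk_def b_def ld_def fun_eq_iff)
    have 2: "runs (prog_cmd p) b (poly (prog_time p) n) (mk b (mtape n M', 0) (mtape n M', 0) (mtape n M', 0))"
      unfolding M'_def by (subst (1) b, rule runs_prog_cmd) (simp add: b_def ld_def)
    obtain tc where 3: "runs (check_cmd ok) (mk b (mtape n M', 0) (mtape n M', 0) (mtape n M', 0))
        (n * Suc n * 3 + 1) (mk b (mtape n M', 0) (mtape n M', 0) tc)"
      and tc: "read_tape tc = 0 \<longleftrightarrow> (\<forall>x<n. \<forall>y<n. ok (M' x y))"
      using runs_check_cmd[of ok b "(mtape n M', 0)" "(mtape n M', 0)" n M'] by (elim exE conjE)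
    have "runs c ((\<lambda>_. (\<lambda>_. 0, 0))(0 := input_tape w)) (poly T n) (mk b (mtape n M', 0) (mtape n M', 0) tc)"
      using runs_Seq[OF 1 runs_Seq[OF 2[unfolded b_def] 3[unfolded b_def]]]
      unfolding c_def b_def T_def by (simp add: algebra_simps)
    moreover have "poly T n \<le> poly T (length w)"
      by (rule poly_nat_mono) (simp add: n_def leading_def length_takeWhile_le)
    ultimately have 4: "runs c ((\<lambda>_. (\<lambda>_. 0, 0))(0 := input_tape w)) (poly T (length w))
        (mk b (mtape n M', 0) (mtape n M', 0) tc)"
      by (rule runs_mono)
    have "reads (mk b (mtape n M', 0) (mtape n M', 0) tc) 4 = read_tape t4"
      by (simp add: reads_def mk_def b_def ld_def)
    moreover have "read_tape tc = 0 \<and> read_tape t4 = 0 \<longleftrightarrow> w \<in> L"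
      unfolding tc t4 L[of w] n_def M'_def M_def by (rule conj_commute)
    ultimately show "\<exists>ts. runs c ((\<lambda>_. (\<lambda>_. 0, 0))(0 := input_tape w)) (poly T (length w)) ts \<and>
        ((reads ts 3 = 0 \<and> reads ts 4 = 0) \<longleftrightarrow> w \<in> L)"
      using 4 by (intro exI[of _ "mk b (mtape n M', 0) (mtape n M', 0) tc"] conjI) simp_all
  qed (use lt S5 in \<open>auto\<close>)
qed

section \<open>Colourings without rainbow triangles\<close>

text \<open>Atoms other than \<open>Idt\<close> are colours of edges; \<open>Idt\<close> marks pairs of identified vertices.\<close>

definition gallai :: "'v set \<Rightarrow> ('v \<Rightarrow> 'v \<Rightarrow> atom) \<Rightarrow> bool" where
  "gallai V g \<longleftrightarrow> (\<forall>x\<in>V. g x x = Idt) \<and> (\<forall>x\<in>V. \<forall>y\<in>V. g x y = g y x) \<and>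
     (\<forall>x\<in>V. \<forall>y\<in>V. \<forall>z\<in>V. atom_le_comp (g x z) (g x y) (g y z))"

lemma gallai_refl: "gallai V g \<Longrightarrow> x \<in> V \<Longrightarrow> g x x = Idt"
  and gallai_sym: "gallai V g \<Longrightarrow> x \<in> V \<Longrightarrow> y \<in> V \<Longrightarrow> g x y = g y x"
  and gallai_triangle: "gallai V g \<Longrightarrow> x \<in> V \<Longrightarrow> y \<in> V \<Longrightarrow> z \<in> V \<Longrightarrow>
    atom_le_comp (g x z) (g x y) (g y z)"
  by (auto simp: gallai_def)

lemma gallai_subset: "gallai V g \<Longrightarrow> W \<subseteq> V \<Longrightarrow> gallai W g"
  by (auto simp: gallai_def subset_iff)

lemma gallai_Idt:
  assumes "gallai V g" "x \<in> V" "y \<in> V" "z \<in> V" "g x y = Idt"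
  shows "g x z = g y z"
  using gallai_triangle[OF assms(1-4)] assms(5) by (simp add: atom_le_comp_def)

lemma gallai_isosceles:
  assumes "gallai V g" "x \<in> V" "y \<in> V" "z \<in> V"
    and "g x z \<noteq> g x y" "g y z \<noteq> g x y" "g x z \<noteq> Idt" "g y z \<noteq> Idt"
  shows "g x z = g y z"
  using gallai_triangle[OF assms(1-4)] assms(5-8) by (auto simp: atom_le_comp_def split: if_splits)

text \<open>\<open>Idt\<close> is added to every colour, so that identified vertices lie in the same
  component.\<close>

definition link :: "'v set \<Rightarrow> ('v \<Rightarrow> 'v \<Rightarrow> atom) \<Rightarrow> atom \<Rightarrow> ('v \<times> 'v) set" where
  "link W g c = {(x, y). x \<in> W \<and> y \<in> W \<and> g x y \<in> {c, Idt}}"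

section \<open>Connected components of one colour and Gallai's theorem\<close>

lemma link_sym: "gallai W g \<Longrightarrow> sym ((link W g c)\<^sup>*)"
  by (intro sym_rtrancl) (auto simp: sym_def link_def gallai_sym)

lemma linkI: "x \<in> W \<Longrightarrow> y \<in> W \<Longrightarrow> g x y \<in> {c, Idt} \<Longrightarrow> (x, y) \<in> (link W g c)\<^sup>*"
  by (auto simp: link_def)

lemma link_in: "(x, y) \<in> (link W g c)\<^sup>* \<Longrightarrow> x \<in> W \<Longrightarrow> y \<in> W"
  by (induction rule: rtrancl_induct) (auto simp: link_def)

text \<open>The connected components of \<open>link W g c\<close> are modules of the colouring.\<close>

lemma link_module:
  assumes g: "gallai W g" and "(x, x') \<in> (link W g c)\<^sup>*" "x \<in> W" "y \<in> W" "(x, y) \<notin> (link W g c)\<^sup>*"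
  shows "g x y = g x' y"
  using assms(2)
proof (induction rule: rtrancl_induct)
  case (step x' x'')
  have x: "x' \<in> W" "x'' \<in> W" "g x' x'' \<in> {c, Idt}"
    using step.hyps(2) by (auto simp: link_def)
  have nl: "(x', y) \<notin> (link W g c)\<^sup>*" "(x'', y) \<notin> (link W g c)\<^sup>*"
    using step.hyps assms(5) by (meson rtrancl_trans rtrancl.rtrancl_into_rtrancl)+
  then have "g x' y \<notin> {c, Idt}" "g x'' y \<notin> {c, Idt}"
    using linkI[OF x(1) assms(4)] linkI[OF x(2) assms(4)] by blast+
  \<comment> \<open>The edge between \<open>x'\<close> and \<open>x''\<close> has colour
    \<open>c\<close> or \<open>Idt\<close>, and the edges to \<open>y\<close> have neither; a
    triangle that is not rainbow then has equal edges at \<open>y\<close>.\<close>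
  then have "g x' y = g x'' y"
    using gallai_Idt[OF g x(1,2) assms(4)] gallai_isosceles[OF g x(1,2) assms(4)] x(3) by auto
  then show ?case using step.IH by simp
qed simp

text \<open>Replacing \<open>v\<close> by its twin \<open>u\<close> maps paths to paths, so adding
  \<open>v\<close> joins no components.\<close>

lemma link_twin:
  assumes g: "gallai (insert v W) g" and u: "u \<in> W" "g v u = Idt"
    and "(x, y) \<in> (link (insert v W) g c)\<^sup>*"
  shows "((if x = v then u else x), (if y = v then u else y)) \<in> (link W g c)\<^sup>*"
  using assms(4)
proof (induction rule: rtrancl_induct)
  case (step y z)
  have eq: "g v t = g u t" "g t v = g t u" if "t \<in> insert v W" for t
    using gallai_Idt[OF g _ _ that, of v u] gallai_sym[OF g, of t] u that by auto
  have "((if y = v then u else y), (if z = v then u else z)) \<in> link W g c"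
    using step.hyps(2) u(1) eq by (auto simp: link_def)
  with step.IH show ?case by (rule rtrancl_into_rtrancl)
qed simp

lemma link_isolated:
  assumes "v \<notin> W" "\<forall>z\<in>W. g v z \<notin> {c, Idt}" "(v, y) \<in> (link (insert v W) g c)\<^sup>*"
  shows "y = v"
  using assms(3) by (induction rule: rtrancl_induct) (use assms(1,2) in \<open>auto simp: link_def\<close>)

text \<open>Cut the path behind its last visit to \<open>v\<close>.\<close>

lemma link_neighbour:
  assumes "(v, y) \<in> (link (insert v W) g c)\<^sup>*"
  shows "y = v \<or> (\<exists>t\<in>W. g v t \<in> {c, Idt} \<and> (t, y) \<in> (link W g c)\<^sup>*)"
  using assms
proof (induction rule: rtrancl_induct)
  case (step y z)
  have yz: "y \<in> insert v W" "z \<in> insert v W" "g y z \<in> {c, Idt}"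
    using step.hyps(2) by (auto simp: link_def)
  show ?case
  proof (cases "z = v \<or> y = v")
    case True
    then show ?thesis using yz by auto
  next
    case False
    then have "(y, z) \<in> link W g c" using yz by (auto simp: link_def)
    then show ?thesis using step.IH False by (meson rtrancl.rtrancl_into_rtrancl)
  qed
qed simp

text \<open>This is due to Gallai. Removing a vertex \<open>v\<close>, let \<open>c\<close> be a disconnected colour on the
  remaining vertices. If \<open>v\<close> has neighbours in all three colours, then the components of \<open>c\<close> on the remaining vertices have a \<open>c\<close>-neighbour
  of \<open>v\<close> each, and so both other colours would be the colour of all edges between a component and the
  rest.\<close>

lemma gallai_disconnected:
  assumes "finite W" "gallai W g" "\<exists>x\<in>W. \<exists>y\<in>W. g x y \<noteq> Idt"
  shows "\<exists>c\<in>- {Idt}. \<exists>x\<in>W. \<exists>y\<in>W. (x, y) \<notin> (link W g c)\<^sup>*"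
  using assms
proof (induction W rule: finite_induct)
  case (insert v W)
  note g = insert.prems(1)
  have gW: "gallai W g"
    by (rule gallai_subset[OF g]) auto
  show ?case
  proof (cases "\<exists>u\<in>W. g v u = Idt")
    case True
    then obtain u where u: "u \<in> W" "g v u = Idt" by blast
    have eq: "g v t = g u t" "g t v = g t u" if "t \<in> insert v W" for t
      using gallai_Idt[OF g _ _ that, of v u] gallai_sym[OF g, of t] u that by auto
    have "\<exists>x\<in>W. \<exists>y\<in>W. g x y \<noteq> Idt"
    proof (rule ccontr)
      assume *: "\<not> ?thesis"
      have "g x y = Idt" if "x \<in> insert v W" "y \<in> insert v W" for x y
      proof -
        have all: "g a b = Idt" if "a \<in> W" "b \<in> W" for a b using * that by blast
        show ?thesis
          using that all u(1) eq[of x] eq[of y] eq[of u] by (cases "x = v"; cases "y = v") auto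
      qed
      then show False using insert.prems(2) by blast
    qed
    from insert.IH[OF gW this] obtain c x y where c: "c \<in> - {Idt}" "x \<in> W" "y \<in> W"
      "(x, y) \<notin> (link W g c)\<^sup>*" by blast
    moreover from this have "x \<noteq> v" "y \<noteq> v" using insert.hyps(2) by auto
    ultimately have "(x, y) \<notin> (link (insert v W) g c)\<^sup>*"
      using link_twin[OF g u, of x y c] by auto
    with c(1-3) show ?thesis by blast
  next
    case False
    then have nI: "g v u \<noteq> Idt" if "u \<in> W" for u using that by blast
    have "W \<noteq> {}"
      using insert.prems(2) gallai_refl[OF g, of v] by auto
    then obtain u0 where u0: "u0 \<in> W" by blast
    show ?thesis
    proof (rule ccontr)
      assume contra: "\<not> ?thesis"
      then have conn: "(x, y) \<in> (link (insert v W) g c)\<^sup>*"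
        if "x \<in> insert v W" "y \<in> insert v W" "c \<noteq> Idt" for x y c
        using that by blast
      \<comment> \<open>Without a neighbour of colour \<open>d\<close> the vertex \<open>v\<close>
        would be a component of its own.\<close>
      have nbr: "\<exists>z\<in>W. g v z = d" if "d \<noteq> Idt" for d
      proof (rule ccontr)
        assume "\<not> ?thesis"
        then have "\<forall>z\<in>W. g v z \<notin> {d, Idt}" using nI by auto
        from link_isolated[OF insert.hyps(2) this conn] u0 that insert.hyps(2) show False by auto
      qed
      have "\<exists>x\<in>W. \<exists>y\<in>W. g x y \<noteq> Idt"
      proof (rule ccontr)
        assume "\<not> ?thesis"
        then have "g v x = g v y" if "x \<in> W" "y \<in> W" for x y
          using gallai_Idt[OF g, of x y v] gallai_sym[OF g, of v] that by auto
        then show False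
          using nbr[of At_a] nbr[of At_b] by (metis atom.distinct(1,3,7))
      qed
      from insert.IH[OF gW this] obtain c x y where c: "c \<noteq> Idt" "x \<in> W" "y \<in> W"
        "(x, y) \<notin> (link W g c)\<^sup>*" by blast
      let ?L = "(link W g c)\<^sup>*"
      have symL: "(p, q) \<in> ?L \<Longrightarrow> (q, p) \<in> ?L" for p q
        using link_sym[OF gW] by (auto simp: sym_def)
      \<comment> \<open>The component of \<open>w\<close> contains a \<open>c\<close>-neighbour
        \<open>t\<close> of \<open>v\<close>. In the triangle \<open>v\<close>, \<open>u\<close>,
        \<open>t\<close> two edges have colours \<open>d\<close> and \<open>c\<close> and the third
        is not \<open>c\<close>, so it is \<open>d\<close>; since the component is a module,
        \<open>w\<close> inherits this colour from \<open>t\<close>.\<close>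
      have key: "g u w = d" if u: "u \<in> W" "g v u = d" and d: "d \<noteq> c" and w: "w \<in> W" "(u, w) \<notin> ?L" for u w d
      proof -
        have "(v, w) \<in> (link (insert v W) g c)\<^sup>*"
          using conn c(1) w(1) by auto
        from link_neighbour[OF this] obtain t where t: "t \<in> W" "g v t \<in> {c, Idt}" "(t, w) \<in> ?L"
          using w(1) insert.hyps(2) by auto
        have vt: "g v t = c" using t(1,2) nI by auto
        have ut: "(u, t) \<notin> ?L" using w(2) t(3) by (meson rtrancl_trans)
        then have "g u t \<notin> {c, Idt}" using linkI[OF u(1) t(1)] by blast
        then have "g u t = d"
          using gallai_triangle[OF g, of v u t] u t(1) d vt nI[OF u(1)] c(1)
          by (auto simp: atom_le_comp_def split: if_splits)
        moreover have "g t u = g w u"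
          using link_module[OF gW t(3,1) u(1)] ut symL by blast
        ultimately show ?thesis
          using gallai_sym[OF gW u(1)] t(1) w(1) by simp
      qed
      obtain p q where pq: "p \<noteq> Idt" "q \<noteq> Idt" "p \<noteq> c" "q \<noteq> c" "p \<noteq> q"
        using atom.distinct by (metis (full_types))
      obtain u u' where u: "u \<in> W" "g v u = p" and u': "u' \<in> W" "g v u' = q"
        using nbr pq(1,2) by blast
      show False
      \<comment> \<open>If \<open>u\<close> and \<open>u'\<close> share a component, all its edges
        to an outside vertex \<open>w\<close> have one colour, which would be \<open>p\<close> and
        \<open>q\<close>; otherwise the edge between \<open>u\<close> and \<open>u'\<close> would
        have both colours.\<close>
      proof (cases "(u, u') \<in> ?L")
        case True
        obtain w where w: "w \<in> W" "(u, w) \<notin> ?L"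
          using c(2-4) symL by (meson rtrancl_trans)
        then have "(u', w) \<notin> ?L"
          using True by (meson rtrancl_trans)
        with w True show False
          using key[OF u pq(3) w] key[OF u' pq(4) w(1)] link_module[OF gW True u(1) w] pq(5) by simp
      next
        case False
        then have "(u', u) \<notin> ?L" using symL by blast
        with False show False
          using key[OF u pq(3) u'(1)] key[OF u' pq(4) u(1)] gallai_sym[OF gW u(1) u'(1)] pq(5) by simp
      qed
    qed
  qed
qed simp

section \<open>Refinement of partitions\<close>

text \<open>In a colouring of the classes of \<open>E\<close> in which the colour \<open>c\<close> is disconnected, two
  vertices of a class must be in the same component if all other colours are forbidden (in \<open>B\<close>)
  between their components.\<close>

definition closed_under ::
    "'v set \<Rightarrow> ('v \<Rightarrow> 'v \<Rightarrow> atom set) \<Rightarrow> atom \<Rightarrow> ('v \<Rightarrow> 'v \<Rightarrow> bool) \<Rightarrow> ('v \<Rightarrow> 'v \<Rightarrow> bool) \<Rightarrow>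
     ('v \<Rightarrow> 'v \<Rightarrow> atom set) \<Rightarrow> bool" where
  "closed_under V F c E Q B \<longleftrightarrow>
     (\<forall>x\<in>V. Q x x) \<and>
     (\<forall>x\<in>V. \<forall>y\<in>V. E x y \<and> - {Idt, c} \<subseteq> B x y \<longrightarrow> Q x y) \<and>
     (\<forall>x\<in>V. \<forall>y\<in>V. \<forall>z\<in>V. Q x z \<and> Q y z \<longrightarrow> Q x y) \<and>
     (\<forall>x\<in>V. \<forall>y\<in>V. - F x y \<subseteq> B x y) \<and>
     (\<forall>x\<in>V. \<forall>y\<in>V. \<forall>z\<in>V. Q x z \<longrightarrow> B y z \<subseteq> B x y)"

lemma closed_underD:
  assumes "closed_under V F c E Q B"
  shows "x \<in> V \<Longrightarrow> Q x x"
    and "x \<in> V \<Longrightarrow> y \<in> V \<Longrightarrow> E x y \<Longrightarrow> - {Idt, c} \<subseteq> B x y \<Longrightarrow> Q x y"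
    and "x \<in> V \<Longrightarrow> y \<in> V \<Longrightarrow> z \<in> V \<Longrightarrow> Q x z \<Longrightarrow> Q y z \<Longrightarrow> Q x y"
    and "x \<in> V \<Longrightarrow> y \<in> V \<Longrightarrow> - F x y \<subseteq> B x y"
    and "x \<in> V \<Longrightarrow> y \<in> V \<Longrightarrow> z \<in> V \<Longrightarrow> Q x z \<Longrightarrow> B y z \<subseteq> B x y"
  using assms unfolding closed_under_def by - (elim conjE, blast)+

text \<open>With reflexivity the single condition yields symmetry and transitivity. It has the shape
  of a sweep, combining \<open>(x, z)\<close> and \<open>(y, z)\<close> into
  \<open>(x, y)\<close>.\<close>

definition equiv_rel :: "'v set \<Rightarrow> ('v \<Rightarrow> 'v \<Rightarrow> bool) \<Rightarrow> bool" where
  "equiv_rel V E \<longleftrightarrow> (\<forall>x\<in>V. E x x) \<and> (\<forall>x\<in>V. \<forall>y\<in>V. \<forall>z\<in>V. E x z \<and> E y z \<longrightarrow> E x y)"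

lemma equiv_rel_sym: "equiv_rel V E \<Longrightarrow> x \<in> V \<Longrightarrow> y \<in> V \<Longrightarrow> E x y \<longleftrightarrow> E y x"
  unfolding equiv_rel_def by blast

lemma equiv_rel_trans:
  "equiv_rel V E \<Longrightarrow> x \<in> V \<Longrightarrow> y \<in> V \<Longrightarrow> z \<in> V \<Longrightarrow> E x y \<Longrightarrow> E y z \<Longrightarrow> E x z"
  unfolding equiv_rel_def by blast

lemma closed_under_equiv_rel: "closed_under V F c E Q B \<Longrightarrow> equiv_rel V Q"
  unfolding closed_under_def equiv_rel_def by blast

text \<open>Forbidding everything splits nothing; comparison with this closed relation shows that
  the finest one lies inside \<open>E\<close>.\<close>

lemma closed_under_top: "equiv_rel V E \<Longrightarrow> closed_under V F c E E (\<lambda>_ _. UNIV)"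
  unfolding closed_under_def equiv_rel_def by blast

text \<open>In the last condition of \<open>closed_under\<close> the arguments are swapped: the
  choice \<open>z = x\<close> gives symmetry, and symmetry turns the condition into invariance along
  \<open>Q\<close>.\<close>

lemma closed_under_B:
  assumes "closed_under V F c E Q B" "x \<in> V" "y \<in> V"
  shows "B x y = B y x" "x' \<in> V \<Longrightarrow> Q x x' \<Longrightarrow> B x y = B x' y"
proof -
  have 1: "B x y \<subseteq> B y x" if "x \<in> V" "y \<in> V" for x y
    using assms(1) that unfolding closed_under_def by blast
  then show sym: "B x y = B y x" using assms(2,3) by blast
  have 2: "B x' y \<subseteq> B x y" if "x \<in> V" "x' \<in> V" "Q x x'" for x x'
  proof -
    have "B y x' \<subseteq> B x y"
      using assms(1,3) that unfolding closed_under_def by blast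
    then show ?thesis using 1[OF that(2) assms(3)] by blast
  qed
  show "B x y = B x' y" if "x' \<in> V" "Q x x'"
    using 2[of x x'] 2[of x' x] that assms(2) equiv_rel_sym[OF closed_under_equiv_rel[OF assms(1)]] by blast
qed

text \<open>A solution up to the inside of the classes: the vertices of a class count as identified,
  and the labels between them are not consulted yet.\<close>

definition quotient_colouring ::
    "'v set \<Rightarrow> ('v \<Rightarrow> 'v \<Rightarrow> atom set) \<Rightarrow> ('v \<Rightarrow> 'v \<Rightarrow> bool) \<Rightarrow> ('v \<Rightarrow> 'v \<Rightarrow> atom) \<Rightarrow> bool" where
  "quotient_colouring V F E g \<longleftrightarrow> gallai V g \<and>
     (\<forall>x\<in>V. \<forall>y\<in>V. (g x y = Idt \<longleftrightarrow> E x y) \<and> (E x y \<or> g x y \<in> F x y))"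

text \<open>Pairs inside a class of \<open>E\<close> that \<open>Q\<close> separates get an allowed
  colour other than \<open>c\<close>, chosen freely for each pair of new classes; all other colours
  are kept.\<close>

lemma quotient_colouring_refine:
  assumes g: "quotient_colouring V F E g" and c: "c \<noteq> Idt" and cl: "closed_under V F c E Q B"
    and QE: "\<And>x y. x \<in> V \<Longrightarrow> y \<in> V \<Longrightarrow> Q x y \<Longrightarrow> E x y"
  shows "\<exists>g'. quotient_colouring V F Q g'"
proof -
  \<comment> \<open>The choice depends on the set alone, so \<open>g'\<close> inherits symmetry and
    constancy on the classes of \<open>Q\<close> from \<open>B\<close>.\<close>
  define h where "h X = (SOME d. d \<notin> {Idt, c} \<and> d \<notin> X)" for X
  define g' where "g' x y = (if Q x y then Idt else if E x y then h (B x y) else g x y)" for x y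
  have gg: "gallai V g" and gE: "\<And>x y. x \<in> V \<Longrightarrow> y \<in> V \<Longrightarrow> g x y = Idt \<longleftrightarrow> E x y"
    and gF: "\<And>x y. x \<in> V \<Longrightarrow> y \<in> V \<Longrightarrow> E x y \<or> g x y \<in> F x y"
    using g unfolding quotient_colouring_def by auto
  have eQ: "equiv_rel V Q" by (rule closed_under_equiv_rel[OF cl])
  have h: "h (B x y) \<notin> {Idt, c} \<and> h (B x y) \<notin> B x y" if "x \<in> V" "y \<in> V" "E x y" "\<not> Q x y" for x y
  proof -
    have "\<not> - {Idt, c} \<subseteq> B x y"
      using cl that unfolding closed_under_def by blast
    then have "\<exists>d. d \<notin> {Idt, c} \<and> d \<notin> B x y" by blast
    then show ?thesis unfolding h_def by (rule someI_ex)
  qed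
  have Qrefl: "Q x x" if "x \<in> V" for x using eQ that unfolding equiv_rel_def by blast
  have Qsym: "Q x y \<longleftrightarrow> Q y x" if "x \<in> V" "y \<in> V" for x y by (rule equiv_rel_sym[OF eQ that])
  have Esym: "E x y \<longleftrightarrow> E y x" if "x \<in> V" "y \<in> V" for x y
    using gE gallai_sym[OF gg that] that by metis
  have Eg: "E x z \<longleftrightarrow> E y z" "g x z = g y z" if "x \<in> V" "y \<in> V" "z \<in> V" "E x y" for x y z
    using gallai_Idt[OF gg that(1-3)] gE[OF that(1,2)] gE[OF that(1,3)] gE[OF that(2,3)] that(4)
    by simp_all
  have g'Q: "g' x z = g' y z" if "x \<in> V" "y \<in> V" "z \<in> V" "Q x y" for x y z
  proof -
    have "Q x z \<longleftrightarrow> Q y z"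
      using equiv_rel_trans[OF eQ that(1,2,3,4)] equiv_rel_trans[OF eQ that(2,1,3)]
        Qsym[OF that(1,2)] that(4) by blast
    moreover have "B x z = B y z"
      by (rule closed_under_B(2)[OF cl that(1,3,2,4)])
    ultimately show ?thesis
      using Eg[OF that(1-3) QE[OF that(1,2,4)]] unfolding g'_def by simp
  qed
  have g'sym: "g' x y = g' y x" if "x \<in> V" "y \<in> V" for x y
    using Qsym[OF that] Esym[OF that] closed_under_B(1)[OF cl that] gallai_sym[OF gg that]
    unfolding g'_def by simp
  have g'Idt: "g' x y = Idt \<longleftrightarrow> Q x y" if "x \<in> V" "y \<in> V" for x y
    using h[OF that] gE[OF that] unfolding g'_def by auto
  have g'E: "g' x y \<noteq> c" if "x \<in> V" "y \<in> V" "E x y" "\<not> Q x y" for x y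
    using h[OF that] that unfolding g'_def by auto
  have iso: "g' x z = g' y z" if "x \<in> V" "y \<in> V" "z \<in> V" "E x y" "\<not> E x z" for x y z
  proof -
    have "\<not> Q x z" "\<not> Q y z" "\<not> E y z" "g x z = g y z"
      using Eg[OF that(1-4)] QE[OF that(1,3)] QE[OF that(2,3)] that(5) by auto
    then show ?thesis unfolding g'_def using that(5) by simp
  qed
  have tri: "atom_le_comp (g' x z) (g' x y) (g' y z)" if V: "x \<in> V" "y \<in> V" "z \<in> V" for x y z
  proof -
    consider "Q x y" | "Q y z" | "Q x z" | "\<not> Q x y" "\<not> Q y z" "\<not> Q x z" by blast
    then show ?thesis
    proof cases
      case 1
      then show ?thesis using g'Q[OF V 1] g'Idt V by (simp add: atom_le_comp_def)
    next
      case 2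
      have "g' x y = g' x z"
        using g'Q[OF V(2,3,1) 2] g'sym V by simp
      then show ?thesis using g'Idt[OF V(2,3)] 2 by (simp add: atom_le_comp_def)
    next
      case 3
      have "g' x y = g' y z"
        using g'Q[OF V(1,3,2) 3] g'sym V by simp
      then show ?thesis using g'Idt[OF V(1,3)] 3 by (simp add: atom_le_comp_def)
    next
      case 4
      have nI: "g' x y \<noteq> Idt" "g' y z \<noteq> Idt" "g' x z \<noteq> Idt"
        using 4 g'Idt V by auto
      have "\<not> (g' x y \<noteq> g' y z \<and> g' y z \<noteq> g' x z \<and> g' x y \<noteq> g' x z)"
      proof (cases "E x y \<or> E y z \<or> E x z")
        case True
        show ?thesis
        proof (cases "E x y \<and> E y z \<and> E x z")
          case True
          \<comment> \<open>Inside a class of \<open>E\<close> only two colours are used, too few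
            for a rainbow triangle.\<close>
          then have "g' x y \<noteq> c" "g' y z \<noteq> c" "g' x z \<noteq> c"
            using g'E V 4 by auto
          then show ?thesis
            using nI c by (cases c; cases "g' x y"; cases "g' y z"; cases "g' x z"; simp)
        next
          case False
          \<comment> \<open>If just one edge lies inside a class of \<open>E\<close>, the other two
            agree because \<open>g\<close> is constant on that class; just two such edges are
            impossible.\<close>
          with True consider "E x y" "\<not> E x z" | "E x y" "E x z" "\<not> E y z" | "E y z" "\<not> E y x"
            | "E x z" "\<not> E x y"
            using Esym[OF V(1,2)] by blast
          then show ?thesis
          proof cases
            case 1
            then show ?thesis using iso[OF V] by simp
          next
            case 2
            then show ?thesis using Eg(1)[OF V] by simp
          next
            case 3
            then show ?thesis using iso[OF V(2,3,1)] g'sym V by simp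
          next
            case 4
            then show ?thesis using iso[OF V(1,3,2)] g'sym[OF V(2,3)] by simp
          qed
        qed
      next
        case False
        then show ?thesis
          using gallai_triangle[OF gg V] 4 gE[OF V(1,2)] gE[OF V(2,3)] gE[OF V(1,3)] unfolding g'_def
          by (simp add: atom_le_comp_def)
      qed
      then show ?thesis
        using nI by (auto simp: atom_le_comp_def)
    qed
  qed
  have "g' x y \<in> F x y" if "x \<in> V" "y \<in> V" "\<not> Q x y" for x y
  proof -
    have "- F x y \<subseteq> B x y" using cl that(1,2) unfolding closed_under_def by blast
    then show ?thesis
      using h[OF that(1,2)] gF[OF that(1,2)] that(3) unfolding g'_def by auto
  qed
  then have "quotient_colouring V F Q g'"
    unfolding quotient_colouring_def gallai_def
    by (intro conjI ballI) (use g'Idt Qrefl g'sym tri in auto)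
  then show ?thesis by blast
qed

text \<open>Split the class \<open>W\<close> into the components of \<open>c\<close> and keep the
  other classes. Components are modules, so all pairs between two of them have one colour of
  \<open>g\<close>; it is neither \<open>c\<close> nor \<open>Idt\<close> and lies in every label
  between them, so no merge is forced.\<close>

lemma closed_under_colouring:
  assumes g: "gallai V g" and gF: "\<And>x y. x \<in> V \<Longrightarrow> y \<in> V \<Longrightarrow> g x y \<in> F x y"
    and E: "equiv_rel V E" and W: "W = {y \<in> V. E x0 y}" and x0: "x0 \<in> V"
    and Q: "\<And>x y. Q x y \<longleftrightarrow> E x y \<and> (x \<in> W \<longrightarrow> (x, y) \<in> (link W g c)\<^sup>*)"
  shows "\<exists>B. closed_under V F c E Q B"
proof -
  \<comment> \<open>\<open>F\<close> may be asymmetric, but the forbidden sets of a closed relation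
    are symmetric, so both orientations enter.\<close>
  define B where "B x y = {d. \<exists>x'\<in>V. \<exists>y'\<in>V. Q x x' \<and> Q y y' \<and> (d \<notin> F x' y' \<or> d \<notin> F y' x')}" for x y
  have WV: "W \<subseteq> V" using W by auto
  have gW: "gallai W g" by (rule gallai_subset[OF g WV])
  have symL: "(p, q) \<in> (link W g c)\<^sup>* \<Longrightarrow> (q, p) \<in> (link W g c)\<^sup>*" for p q
    using link_sym[OF gW] by (auto simp: sym_def)
  have EW: "x \<in> W \<longleftrightarrow> y \<in> W" if "x \<in> V" "y \<in> V" "E x y" for x y
    using equiv_rel_trans[OF E x0 that(1,2)] equiv_rel_trans[OF E x0 that(2,1)]
      equiv_rel_sym[OF E that(1,2)] that by (auto simp: W)
  have Qrefl: "Q x x" if "x \<in> V" for x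
    using E that by (simp add: Q equiv_rel_def)
  have Qsym: "Q y x" if "x \<in> V" "y \<in> V" "Q x y" for x y
    using that EW[of x y] symL equiv_rel_sym[OF E] by (auto simp: Q)
  have Qtrans: "Q x z" if "x \<in> V" "y \<in> V" "z \<in> V" "Q x y" "Q y z" for x y z
    using that EW[of x y] equiv_rel_trans[OF E that(1-3)] by (auto simp: Q intro: rtrancl_trans)
  have "closed_under V F c E Q B"
    unfolding closed_under_def
  proof (intro conjI ballI impI)
    show "Q x x" if "x \<in> V" for x by (rule Qrefl[OF that])
    show "Q x y" if "x \<in> V" "y \<in> V" "z \<in> V" "Q x z \<and> Q y z" for x y z
      using Qtrans[of x z y] Qsym[of y z] that by blast
    show "- F x y \<subseteq> B x y" if "x \<in> V" "y \<in> V" for x y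
      using Qrefl that by (auto simp: B_def)
    show "B y z \<subseteq> B x y" if xyz: "x \<in> V" "y \<in> V" "z \<in> V" "Q x z" for x y z
    proof
      fix d assume "d \<in> B y z"
      then obtain y' z' where *: "y' \<in> V" "z' \<in> V" "Q y y'" "Q z z'" "d \<notin> F y' z' \<or> d \<notin> F z' y'"
        unfolding B_def by blast
      have "Q x z'" by (rule Qtrans[OF xyz(1,3) *(2) xyz(4) *(4)])
      with * show "d \<in> B x y" unfolding B_def by blast
    qed
    show "Q x y" if xy: "x \<in> V" "y \<in> V" "E x y \<and> - {Idt, c} \<subseteq> B x y" for x y
    proof (rule ccontr)
      assume nQ: "\<not> Q x y"
      then have x: "x \<in> W" and nL: "(x, y) \<notin> (link W g c)\<^sup>*"
        using xy by (auto simp: Q)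
      have y: "y \<in> W" using EW xy x by blast
      have "g x y \<notin> {c, Idt}"
        using linkI[OF x y] nL by blast
      then have "g x y \<in> B x y" using xy by blast
      then obtain x' y' where *: "x' \<in> V" "y' \<in> V" "Q x x'" "Q y y'" "g x y \<notin> F x' y' \<or> g x y \<notin> F y' x'"
        unfolding B_def by blast
      have L: "(x, x') \<in> (link W g c)\<^sup>*" "(y, y') \<in> (link W g c)\<^sup>*"
        using * x y by (auto simp: Q)
      have W': "x' \<in> W" "y' \<in> W" using link_in[OF L(1) x] link_in[OF L(2) y] .
      have "g x y = g x' y" by (rule link_module[OF gW L(1) x y nL])
      moreover have "(y, x') \<notin> (link W g c)\<^sup>*"
        using nL L symL by (meson rtrancl_trans)
      then have "g y x' = g y' x'" by (rule link_module[OF gW L(2) y W'(1)])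
      ultimately have "g x y = g x' y'" "g x y = g y' x'"
        using gallai_sym[OF gW] W' y by auto
      with *(5) gF[OF *(1,2)] gF[OF *(2,1)] show False by simp
    qed
  qed
  then show ?thesis by blast
qed

text \<open>Otherwise \<open>g\<close> is not constantly \<open>Idt\<close> on the class of
  \<open>x\<close>, some colour is disconnected there, and its components give a closed relation
  that contradicts stability.\<close>

lemma stable_Idt:
  assumes V: "finite V" and g: "gallai V g" and gF: "\<And>x y. x \<in> V \<Longrightarrow> y \<in> V \<Longrightarrow> g x y \<in> F x y"
    and E: "equiv_rel V E"
    and stable: "\<And>c Q B x y. c \<noteq> Idt \<Longrightarrow> closed_under V F c E Q B \<Longrightarrow> x \<in> V \<Longrightarrow> y \<in> V \<Longrightarrow> E x y \<Longrightarrow> Q x y"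
    and xy: "x \<in> V" "y \<in> V" "E x y"
  shows "Idt \<in> F x y"
proof (rule ccontr)
  assume nI: "Idt \<notin> F x y"
  define W where "W = {y \<in> V. E x y}"
  have W: "finite W" "gallai W g" "x \<in> W" "y \<in> W"
    using V gallai_subset[OF g, of W] xy E by (auto simp: W_def equiv_rel_def)
  have "g x y \<noteq> Idt" using gF[OF xy(1,2)] nI by auto
  then obtain c u v where c: "c \<noteq> Idt" "u \<in> W" "v \<in> W" "(u, v) \<notin> (link W g c)\<^sup>*"
    using gallai_disconnected[OF W(1,2)] W(3,4) by blast
  obtain B where B: "closed_under V F c E (\<lambda>x y. E x y \<and> (x \<in> W \<longrightarrow> (x, y) \<in> (link W g c)\<^sup>*)) B"
    using closed_under_colouring[OF g gF E W_def xy(1) refl, of c] by blast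
  have "u \<in> V" "v \<in> V" "E u v"
    using c(2,3) equiv_rel_trans[OF E, of u x v] equiv_rel_sym[OF E xy(1), of u] xy(1)
    by (simp_all add: W_def)
  from stable[OF c(1) B this] c(2,4) show False by blast
qed

text \<open>Bounds the rounds of both iterations: growth in each of the steps \<open>0\<close> to
  \<open>N\<close> would give more than \<open>N\<close> elements.\<close>

lemma pigeonhole_stable:
  assumes "finite U" "card U \<le> N" "\<And>k. X k \<subseteq> U" "\<And>k. X k \<subseteq> X (Suc k)"
  shows "\<exists>k\<le>N. X (Suc k) = X k"
proof (rule ccontr)
  assume "\<not> ?thesis"
  then have *: "X k \<subset> X (Suc k)" if "k \<le> N" for k
    using assms(4) that by blast
  have "k \<le> card (X k)" if "k \<le> Suc N" for k
    using that
  proof (induction k)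
    case (Suc k)
    then have "card (X k) < card (X (Suc k))"
      using * finite_subset[OF assms(3) assms(1)] by (intro psubset_card_mono) auto
    then show ?case using Suc by simp
  qed simp
  from this[of "Suc N"] have "Suc N \<le> card (X (Suc N))" by simp
  also have "\<dots> \<le> card U" by (rule card_mono[OF assms(1,3)])
  finally show False using assms(2) by simp
qed

section \<open>The refinement algorithm as a sweep program\<close>

text \<open>Of each pair of vertices we store the label, whether it is in the current partition (\<open>eqv\<close>),
  whether it is in the refined partition being computed (\<open>mrg\<close>), and the atoms that are forbidden
  between the two classes of the refined partition (\<open>bad\<close>).\<close>

datatype cell = Cell (dg: bool) (lb: "atom set") (eqv: bool) (mrg: bool) (bad: "atom set")

lemma UNIV_atom: "UNIV = {Idt, At_a, At_b, At_c}"
  using atom.exhaust by auto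

instance atom :: finite
  by standard (simp add: UNIV_atom)

instance cell :: finite
proof
  have "c \<in> (\<lambda>(d, l, e, q, b). Cell d l e q b) ` UNIV" for c
    by (cases c) (auto simp: image_def)
  then have "(UNIV :: cell set) = (\<lambda>(d, l, e, q, b). Cell d l e q b) ` UNIV" by blast
  then show "finite (UNIV :: cell set)" by (metis finite finite_imageI)
qed

text \<open>In an update with arguments \<open>p\<close>, \<open>q\<close> and \<open>m\<close>, these are the entries \<open>(x, z)\<close>, \<open>(y, z)\<close>
  and \<open>(x, y)\<close>. The flag \<open>dg p\<close> selects \<open>z = x\<close>, and then \<open>q\<close> is the entry \<open>(y, x)\<close>.\<close>

definition symm_upd :: "cell \<Rightarrow> cell \<Rightarrow> cell \<Rightarrow> cell" where
  "symm_upd p q m = (if dg p then Cell (dg m) (lb m \<inter> lb q) (eqv m) (mrg m) (bad m) else m)"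

text \<open>The start of the fixed point iteration, below every closed relation.\<close>

definition reset_upd :: "cell \<Rightarrow> cell \<Rightarrow> cell \<Rightarrow> cell" where
  "reset_upd p q m = (if dg p then Cell (dg m) (lb m) (eqv m) (dg m) (- lb m) else m)"

text \<open>The conditions of \<open>closed_under\<close>, read as rules that enlarge
  \<open>mrg\<close> and \<open>bad\<close>.\<close>

definition merge_upd :: "atom \<Rightarrow> cell \<Rightarrow> cell \<Rightarrow> cell \<Rightarrow> cell" where
  "merge_upd c p q m = Cell (dg m) (lb m) (eqv m)
     (mrg m \<or> mrg p \<and> mrg q \<or> eqv m \<and> - {Idt, c} \<subseteq> bad m)
     (bad m \<union> (if mrg p then bad q else {}))"

definition commit_upd :: "cell \<Rightarrow> cell \<Rightarrow> cell \<Rightarrow> cell" where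
  "commit_upd p q m = (if dg p then Cell (dg m) (lb m) (mrg m) (mrg m) (bad m) else m)"

text \<open>Five bits per pair can grow, \<open>mrg\<close> and one for each of the four atoms in
  \<open>bad\<close>. Five sweeps inside two loops make the \<open>5 * (n * n)\<close> rounds that
  suffice.\<close>

definition refine_prog :: "atom \<Rightarrow> cell prog" where
  "refine_prog c = (let P = Pass (merge_upd c) in
     PSeq (Pass reset_upd)
       (PSeq (Loop (Loop (PSeq P (PSeq P (PSeq P (PSeq P P)))))) (Pass commit_upd)))"

text \<open>A round that changes the partition removes a pair from \<open>eqv\<close>, so
  \<open>n * n\<close> rounds reach a stable one.\<close>

definition main_prog :: "cell prog" where
  "main_prog = PSeq (Pass symm_upd)
     (Loop (Loop (PSeq (refine_prog At_a) (PSeq (refine_prog At_b) (refine_prog At_c)))))"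

section \<open>Semantics of the sweeps\<close>

lemma fold_select:
  "fold (\<lambda>z m. if z = x then h z m else m) [0..<n] m = (if x < n then h x m else (m :: 'a))"
  by (induction n) auto

definition diagonal :: "nat \<Rightarrow> (nat \<Rightarrow> nat \<Rightarrow> cell) \<Rightarrow> bool" where
  "diagonal n M \<longleftrightarrow> (\<forall>x<n. \<forall>y<n. dg (M x y) \<longleftrightarrow> x = y)"

lemma sem_select:
  assumes "diagonal n M" "x < n"
  shows "fold (\<lambda>z m. if dg (M x z) then h z m else m) [0..<n] m = h x m"
proof -
  have "fold (\<lambda>z m. if dg (M x z) then h z m else m) [0..<n] m =
      fold (\<lambda>z m. if z = x then h z m else m) [0..<n] m"
    using assms by (intro fold_cong) (auto simp: diagonal_def)
  then show ?thesis using assms(2) by (simp add: fold_select)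
qed

lemma sem_symm:
  assumes "diagonal n M" "x < n"
  shows "sem n (Pass symm_upd) M x y =
    (let m = M x y in Cell (dg m) (lb m \<inter> lb (M y x)) (eqv m) (mrg m) (bad m))"
  using sem_select[OF assms, of "\<lambda>z m. Cell (dg m) (lb m \<inter> lb (M y z)) (eqv m) (mrg m) (bad m)" "M x y"]
  by (simp add: symm_upd_def[abs_def] Let_def)

lemma sem_reset:
  assumes "diagonal n M" "x < n"
  shows "sem n (Pass reset_upd) M x y =
    (let m = M x y in Cell (dg m) (lb m) (eqv m) (dg m) (- lb m))"
  using sem_select[OF assms, of "\<lambda>z m. Cell (dg m) (lb m) (eqv m) (dg m) (- lb m)" "M x y"]
  by (simp add: reset_upd_def[abs_def] Let_def)

lemma sem_commit:
  assumes "diagonal n M" "x < n"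
  shows "sem n (Pass commit_upd) M x y =
    (let m = M x y in Cell (dg m) (lb m) (mrg m) (mrg m) (bad m))"
  using sem_select[OF assms, of "\<lambda>z m. Cell (dg m) (lb m) (mrg m) (mrg m) (bad m)" "M x y"]
  by (simp add: commit_upd_def[abs_def] Let_def)

lemma fold_merge:
  fixes c :: atom
  defines "f \<equiv> \<lambda>p q. fold (\<lambda>z m. merge_upd c (p z) (q z) m)"
  shows "dg (f p q zs m) = dg m" "lb (f p q zs m) = lb m" "eqv (f p q zs m) = eqv m"
    and "mrg m \<Longrightarrow> mrg (f p q zs m)" "bad m \<subseteq> bad (f p q zs m)"
    and "z \<in> set zs \<Longrightarrow> mrg (p z) \<Longrightarrow> mrg (q z) \<Longrightarrow> mrg (f p q zs m)"
    and "z \<in> set zs \<Longrightarrow> mrg (p z) \<Longrightarrow> bad (q z) \<subseteq> bad (f p q zs m)"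
    and "z \<in> set zs \<Longrightarrow> eqv m \<Longrightarrow> - {Idt, c} \<subseteq> bad m \<Longrightarrow> mrg (f p q zs m)"
proof -
  show "dg (f p q zs m) = dg m" "lb (f p q zs m) = lb m" "eqv (f p q zs m) = eqv m"
    unfolding f_def by (induction zs arbitrary: m) (simp_all add: merge_upd_def)
  show mono: "mrg m \<Longrightarrow> mrg (f p q zs m)" "bad m \<subseteq> bad (f p q zs m)" for zs m
  proof -
    show "mrg m \<Longrightarrow> mrg (f p q zs m)"
      unfolding f_def by (induction zs arbitrary: m) (simp_all add: merge_upd_def)
    show "bad m \<subseteq> bad (f p q zs m)"
    proof (induction zs arbitrary: m)
      case (Cons z zs)
      have "bad m \<subseteq> bad (merge_upd c (p z) (q z) m)" by (auto simp: merge_upd_def)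
      also have "\<dots> \<subseteq> bad (f p q zs (merge_upd c (p z) (q z) m))" by (rule Cons.IH)
      finally show ?case by (simp add: f_def)
    qed (simp add: f_def)
  qed
  have f_Cons: "f p q (z # zs) m = f p q zs (merge_upd c (p z) (q z) m)" for z zs m
    by (simp add: f_def)
  show "z \<in> set zs \<Longrightarrow> mrg (p z) \<Longrightarrow> mrg (q z) \<Longrightarrow> mrg (f p q zs m)"
  proof (induction zs arbitrary: m)
    case (Cons z' zs)
    show ?case
    proof (cases "z = z'")
      case True
      then show ?thesis
        unfolding f_Cons using Cons.prems by (intro mono(1)) (simp add: merge_upd_def)
    qed (use Cons.IH Cons.prems in \<open>simp add: f_Cons\<close>)
  qed simp
  show "z \<in> set zs \<Longrightarrow> mrg (p z) \<Longrightarrow> bad (q z) \<subseteq> bad (f p q zs m)"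
  proof (induction zs arbitrary: m)
    case (Cons z' zs)
    show ?case
    proof (cases "z = z'")
      case True
      have "bad (q z) \<subseteq> bad (merge_upd c (p z') (q z') m)"
        using True Cons.prems by (auto simp: merge_upd_def)
      also have "\<dots> \<subseteq> bad (f p q zs (merge_upd c (p z') (q z') m))" by (rule mono(2))
      finally show ?thesis by (simp add: f_def)
    qed (use Cons.IH Cons.prems in \<open>simp add: f_Cons\<close>)
  qed simp
  show "z \<in> set zs \<Longrightarrow> eqv m \<Longrightarrow> - {Idt, c} \<subseteq> bad m \<Longrightarrow> mrg (f p q zs m)"
  proof (cases zs)
    case (Cons z' zs')
    assume "eqv m" "- {Idt, c} \<subseteq> bad m"
    then show ?thesis
      unfolding Cons f_Cons
      by (intro mono(1)) (simp add: merge_upd_def)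
  qed simp
qed

text \<open>\<open>Q\<close> and \<open>B\<close> are the values of a closed relation at one pair;
  every rule that starts below them stays below them.\<close>

lemma fold_merge_upper:
  assumes "\<And>z. z \<in> set zs \<Longrightarrow> mrg (p z) \<Longrightarrow> mrg (q z) \<Longrightarrow> Q"
    and "\<And>z. z \<in> set zs \<Longrightarrow> mrg (p z) \<Longrightarrow> bad (q z) \<subseteq> B"
    and "eqv m \<Longrightarrow> - {Idt, c} \<subseteq> B \<Longrightarrow> Q"
    and "mrg m \<Longrightarrow> Q" "bad m \<subseteq> B"
  shows "(mrg (fold (\<lambda>z m. merge_upd c (p z) (q z) m) zs m) \<longrightarrow> Q) \<and>
    bad (fold (\<lambda>z m. merge_upd c (p z) (q z) m) zs m) \<subseteq> B"
  using assms
proof (induction zs arbitrary: m)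
  case (Cons z zs)
  let ?m = "merge_upd c (p z) (q z) m"
  have "(mrg (fold (\<lambda>z m. merge_upd c (p z) (q z) m) zs ?m) \<longrightarrow> Q) \<and>
    bad (fold (\<lambda>z m. merge_upd c (p z) (q z) m) zs ?m) \<subseteq> B"
  proof (rule Cons.IH)
    show "mrg ?m \<Longrightarrow> Q"
      unfolding merge_upd_def cell.sel
      using Cons.prems(1)[of z] Cons.prems(3) Cons.prems(4) subset_trans[OF _ Cons.prems(5)]
      by (elim disjE conjE) simp_all
    show "bad ?m \<subseteq> B"
      using Cons.prems(2)[of z] Cons.prems(5) by (simp add: merge_upd_def)
    show "eqv ?m \<Longrightarrow> - {Idt, c} \<subseteq> B \<Longrightarrow> Q"
      using Cons.prems(3) by (simp add: merge_upd_def)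
    show "\<And>z'. z' \<in> set zs \<Longrightarrow> mrg (p z') \<Longrightarrow> mrg (q z') \<Longrightarrow> Q"
      by (rule Cons.prems(1)) simp_all
    show "\<And>z'. z' \<in> set zs \<Longrightarrow> mrg (p z') \<Longrightarrow> bad (q z') \<subseteq> B"
      by (rule Cons.prems(2)) simp_all
  qed
  then show ?case by simp
qed simp

lemma closed_under_cong_imp:
  assumes cl: "closed_under V F c E Q B"
    and eq: "\<And>x y. x \<in> V \<Longrightarrow> y \<in> V \<Longrightarrow> F x y = F' x y \<and> E x y = E' x y \<and> Q x y = Q' x y \<and> B x y = B' x y"
  shows "closed_under V F' c E' Q' B'"
proof -
  have F: "F' x y = F x y" and E: "E' x y = E x y" and Q: "Q' x y = Q x y"
    and B: "B' x y = B x y" if "x \<in> V" "y \<in> V" for x y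
    using eq[OF that] by auto
  show ?thesis
    unfolding closed_under_def
  proof (intro conjI ballI impI)
    show "Q' x x" if "x \<in> V" for x
      using closed_underD(1)[OF cl that] Q[OF that that] by simp
    show "Q' x y" if "x \<in> V" "y \<in> V" "E' x y \<and> - {Idt, c} \<subseteq> B' x y" for x y
      using closed_underD(2)[OF cl that(1,2)] that(3) E[OF that(1,2)] Q[OF that(1,2)] B[OF that(1,2)] by simp
    show "Q' x y" if "x \<in> V" "y \<in> V" "z \<in> V" "Q' x z \<and> Q' y z" for x y z
      using closed_underD(3)[OF cl that(1-3)] that(4) Q[OF that(1,2)] Q[OF that(1,3)] Q[OF that(2,3)] by simp
    show "- F' x y \<subseteq> B' x y" if "x \<in> V" "y \<in> V" for x y
      using closed_underD(4)[OF cl that] F[OF that] B[OF that] by simp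
    show "B' y z \<subseteq> B' x y" if "x \<in> V" "y \<in> V" "z \<in> V" "Q' x z" for x y z
      using closed_underD(5)[OF cl that(1-3)] that(4) Q[OF that(1,3)] B[OF that(1,2)] B[OF that(2,3)] by simp
  qed
qed

lemma closed_under_cong:
  assumes "\<And>x y. x \<in> V \<Longrightarrow> y \<in> V \<Longrightarrow> F x y = F' x y \<and> E x y = E' x y \<and> Q x y = Q' x y"
  shows "closed_under V F c E Q B \<longleftrightarrow> closed_under V F' c E' Q' B"
  using closed_under_cong_imp[of V F c E Q B F' E' Q' B] closed_under_cong_imp[of V F' c E' Q' B F E Q B] assms
  by blast

definition merge_step :: "nat \<Rightarrow> atom \<Rightarrow> (nat \<Rightarrow> nat \<Rightarrow> cell) \<Rightarrow> nat \<Rightarrow> nat \<Rightarrow> cell" where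
  "merge_step n c M = sem n (Pass (merge_upd c)) M"

lemma merge_step_fixed [simp]:
  "dg (merge_step n c M x y) = dg (M x y)" "lb (merge_step n c M x y) = lb (M x y)"
  "eqv (merge_step n c M x y) = eqv (M x y)"
  unfolding merge_step_def sem.simps by (rule fold_merge(1-3))+

lemma merge_step_mono:
  "mrg (M x y) \<Longrightarrow> mrg (merge_step n c M x y)" "bad (M x y) \<subseteq> bad (merge_step n c M x y)"
  unfolding merge_step_def sem.simps by (rule fold_merge(4), assumption) (rule fold_merge(5))

lemma merge_step_upper:
  assumes cl: "closed_under {..<n} F c (\<lambda>x y. eqv (M x y)) Q B"
    and le: "\<And>x y. x < n \<Longrightarrow> y < n \<Longrightarrow> (mrg (M x y) \<longrightarrow> Q x y) \<and> bad (M x y) \<subseteq> B x y"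
    and xy: "x < n" "y < n"
  shows "(mrg (merge_step n c M x y) \<longrightarrow> Q x y) \<and> bad (merge_step n c M x y) \<subseteq> B x y"
  unfolding merge_step_def sem.simps
proof (rule fold_merge_upper)
  show "Q x y" if "z \<in> set [0..<n]" "mrg (M x z)" "mrg (M y z)" for z
  proof -
    have "Q x z" "Q y z" using le that xy by auto
    then show ?thesis using closed_underD(3)[OF cl, of x y z] that(1) xy by simp
  qed
  show "bad (M y z) \<subseteq> B x y" if "z \<in> set [0..<n]" "mrg (M x z)" for z
  proof -
    have "Q x z" "bad (M y z) \<subseteq> B y z" using le that xy by auto
    moreover have "Q x z \<longrightarrow> B y z \<subseteq> B x y"
      using closed_underD(5)[OF cl, of x y z] that(1) xy by simp
    ultimately show ?thesis by blast
  qed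
  show "Q x y" if "eqv (M x y)" "- {Idt, c} \<subseteq> B x y"
    using closed_underD(2)[OF cl, of x y] that xy by simp
qed (use le xy in auto)

text \<open>A violated condition would let a rule fire in the next sweep and change
  \<open>mrg\<close> or \<open>bad\<close>.\<close>

lemma merge_step_closed:
  assumes st: "\<And>x y. x < n \<Longrightarrow> y < n \<Longrightarrow>
      mrg (merge_step n c M x y) = mrg (M x y) \<and> bad (merge_step n c M x y) = bad (M x y)"
    and refl: "\<And>x. x < n \<Longrightarrow> mrg (M x x)"
    and F: "\<And>x y. x < n \<Longrightarrow> y < n \<Longrightarrow> - F x y \<subseteq> bad (M x y)"
  shows "closed_under {..<n} F c (\<lambda>x y. eqv (M x y)) (\<lambda>x y. mrg (M x y)) (\<lambda>x y. bad (M x y))"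
  unfolding closed_under_def
proof (intro conjI ballI impI)
  show "mrg (M x y)" if "x \<in> {..<n}" "y \<in> {..<n}" "eqv (M x y) \<and> - {Idt, c} \<subseteq> bad (M x y)" for x y
    \<comment> \<open>The choice \<open>z = x\<close> witnesses that the list of indices is not
      empty.\<close>
    using st[of x y] fold_merge(8)[where z = x and zs = "[0..<n]" and m = "M x y" and c = c and p = "M x" and q = "M y"] that
    by (simp add: merge_step_def)
  show "mrg (M x y)" if "x \<in> {..<n}" "y \<in> {..<n}" "z \<in> {..<n}" "mrg (M x z) \<and> mrg (M y z)" for x y z
    using st[of x y] fold_merge(6)[where z = z and zs = "[0..<n]" and m = "M x y" and c = c and p = "M x" and q = "M y"] that
    by (simp add: merge_step_def)
  show "bad (M y z) \<subseteq> bad (M x y)" if "x \<in> {..<n}" "y \<in> {..<n}" "z \<in> {..<n}" "mrg (M x z)" for x y z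
    using st[of x y] fold_merge(7)[where z = z and zs = "[0..<n]" and m = "M x y" and c = c and p = "M x" and q = "M y"] that
    by (simp add: merge_step_def)
qed (use refl F in auto)

lemma merge_iterate:
  fixes M :: "nat \<Rightarrow> nat \<Rightarrow> cell" and n :: nat and c :: atom
  defines "R \<equiv> (merge_step n c ^^ (5 * (n * n))) M"
  defines "E \<equiv> \<lambda>x y. eqv (M x y)"
  assumes refl: "\<And>x y. x < n \<Longrightarrow> y < n \<Longrightarrow> mrg (M x y) \<longleftrightarrow> x = y"
    and F: "\<And>x y. x < n \<Longrightarrow> y < n \<Longrightarrow> bad (M x y) = - F x y"
  shows "dg (R x y) = dg (M x y)" "lb (R x y) = lb (M x y)" "eqv (R x y) = eqv (M x y)"
    and "closed_under {..<n} F c E (\<lambda>x y. mrg (R x y)) (\<lambda>x y. bad (R x y))"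
    and "closed_under {..<n} F c E Q B \<Longrightarrow> x < n \<Longrightarrow> y < n \<Longrightarrow> mrg (R x y) \<Longrightarrow> Q x y"
proof -
  define N where "N = 5 * (n * n)"
  define A where "A k = (merge_step n c ^^ k) M" for k
  have A_Suc: "A (Suc k) = merge_step n c (A k)" for k by (simp add: A_def)
  have fixed: "dg (A k x y) = dg (M x y)" "lb (A k x y) = lb (M x y)" "eqv (A k x y) = eqv (M x y)" for k x y
    by (induction k) (simp_all add: A_def)
  have R: "R = A N" by (simp add: R_def A_def N_def)
  show "dg (R x y) = dg (M x y)" "lb (R x y) = lb (M x y)" "eqv (R x y) = eqv (M x y)"
    by (simp_all add: R fixed)
  have mono: "mrg (A j x y) \<longrightarrow> mrg (A k x y)" "bad (A j x y) \<subseteq> bad (A k x y)" if "j \<le> k" for j k x y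
    using that
  proof (induction rule: dec_induct)
    case (step k)
    show "mrg (A j x y) \<longrightarrow> mrg (A (Suc k) x y)" "bad (A j x y) \<subseteq> bad (A (Suc k) x y)"
      unfolding A_Suc using step.IH merge_step_mono[of "A k" x y n c] by blast+
  qed simp_all
  have upper: "(mrg (A k x y) \<longrightarrow> Q x y) \<and> bad (A k x y) \<subseteq> B x y"
    if cl: "closed_under {..<n} F c E Q B" and le: "\<And>x y. x < n \<Longrightarrow> y < n \<Longrightarrow> (mrg (A j x y) \<longrightarrow> Q x y) \<and> bad (A j x y) \<subseteq> B x y"
      and "j \<le> k" "x < n" "y < n" for Q B j k x y
    using that(3-5)
  proof (induction arbitrary: x y rule: dec_induct)
    case (step k)
    show ?case
      unfolding A_Suc
      by (rule merge_step_upper[where F = F]) (use cl step in \<open>simp_all add: fixed E_def\<close>)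
  qed (use le in blast)
  have cl0: "(mrg (A 0 x y) \<longrightarrow> Q x y) \<and> bad (A 0 x y) \<subseteq> B x y"
    if "closed_under {..<n} F c E Q B" "x < n" "y < n" for Q B x y
    using that(2,3) refl[of x y] F[of x y] closed_underD(1,4)[OF that(1), of x] by (auto simp: A_def)
  show "Q x y" if cl: "closed_under {..<n} F c E Q B" and "x < n" "y < n" "mrg (R x y)"
    using upper[where j = 0 and k = N, OF cl cl0[OF cl] le0 that(2,3)] that(4) unfolding R by simp
  \<comment> \<open>\<open>None\<close> encodes the bit \<open>mrg\<close> and \<open>Some d\<close>
    the membership of \<open>d\<close> in \<open>bad\<close>, so one growing set records all
    bits.\<close>
  define X where "X k = {(x, y, d). x < n \<and> y < n \<and>
      (case d of None \<Rightarrow> mrg (A k x y) | Some d \<Rightarrow> d \<in> bad (A k x y))}" for k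
  have "\<exists>k\<le>N. X (Suc k) = X k"
  proof (rule pigeonhole_stable)
    let ?U = "{..<n} \<times> {..<n} \<times> (UNIV :: atom option set)"
    show "finite ?U" by simp
    have "card (UNIV :: atom option set) = 5"
      by (simp add: UNIV_option_conv card_image UNIV_atom)
    then show "card ?U \<le> N" by (simp add: card_cartesian_product N_def)
    show "X k \<subseteq> ?U" for k by (auto simp: X_def)
    show "X k \<subseteq> X (Suc k)" for k
    proof
      fix t assume t: "t \<in> X k"
      obtain x y d where "t = (x, y, d)" by (cases t)
      then show "t \<in> X (Suc k)"
        using t mono(1)[of k "Suc k" x y] subsetD[OF mono(2)[of k "Suc k" x y]]
        by (cases d) (simp_all add: X_def)
    qed
  qed
  then obtain k where k: "k \<le> N" "X (Suc k) = X k" by blast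
  have Xeq: "mrg (A i x y) = mrg (A j x y) \<and> bad (A i x y) = bad (A j x y)"
    if "X i = X j" "x < n" "y < n" for i j x y
  proof -
    have "(x, y, d) \<in> X i \<longleftrightarrow> (x, y, d) \<in> X j" for d using that by simp
    from this[of None] this[of "Some d" for d] show ?thesis
      using that(2,3) by (simp add: X_def set_eq_iff)
  qed
  have clk: "closed_under {..<n} F c (\<lambda>x y. eqv (A k x y)) (\<lambda>x y. mrg (A k x y)) (\<lambda>x y. bad (A k x y))"
  proof (rule merge_step_closed)
    show "mrg (merge_step n c (A k) x y) = mrg (A k x y) \<and> bad (merge_step n c (A k) x y) = bad (A k x y)"
      if "x < n" "y < n" for x y
      using Xeq[OF k(2) that] by (simp add: A_Suc)
    show "mrg (A k x x)" if "x < n" for x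
      using mono(1)[of 0 k x x] refl[OF that that] by (simp add: A_def)
    show "- F x y \<subseteq> bad (A k x y)" if "x < n" "y < n" for x y
      using mono(2)[of 0 k x y] F[OF that] by (simp add: A_def)
  qed
  then have clE: "closed_under {..<n} F c E (\<lambda>x y. mrg (A k x y)) (\<lambda>x y. bad (A k x y))"
    by (simp add: fixed E_def)
  have lek: "(mrg (A k x y) \<longrightarrow> mrg (A k x y)) \<and> bad (A k x y) \<subseteq> bad (A k x y)" for x y
    by simp
  \<comment> \<open>Stage \<open>k\<close> is closed and therefore bounds all later stages from
    above; monotonicity gives the other inclusion.\<close>
  have eq: "mrg (R x y) = mrg (A k x y)" "bad (R x y) = bad (A k x y)" if "x < n" "y < n" for x y
  proof -
    have u: "(mrg (A N x y) \<longrightarrow> mrg (A k x y)) \<and> bad (A N x y) \<subseteq> bad (A k x y)"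
      by (rule upper[where j = k and k = N, OF clE lek k(1) that])
    show "mrg (R x y) = mrg (A k x y)"
      unfolding R using u mono(1)[OF k(1), of x y] by blast
    show "bad (R x y) = bad (A k x y)"
      unfolding R using u mono(2)[OF k(1), of x y] by (intro equalityI conjunct2[OF u])
  qed
  show "closed_under {..<n} F c E (\<lambda>x y. mrg (R x y)) (\<lambda>x y. bad (R x y))"
    by (rule closed_under_cong_imp[OF clE]) (use eq in simp)
qed

lemma funpow_5: "f (f (f (f (f x)))) = (f ^^ 5) x"
  by (simp add: eval_nat_numeral)

lemma sem_merge_loop:
  "sem n (let P = Pass (merge_upd c) in Loop (Loop (PSeq P (PSeq P (PSeq P (PSeq P P)))))) M =
   (merge_step n c ^^ (5 * (n * n))) M"
proof -
  have "sem n (let P = Pass (merge_upd c) in PSeq P (PSeq P (PSeq P (PSeq P P)))) = merge_step n c ^^ 5"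
    unfolding Let_def sem.simps(2) merge_step_def[symmetric] funpow_5 by (simp add: fun_eq_iff)
  moreover have "sem n (Loop p) = sem n p ^^ n" for p :: "cell prog"
    by (simp add: fun_eq_iff)
  ultimately show ?thesis
    by (simp only: Let_def funpow_mult ac_simps)
qed

text \<open>The new partition is the least closed relation for \<open>c\<close>, which is all that
  the correctness proof uses.\<close>

definition refines :: "nat \<Rightarrow> atom \<Rightarrow> (nat \<Rightarrow> nat \<Rightarrow> cell) \<Rightarrow> (nat \<Rightarrow> nat \<Rightarrow> cell) \<Rightarrow> bool" where
  "refines n c M M' \<longleftrightarrow>
     (\<forall>x<n. \<forall>y<n. dg (M' x y) = dg (M x y) \<and> lb (M' x y) = lb (M x y)) \<and>
     (\<exists>B. closed_under {..<n} (\<lambda>x y. lb (M x y)) c (\<lambda>x y. eqv (M x y)) (\<lambda>x y. eqv (M' x y)) B) \<and>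
     (\<forall>Q B x y. closed_under {..<n} (\<lambda>x y. lb (M x y)) c (\<lambda>x y. eqv (M x y)) Q B \<longrightarrow>
        x < n \<longrightarrow> y < n \<longrightarrow> eqv (M' x y) \<longrightarrow> Q x y)"

lemma refines_refine_prog:
  assumes "diagonal n M"
  shows "refines n c M (sem n (refine_prog c) M)"
proof -
  define F where "F x y = lb (M x y)" for x y
  define E where "E x y = eqv (M x y)" for x y
  define A where "A = sem n (Pass reset_upd) M"
  define R where "R = (merge_step n c ^^ (5 * (n * n))) A"
  have A: "A x y = Cell (dg (M x y)) (lb (M x y)) (eqv (M x y)) (dg (M x y)) (- lb (M x y))" if "x < n" for x y
    using sem_reset[OF assms that, of y] unfolding A_def Let_def .
  have 1: "mrg (A x y) \<longleftrightarrow> x = y" "bad (A x y) = - F x y" if "x < n" "y < n" for x y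
    using assms that A[OF that(1), of y] unfolding diagonal_def F_def by simp_all
  note it = merge_iterate[where M = A and n = n and c = c and F = F, folded R_def]
  have R: "dg (R x y) = dg (M x y)" "lb (R x y) = lb (M x y)" "eqv (R x y) = eqv (M x y)" if "x < n" for x y
    using it(1-3)[of x y, OF 1] A[OF that, of y] by simp_all
  have "diagonal n R"
    using assms R(1) unfolding diagonal_def by simp
  then have C: "sem n (Pass commit_upd) R x y = Cell (dg (M x y)) (lb (M x y)) (mrg (R x y)) (mrg (R x y)) (bad (R x y))"
    if "x < n" for x y
    using sem_commit[of n R x y] that R[OF that] by (simp only: Let_def)
  have sem: "sem n (refine_prog c) M = sem n (Pass commit_upd) R"
    unfolding refine_prog_def Let_def sem.simps(2) sem_merge_loop[unfolded Let_def] R_def A_def ..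
  have cong: "closed_under {..<n} F c (\<lambda>x y. eqv (A x y)) Q B \<longleftrightarrow> closed_under {..<n} F c E Q B" for Q B
    by (rule closed_under_cong) (simp add: A E_def)
  have "closed_under {..<n} F c E (\<lambda>x y. mrg (R x y)) (\<lambda>x y. bad (R x y))"
    using it(4)[OF 1] unfolding cong by simp
  moreover have "closed_under {..<n} F c E (\<lambda>x y. mrg (R x y)) B \<longleftrightarrow>
      closed_under {..<n} F c E (\<lambda>x y. eqv (sem n (refine_prog c) M x y)) B" for B
    by (rule closed_under_cong) (simp add: sem C del: sem.simps)
  ultimately have cl: "\<exists>B. closed_under {..<n} F c E (\<lambda>x y. eqv (sem n (refine_prog c) M x y)) B"
    by blast
  have upper: "Q x y" if "closed_under {..<n} F c E Q B" "x < n" "y < n" "eqv (sem n (refine_prog c) M x y)" for Q B x y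
    using it(5)[unfolded cong, OF 1 that(1-3)] that(2,4) by (simp add: sem C del: sem.simps)
  show ?thesis
    unfolding refines_def F_def[symmetric] E_def[symmetric]
  proof (intro conjI allI impI)
    show "dg (sem n (refine_prog c) M x y) = dg (M x y)" "lb (sem n (refine_prog c) M x y) = F x y"
      if "x < n" for x y
      using that by (simp_all add: sem C F_def del: sem.simps)
    show "\<exists>B. closed_under {..<n} F c E (\<lambda>x y. eqv (sem n (refine_prog c) M x y)) B" by (rule cl)
  qed (rule upper)
qed

definition invariant :: "nat \<Rightarrow> (nat \<Rightarrow> nat \<Rightarrow> atom set) \<Rightarrow> (nat \<Rightarrow> nat \<Rightarrow> cell) \<Rightarrow> bool" where
  "invariant n F M \<longleftrightarrow> diagonal n M \<and> (\<forall>x<n. \<forall>y<n. lb (M x y) = F x y) \<and>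
     equiv_rel {..<n} (\<lambda>x y. eqv (M x y)) \<and>
     (\<exists>g. quotient_colouring {..<n} F (\<lambda>x y. eqv (M x y)) g)"

lemma invariant_refine:
  assumes inv: "invariant n F M" and c: "c \<noteq> Idt"
  defines "M' \<equiv> sem n (refine_prog c) M"
  shows "invariant n F M'" "x < n \<Longrightarrow> y < n \<Longrightarrow> eqv (M' x y) \<Longrightarrow> eqv (M x y)"
    and "closed_under {..<n} F c (\<lambda>x y. eqv (M x y)) Q B \<Longrightarrow> x < n \<Longrightarrow> y < n \<Longrightarrow> eqv (M' x y) \<Longrightarrow> Q x y"
proof -
  have F: "lb (M x y) = F x y" if "x < n" "y < n" for x y
    using inv that unfolding invariant_def by blast
  have E: "equiv_rel {..<n} (\<lambda>x y. eqv (M x y))"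
    using inv unfolding invariant_def by blast
  obtain g where g: "quotient_colouring {..<n} F (\<lambda>x y. eqv (M x y)) g"
    using inv unfolding invariant_def by blast
  have r: "refines n c M M'"
    unfolding M'_def using inv invariant_def refines_refine_prog by blast
  have cong: "closed_under {..<n} (\<lambda>x y. lb (M x y)) c (\<lambda>x y. eqv (M x y)) Q B \<longleftrightarrow>
      closed_under {..<n} F c (\<lambda>x y. eqv (M x y)) Q B" for Q B
    by (rule closed_under_cong) (simp add: F)
  obtain B where B: "closed_under {..<n} F c (\<lambda>x y. eqv (M x y)) (\<lambda>x y. eqv (M' x y)) B"
    using r unfolding refines_def cong by blast
  have fixed: "dg (M' x y) = dg (M x y)" "lb (M' x y) = lb (M x y)" if "x < n" "y < n" for x y
    using r that unfolding refines_def by blast+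
  show upper: "closed_under {..<n} F c (\<lambda>x y. eqv (M x y)) Q B \<Longrightarrow> x < n \<Longrightarrow> y < n \<Longrightarrow> eqv (M' x y) \<Longrightarrow> Q x y"
    for Q B x y
    using r unfolding refines_def cong by blast
  show le: "x < n \<Longrightarrow> y < n \<Longrightarrow> eqv (M' x y) \<Longrightarrow> eqv (M x y)" for x y
    by (rule upper[OF closed_under_top[OF E]])
  have "\<exists>g'. quotient_colouring {..<n} F (\<lambda>x y. eqv (M' x y)) g'"
    by (rule quotient_colouring_refine[OF g c B]) (use le in auto)
  moreover have "diagonal n M'"
    using inv fixed(1) unfolding invariant_def diagonal_def by simp
  ultimately show "invariant n F M'"
    unfolding invariant_def using closed_under_equiv_rel[OF B] fixed(2) F by simp
qed

lemma main_prog_correct: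
  assumes d: "diagonal n M" and f: "\<And>x y. x < n \<Longrightarrow> y < n \<Longrightarrow> lb (M x y) = f x y"
    and e: "\<And>x y. x < n \<Longrightarrow> y < n \<Longrightarrow> eqv (M x y)"
  shows "(\<forall>x<n. \<forall>y<n. eqv (sem n main_prog M x y) \<longrightarrow> Idt \<in> lb (sem n main_prog M x y)) \<longleftrightarrow>
    (\<exists>g. gallai {..<n} g \<and> (\<forall>x<n. \<forall>y<n. g x y \<in> f x y))"
proof -
  \<comment> \<open>Colourings are symmetric, so only atoms in both labels of a pair can
    occur.\<close>
  define F where "F x y = f x y \<inter> f y x" for x y
  define A where "A = sem n (Pass symm_upd) M"
  define r where "r c = sem n (refine_prog c)" for c
  define S where "S k = ((r At_c \<circ> r At_b \<circ> r At_a) ^^ k) A" for k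
  have S_Suc: "S (Suc k) = r At_c (r At_b (r At_a (S k)))" for k
    by (simp add: S_def)
  have loop: "sem n (Loop p) = sem n p ^^ n" for p :: "cell prog"
    by (simp add: fun_eq_iff)
  have "sem n (PSeq (refine_prog At_a) (PSeq (refine_prog At_b) (refine_prog At_c))) =
      r At_c \<circ> r At_b \<circ> r At_a"
    by (simp add: fun_eq_iff r_def)
  then have final: "sem n main_prog M = S (n * n)"
    unfolding main_prog_def sem.simps(2) loop S_def A_def by (simp only: funpow_mult)
  have A: "A x y = Cell (dg (M x y)) (F x y) True (mrg (M x y)) (bad (M x y))" if "x < n" "y < n" for x y
    using sem_symm[OF d that(1), of y] f that e unfolding A_def Let_def F_def by simp
  \<comment> \<open>With a single class the constant colouring \<open>Idt\<close> respects the
    labels vacuously.\<close>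
  have "quotient_colouring {..<n} F (\<lambda>x y. eqv (A x y)) (\<lambda>_ _. Idt)"
    using A by (simp add: quotient_colouring_def gallai_def atom_le_comp_def)
  then have "invariant n F A"
    unfolding invariant_def diagonal_def equiv_rel_def using A d
    by (auto simp: diagonal_def)
  then have inv: "invariant n F (S k)" for k
    by (induction k) (simp_all add: S_def r_def invariant_refine(1))
  show ?thesis
    unfolding final
  proof
    assume ok: "\<forall>x<n. \<forall>y<n. eqv (S (n * n) x y) \<longrightarrow> Idt \<in> lb (S (n * n) x y)"
    obtain g where g: "quotient_colouring {..<n} F (\<lambda>x y. eqv (S (n * n) x y)) g"
      using inv unfolding invariant_def by blast
    have "g x y \<in> F x y" if "x < n" "y < n" for x y
    proof (cases "eqv (S (n * n) x y)")
      case True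
      then have "g x y = Idt" "Idt \<in> lb (S (n * n) x y)" "lb (S (n * n) x y) = F x y"
        using g ok that inv[of "n * n"] unfolding quotient_colouring_def invariant_def by auto
      then show ?thesis by simp
    next
      case False
      then show ?thesis using g that unfolding quotient_colouring_def by auto
    qed
    then show "\<exists>g. gallai {..<n} g \<and> (\<forall>x<n. \<forall>y<n. g x y \<in> f x y)"
      using g unfolding quotient_colouring_def F_def by blast
  next
    assume "\<exists>g. gallai {..<n} g \<and> (\<forall>x<n. \<forall>y<n. g x y \<in> f x y)"
    then obtain g where g: "gallai {..<n} g" and gf: "\<And>x y. x < n \<Longrightarrow> y < n \<Longrightarrow> g x y \<in> f x y" by blast
    have gF: "g x y \<in> F x y" if "x \<in> {..<n}" "y \<in> {..<n}" for x y
      using gf[of x y] gf[of y x] gallai_sym[OF g that] that by (simp add: F_def)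
    have inv': "invariant n F (r At_a (S k))" "invariant n F (r At_b (r At_a (S k)))" for k
      using inv by (simp_all add: r_def invariant_refine(1))
    have le: "eqv (r c N x y) \<Longrightarrow> eqv (N x y)" if "invariant n F N" "c \<noteq> Idt" "x < n" "y < n" for c N x y
      using invariant_refine(2)[OF that] unfolding r_def .
    have S_le: "eqv (S (Suc k) x y) \<Longrightarrow> eqv (S k x y)" if "x < n" "y < n" for k x y
      unfolding S_Suc using le[OF _ _ that] inv inv' by (metis atom.distinct(1,3,5))
    define X where "X k = {(x, y). x < n \<and> y < n \<and> \<not> eqv (S k x y)}" for k
    have "\<exists>k\<le>n * n. X (Suc k) = X k"
    proof (rule pigeonhole_stable)
      show "finite ({..<n} \<times> {..<n})" by simp
      show "card ({..<n} \<times> {..<n}) \<le> n * n" by simp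
      show "X k \<subseteq> {..<n} \<times> {..<n}" for k by (auto simp: X_def)
      show "X k \<subseteq> X (Suc k)" for k using S_le by (auto simp: X_def)
    qed
    then obtain k where k: "k \<le> n * n" "X (Suc k) = X k" by blast
    define E where "E x y = eqv (S k x y)" for x y
    have stable: "E x y \<longleftrightarrow> eqv (S (Suc k) x y)" if "x < n" "y < n" for x y
    proof -
      have "(x, y) \<in> X (Suc k) \<longleftrightarrow> (x, y) \<in> X k" using k(2) by simp
      then show ?thesis using that by (simp add: X_def E_def)
    qed
    \<comment> \<open>A round that changes nothing squeezes its intermediate partitions between
      equal ones, so it is stable for each colour separately.\<close>
    have b: "eqv (r At_b (r At_a (S k)) x y) \<longleftrightarrow> E x y" and a: "eqv (r At_a (S k) x y) \<longleftrightarrow> E x y"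
      if "x < n" "y < n" for x y
      using stable[OF that, unfolded S_Suc] le[OF inv'(2)[of k] _ that, of At_c] le[OF inv'(1)[of k] _ that, of At_b]
        le[OF inv[of k] _ that, of At_a] unfolding E_def by auto
    have c: "eqv (r At_c (r At_b (r At_a (S k))) x y) \<longleftrightarrow> E x y" if "x < n" "y < n" for x y
      using stable[OF that] by (simp add: S_Suc)
    have Idt_F: "Idt \<in> F x y" if "x < n" "y < n" "E x y" for x y
    proof (rule stable_Idt[where V = "{..<n}" and F = F and E = E, OF _ g gF])
      show "equiv_rel {..<n} E"
        using inv[of k] unfolding invariant_def E_def by blast
      show "Q x y" if c': "c' \<noteq> Idt" and cl: "closed_under {..<n} F c' E Q B" and "x \<in> {..<n}" "y \<in> {..<n}" "E x y"
        for c' Q B x y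
      proof -
        have xy: "x < n" "y < n" using that by auto
        have cong: "closed_under {..<n} F c' (\<lambda>x y. eqv (N x y)) Q B"
          if "\<And>x y. x < n \<Longrightarrow> y < n \<Longrightarrow> eqv (N x y) \<longleftrightarrow> E x y" for N
          using cl closed_under_cong[of "{..<n}" F F E "\<lambda>x y. eqv (N x y)" Q Q c' B] that by simp
        consider "c' = At_a" | "c' = At_b" | "c' = At_c" using c' by (cases c') auto
        then show ?thesis
        proof cases
          case 1
          then show ?thesis
            using invariant_refine(3)[OF inv[of k] c' cong xy] a[OF xy] \<open>E x y\<close> by (simp add: r_def E_def)
        next
          case 2
          then show ?thesis
            using invariant_refine(3)[OF inv'(1)[of k] c' cong[OF a] xy] b[OF xy] \<open>E x y\<close> by (simp add: r_def)
        next
          case 3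
          then show ?thesis
            using invariant_refine(3)[OF inv'(2)[of k] c' cong[OF b] xy] c[OF xy] \<open>E x y\<close> by (simp add: r_def)
        qed
      qed
    qed (use that in auto)
    \<comment> \<open>The final partition may come after the stable stage \<open>k\<close>, but it
      is no coarser.\<close>
    have "eqv (S j x y) \<Longrightarrow> eqv (S k x y)" if "k \<le> j" "x < n" "y < n" for j x y
      using that(1) by (induction rule: dec_induct) (use S_le that(2,3) in blast)+
    then have "eqv (S (n * n) x y) \<Longrightarrow> E x y" if "x < n" "y < n" for x y
      using k(1) that unfolding E_def by blast
    then show "\<forall>x<n. \<forall>y<n. eqv (S (n * n) x y) \<longrightarrow> Idt \<in> lb (S (n * n) x y)"
      using Idt_F inv[of "n * n"] unfolding invariant_def by simp
  qed
qed

section \<open>Representations\<close>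

context
  fixes B :: "'u set" and R :: "atom set \<Rightarrow> ('u \<times> 'u) set"
  assumes rep: "ra_24_65.representation B R"
begin

lemma rep_sup: "R (X \<union> Y) = R X \<union> R Y"
  using rep unfolding ra_24_65.representation_def by (elim conjE allE)

lemma rep_mono: "X \<subseteq> Y \<Longrightarrow> R X \<subseteq> R Y"
  using rep_sup[of X Y] by (simp only: sup.absorb2) (rule equalityD2[THEN le_supE], assumption)

lemma rep_compl: "R (- X) = R UNIV - R X"
  using rep unfolding ra_24_65.representation_def by (elim conjE allE)

lemma rep_atom:
  assumes "e \<in> R X"
  shows "\<exists>p. e \<in> R {p}"
proof -
  have "R X \<subseteq> R ({Idt} \<union> ({At_a} \<union> ({At_b} \<union> {At_c})))"
    by (rule rep_mono) (use UNIV_atom in auto)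
  then show ?thesis
    using assms unfolding rep_sup by blast
qed

lemma rep_atom_in:
  assumes "e \<in> R {p}" "e \<in> R X"
  shows "p \<in> X"
proof (rule ccontr)
  assume "p \<notin> X"
  then have "R {p} \<subseteq> R (- X)" by (intro rep_mono) simp
  then show False using assms rep_compl by blast
qed

lemma rep_gallai:
  assumes s: "s ` V \<subseteq> B" and f: "\<forall>x\<in>V. \<forall>y\<in>V. (s x, s y) \<in> R (f x y)"
  shows "\<exists>g. gallai V g \<and> (\<forall>x\<in>V. \<forall>y\<in>V. g x y \<in> f x y)"
proof -
  define g where "g x y = (SOME p. (s x, s y) \<in> R {p})" for x y
  have g: "(s x, s y) \<in> R {g x y}" if "x \<in> V" "y \<in> V" for x y
    unfolding g_def by (rule someI_ex, rule rep_atom) (use f that in blast)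
  have gin: "g x y \<in> X" if "x \<in> V" "y \<in> V" "(s x, s y) \<in> R X" for x y X
    by (rule rep_atom_in[OF g[OF that(1,2)] that(3)])
  have id: "(s x, s x) \<in> R {Idt}" if "x \<in> V" for x
  proof -
    have "R Idt_24_65 = {(u, u) | u. u \<in> B}"
      using rep unfolding ra_24_65.representation_def by (elim conjE)
    then show ?thesis using s that unfolding Idt_24_65_def by blast
  qed
  have conv: "(v, u) \<in> R X \<Longrightarrow> (u, v) \<in> R X" for u v X
    using rep unfolding ra_24_65.representation_def conv_24_65_def by blast
  have comp: "R (comp_24_65 X Y) = R X O R Y" for X Y
    using rep unfolding ra_24_65.representation_def by blast
  have "gallai V g"
    unfolding gallai_def
  proof (intro conjI ballI)
    show "g x x = Idt" if "x \<in> V" for x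
      using gin[OF that that id[OF that]] by simp
    show "g x y = g y x" if "x \<in> V" "y \<in> V" for x y
      using gin[OF that conv[OF g[OF that(2,1)]]] by simp
    show "atom_le_comp (g x z) (g x y) (g y z)" if "x \<in> V" "y \<in> V" "z \<in> V" for x y z
    proof -
      have "(s x, s z) \<in> R (comp_24_65 {g x y} {g y z})"
        unfolding comp using g that by blast
      from gin[OF that(1,3) this] show ?thesis by (simp add: comp_24_65_def)
    qed
  qed
  then show ?thesis using gin f by blast
qed

end

lemma satisfiable_gallai:
  "ra_24_65.satisfiable (U :: 'u itself) V f \<Longrightarrow> \<exists>g. gallai V g \<and> (\<forall>x\<in>V. \<forall>y\<in>V. g x y \<in> f x y)"
  unfolding ra_24_65.satisfiable_def by (elim exE conjE) (rule rep_gallai)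

text \<open>What a colouring lacks to be a representation: \<open>Idt\<close> is true equality, and
  every composition has witnesses.\<close>

definition extendable :: "'u set \<Rightarrow> ('u \<Rightarrow> 'u \<Rightarrow> atom) \<Rightarrow> bool" where
  "extendable B h \<longleftrightarrow> (\<forall>x\<in>B. \<forall>y\<in>B. h x y = Idt \<longrightarrow> x = y) \<and>
     (\<forall>x\<in>B. \<forall>y\<in>B. \<forall>p q. atom_le_comp (h x y) p q \<longrightarrow> (\<exists>z\<in>B. h x z = p \<and> h z y = q))"

lemma representation_extendable:
  assumes "gallai B h" "extendable B h"
  shows "ra_24_65.representation B (\<lambda>X. {(x, y). x \<in> B \<and> y \<in> B \<and> h x y \<in> X})"
  unfolding ra_24_65.representation_def
proof (intro conjI allI)
  show "{(x, y). x \<in> B \<and> y \<in> B \<and> h x y \<in> Idt_24_65} = {(u, u) | u. u \<in> B}"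
    using assms unfolding Idt_24_65_def extendable_def gallai_def by auto
  show "{(x, y). x \<in> B \<and> y \<in> B \<and> h x y \<in> conv_24_65 X} =
      {(u, v). (v, u) \<in> {(x, y). x \<in> B \<and> y \<in> B \<and> h x y \<in> X}}" for X
    using gallai_sym[OF assms(1)] by (auto simp: conv_24_65_def)
  show "{(x, y). x \<in> B \<and> y \<in> B \<and> h x y \<in> comp_24_65 X Y} =
      {(x, y). x \<in> B \<and> y \<in> B \<and> h x y \<in> X} O {(x, y). x \<in> B \<and> y \<in> B \<and> h x y \<in> Y}" (is "?L = ?R") for X Y
  proof
    show "?L \<subseteq> ?R"
    proof clarify
      fix x y assume xy: "x \<in> B" "y \<in> B" "h x y \<in> comp_24_65 X Y"
      then obtain p q where pq: "p \<in> X" "q \<in> Y" "atom_le_comp (h x y) p q"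
        unfolding comp_24_65_def by blast
      then obtain z where "z \<in> B" "h x z = p" "h z y = q"
        using assms(2) xy(1,2) unfolding extendable_def by blast
      then show "(x, y) \<in> ?R" using pq xy by blast
    qed
    show "?R \<subseteq> ?L"
      using gallai_triangle[OF assms(1)] unfolding comp_24_65_def by fastforce
  qed
qed auto

lemma gallai_comap:
  assumes "gallai P h" "d ` Q \<subseteq> P"
  shows "gallai Q (\<lambda>x y. h (d x) (d y))"
proof -
  have d: "d x \<in> P" if "x \<in> Q" for x using assms(2) that by blast
  show ?thesis
    unfolding gallai_def
  proof (intro conjI ballI)
    show "h (d x) (d x) = Idt" if "x \<in> Q" for x
      by (rule gallai_refl[OF assms(1) d[OF that]])
    show "h (d x) (d y) = h (d y) (d x)" if "x \<in> Q" "y \<in> Q" for x y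
      by (rule gallai_sym[OF assms(1) d[OF that(1)] d[OF that(2)]])
    show "atom_le_comp (h (d x) (d z)) (h (d x) (d y)) (h (d y) (d z))" if "x \<in> Q" "y \<in> Q" "z \<in> Q" for x y z
      by (rule gallai_triangle[OF assms(1) d[OF that(1)] d[OF that(2)] d[OF that(3)]])
  qed
qed

text \<open>Serves to move the constructed space to a set of natural numbers.\<close>

lemma extendable_comap:
  assumes "extendable P h" "bij_betw d Q P"
  shows "extendable Q (\<lambda>x y. h (d x) (d y))"
proof -
  have inj: "inj_on d Q" and im: "d ` Q = P" using assms(2) by (simp_all add: bij_betw_def)
  have d: "d x \<in> P" if "x \<in> Q" for x using im that by blast
  show ?thesis
    unfolding extendable_def
  proof (intro conjI ballI allI impI)
    fix x y p q assume xy: "x \<in> Q" "y \<in> Q"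
    show "x = y" if "h (d x) (d y) = Idt"
    proof -
      have "d x = d y"
        using assms(1) d[OF xy(1)] d[OF xy(2)] that unfolding extendable_def by blast
      then show ?thesis using inj_onD[OF inj _ xy] by blast
    qed
    assume "atom_le_comp (h (d x) (d y)) p q"
    then obtain z where z: "z \<in> P" "h (d x) z = p" "h z (d y) = q"
      using assms(1) d[OF xy(1)] d[OF xy(2)] unfolding extendable_def by blast
    then obtain z' where "z' \<in> Q" "z = d z'" using im by blast
    with z show "\<exists>z\<in>Q. h (d x) (d z) = p \<and> h (d z) (d y) = q" by blast
  qed
qed

section \<open>The ultrametric space over a colouring\<close>

definition level_colour :: "int \<Rightarrow> atom" where
  "level_colour l = (if l mod 3 = 0 then At_a else if l mod 3 = 1 then At_b else At_c)"

lemma level_colour_neq_Idt [simp]: "level_colour l \<noteq> Idt"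
  by (simp add: level_colour_def)

text \<open>Level \<open>0\<close> is excluded because it carries the given colouring.\<close>

lemma level_colour_cofinal:
  assumes "p \<noteq> Idt"
  shows "\<exists>l>m. l \<noteq> 0 \<and> level_colour l = p" "\<exists>l<m. l \<noteq> 0 \<and> level_colour l = p"
proof -
  obtain i :: int where i: "0 \<le> i" "i < 3" "level_colour i = p"
  proof (cases p)
    case Idt then show ?thesis using assms by simp
  next
    case At_a then show ?thesis using that[of 0] by (simp add: level_colour_def)
  next
    case At_b then show ?thesis using that[of 1] by (simp add: level_colour_def)
  next
    case At_c then show ?thesis using that[of 2] by (simp add: level_colour_def)
  qed
  have shift: "level_colour (3 * k + i) = p" for k
  proof -
    have "(3 * k + i) mod 3 = i mod 3" by simp
    then show ?thesis using i(3) by (simp only: level_colour_def)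
  qed
  show "\<exists>l>m. l \<noteq> 0 \<and> level_colour l = p"
    using i shift[of "\<bar>m\<bar> + 1"] by (intro exI[of _ "3 * (\<bar>m\<bar> + 1) + i"]) auto
  show "\<exists>l<m. l \<noteq> 0 \<and> level_colour l = p"
    using i shift[of "- \<bar>m\<bar> - 1"] by (intro exI[of _ "3 * (- \<bar>m\<bar> - 1) + i"]) auto
qed

definition first_diff :: "(int \<Rightarrow> nat) \<Rightarrow> (int \<Rightarrow> nat) \<Rightarrow> int \<Rightarrow> bool" where
  "first_diff x y l \<longleftrightarrow> x l \<noteq> y l \<and> (\<forall>k<l. x k = y k)"

lemma first_diff_unique: "first_diff x y l \<Longrightarrow> first_diff x y l' \<Longrightarrow> l = l'"
  unfolding first_diff_def by (meson linorder_neqE)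

lemma first_diff_sym: "first_diff x y l \<longleftrightarrow> first_diff y x l"
  unfolding first_diff_def by metis

text \<open>Two points get their colour at the first level at which they differ. Level \<open>0\<close> contains
  the given colouring \<open>g\<close>, and any other level is coloured by a single colour, each of which occurs
  both above and below all levels.\<close>

definition level :: "(nat \<Rightarrow> nat \<Rightarrow> atom) \<Rightarrow> int \<Rightarrow> nat \<Rightarrow> nat \<Rightarrow> atom" where
  "level g l u v = (if l = 0 then g u v else if u = v then Idt else level_colour l)"

lemma level_0: "level g 0 u v = g u v"
  by (simp add: level_def)

definition colour :: "(nat \<Rightarrow> nat \<Rightarrow> atom) \<Rightarrow> (int \<Rightarrow> nat) \<Rightarrow> (int \<Rightarrow> nat) \<Rightarrow> atom" where
  "colour g x y = (if x = y then Idt else let l = THE l. first_diff x y l in level g l (x l) (y l))"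

lemma colour_first_diff: "first_diff x y l \<Longrightarrow> colour g x y = level g l (x l) (y l)"
proof -
  assume l: "first_diff x y l"
  then have "(THE l. first_diff x y l) = l"
    using first_diff_unique by blast
  moreover have "x \<noteq> y" using l by (auto simp: first_diff_def)
  ultimately show ?thesis by (simp add: colour_def)
qed

text \<open>Finite support ensures a first difference although the levels extend to minus infinity,
  and it makes the space countable.\<close>

definition points :: "nat set \<Rightarrow> (int \<Rightarrow> nat) set" where
  "points V = {x. finite {l. x l \<noteq> 0} \<and> x 0 \<in> V}"

lemma countable_points: "countable (points V)"
proof -
  define e where "e x = {(l, x l) | l. x l \<noteq> 0}" for x :: "int \<Rightarrow> nat"
  have "e ` points V \<subseteq> Collect finite"
    by (auto simp: e_def points_def)
  then have "countable (e ` points V)"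
    by (rule countable_subset) (rule countable_Collect_finite)
  moreover have "inj_on e (points V)"
  proof
    fix x y assume "e x = e y"
    then have "(l, x l) \<in> e x \<longleftrightarrow> (l, x l) \<in> e y" "(l, y l) \<in> e x \<longleftrightarrow> (l, y l) \<in> e y" for l
      by simp_all
    then have "x l = y l" for l
      unfolding e_def by (cases "x l = 0"; cases "y l = 0") fastforce+
    then show "x = y" by blast
  qed
  ultimately show ?thesis by (rule countable_image_inj_on)
qed

lemma first_diff_exists:
  assumes "x \<in> points V" "y \<in> points V" "x \<noteq> y"
  shows "\<exists>l. first_diff x y l"
proof -
  let ?D = "{l. x l \<noteq> y l}"
  have "?D \<subseteq> {l. x l \<noteq> 0} \<union> {l. y l \<noteq> 0}" by auto
  then have fin: "finite ?D"
    by (rule finite_subset) (use assms in \<open>simp add: points_def\<close>)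
  have ne: "?D \<noteq> {}" using assms(3) by auto
  have "first_diff x y (Min ?D)"
    unfolding first_diff_def using Min_in[OF fin ne] Min_le[OF fin] by fastforce
  then show ?thesis by blast
qed

lemma points_upd: "x \<in> points V \<Longrightarrow> l \<noteq> 0 \<Longrightarrow> x(l := k) \<in> points V"
proof -
  assume x: "x \<in> points V" "l \<noteq> 0"
  have "{k'. (x(l := k)) k' \<noteq> 0} \<subseteq> insert l {l. x l \<noteq> 0}" by auto
  then have fin: "finite {k'. (x(l := k)) k' \<noteq> 0}"
    by (rule finite_subset) (use x(1) in \<open>simp add: points_def\<close>)
  have "(x(l := k)) 0 \<in> V" using x by (simp add: points_def)
  with fin show ?thesis unfolding points_def by (intro CollectI conjI)
qed

context
  fixes V :: "nat set" and g :: "nat \<Rightarrow> nat \<Rightarrow> atom"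
  assumes g: "gallai V g" and inj: "\<And>u v. u \<in> V \<Longrightarrow> v \<in> V \<Longrightarrow> g u v = Idt \<Longrightarrow> u = v"
begin

lemma points_0: "x \<in> points V \<Longrightarrow> x 0 \<in> V"
  by (simp add: points_def)

lemma level_Idt:
  assumes "x \<in> points V" "y \<in> points V"
  shows "level g l (x l) (y l) = Idt \<longleftrightarrow> x l = y l"
proof (cases "l = 0")
  case True
  then show ?thesis
    using inj[OF assms[THEN points_0]] gallai_refl[OF g points_0[OF assms(2)]] by (auto simp: level_def)
qed (simp add: level_def)

lemma level_sym:
  assumes "x \<in> points V" "y \<in> points V"
  shows "level g l (x l) (y l) = level g l (y l) (x l)"
proof (cases "l = 0")
  case True
  show ?thesis
    unfolding True level_0 by (rule gallai_sym[OF g assms[THEN points_0]])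
qed (auto simp: level_def)

lemma level_triangle:
  assumes "x \<in> points V" "y \<in> points V" "z \<in> points V"
  shows "atom_le_comp (level g l (x l) (z l)) (level g l (x l) (y l)) (level g l (y l) (z l))"
proof (cases "l = 0")
  case True
  show ?thesis
    unfolding True level_0 by (rule gallai_triangle[OF g assms[THEN points_0]])
qed (simp add: level_def atom_le_comp_def)

lemma colour_Idt:
  assumes "x \<in> points V" "y \<in> points V"
  shows "colour g x y = Idt \<longleftrightarrow> x = y"
proof (cases "x = y")
  case False
  then obtain l where l: "first_diff x y l"
    using first_diff_exists[OF assms] by blast
  then show ?thesis
    using False level_Idt[OF assms] colour_first_diff[OF l, of g] by (simp add: first_diff_def)
qed (simp add: colour_def)

lemma colour_sym:
  assumes "x \<in> points V" "y \<in> points V"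
  shows "colour g x y = colour g y x"
proof (cases "x = y")
  case False
  then obtain l where l: "first_diff x y l"
    using first_diff_exists[OF assms] by blast
  then show ?thesis
    using level_sym[OF assms] colour_first_diff[OF l, of g]
      colour_first_diff[OF first_diff_sym[THEN iffD1, OF l], of g] by (simp only:)
qed simp

text \<open>The least of the three levels of first difference occurs at least twice. If exactly
  twice, those two edges agree; if all three levels coincide, that level itself contains no rainbow
  triangle.\<close>

lemma colour_triangle:
  assumes V: "x \<in> points V" "y \<in> points V" "z \<in> points V"
  shows "atom_le_comp (colour g x z) (colour g x y) (colour g y z)"
proof -
  consider "x = y" | "y = z" | "x = z" | "x \<noteq> y" "y \<noteq> z" "x \<noteq> z" by blast
  then show ?thesis
  proof cases
    case 4
    obtain k l m where klm: "first_diff x y k" "first_diff y z l" "first_diff x z m"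
      using first_diff_exists[OF V(1,2) 4(1)] first_diff_exists[OF V(2,3) 4(2)]
        first_diff_exists[OF V(1,3) 4(3)] by blast
    have nI: "colour g x y \<noteq> Idt" "colour g y z \<noteq> Idt" "colour g x z \<noteq> Idt"
      using colour_Idt V 4 by auto
    consider "k < l" "m = k" | "l < k" "m = l" | "k = l" "k < m" | "k = l" "m = k"
    proof -
      have "first_diff x z k" if "k < l"
        unfolding first_diff_def
      proof (intro conjI allI impI)
        show "x k \<noteq> z k" using klm(1,2) that unfolding first_diff_def by metis
        show "x j = z j" if "j < k" for j
          using klm(1,2) that \<open>k < l\<close> unfolding first_diff_def by simp
      qed
      moreover have "first_diff x z l" if "l < k"
        unfolding first_diff_def
      proof (intro conjI allI impI)
        show "x l \<noteq> z l" using klm(1,2) that unfolding first_diff_def by metis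
        show "x j = z j" if "j < l" for j
          using klm(1,2) that \<open>l < k\<close> unfolding first_diff_def by simp
      qed
      moreover have "\<not> m < k" if "k = l"
        using klm that unfolding first_diff_def by metis
      ultimately show ?thesis
        using that first_diff_unique[OF klm(3)] linorder_cases[of k l] linorder_cases[of m k] by blast
    qed
    then have "colour g x z = colour g x y \<or> colour g x z = colour g y z \<or> colour g x y = colour g y z \<or>
      k = l \<and> m = k"
    proof cases
      case 1
      then have "y k = z k" using klm(2) by (simp add: first_diff_def)
      then show ?thesis
        using colour_first_diff[OF klm(1), of g] colour_first_diff[OF klm(3), of g] 1 by simp
    next
      case 2
      then have "x l = y l" using klm(1) by (simp add: first_diff_def)
      then show ?thesis
        using colour_first_diff[OF klm(2), of g] colour_first_diff[OF klm(3), of g] 2 by simp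
    next
      case 3
      then have "x k = z k" using klm(3) by (simp add: first_diff_def)
      then have "colour g x y = level g k (z k) (y k)"
        using colour_first_diff[OF klm(1), of g] by simp
      also have "\<dots> = level g k (y k) (z k)"
        by (rule level_sym[OF V(3,2)])
      also have "\<dots> = colour g y z"
        using colour_first_diff[OF klm(2), of g] 3 by simp
      finally show ?thesis by simp
    qed simp
    then show ?thesis
    proof (elim disjE conjE)
      assume "k = l" "m = k"
      then show ?thesis
        using level_triangle[OF V, of k] colour_first_diff[OF klm(1), of g]
          colour_first_diff[OF klm(2), of g] colour_first_diff[OF klm(3), of g] by simp
    qed (use nI in \<open>auto simp: atom_le_comp_def\<close>)
  next
    case 1
    then show ?thesis using colour_Idt[OF V(1,2)] by (simp add: atom_le_comp_def)
  next
    case 2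
    then show ?thesis using colour_Idt[OF V(2,3)] by (simp add: atom_le_comp_def)
  next
    case 3
    then show ?thesis using colour_Idt[OF V(1,3)] colour_sym[OF V(1,2)] by (simp add: atom_le_comp_def)
  qed
qed

lemma colour_upd:
  assumes x: "x \<in> points V" and l: "l \<noteq> 0" "k \<noteq> x l" and xy: "\<forall>j<l. x j = y j" "k \<noteq> y l"
  shows "colour g (x(l := k)) y = level_colour l" "colour g y (x(l := k)) = level_colour l"
proof -
  have "first_diff (x(l := k)) y l" "first_diff y (x(l := k)) l"
    using xy by (auto simp: first_diff_def)
  then show "colour g (x(l := k)) y = level_colour l" "colour g y (x(l := k)) = level_colour l"
    using colour_first_diff[of _ _ l g] xy(2) l(1) by (auto simp: level_def)
qed

lemma colour_upd_later:
  assumes "first_diff x y m" "m < l"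
  shows "colour g x (y(l := k)) = colour g x y"
proof -
  have "first_diff x (y(l := k)) m" using assms by (auto simp: first_diff_def)
  from colour_first_diff[OF this, of g] colour_first_diff[OF assms(1), of g] show ?thesis
    using assms(2) by simp
qed

text \<open>If one of \<open>p\<close>, \<open>q\<close> is the colour of \<open>x\<close> and
  \<open>y\<close>, change an endpoint at a later level of the other colour. If
  \<open>p = q\<close>, change \<open>x\<close> at an earlier level of that colour, where it then
  differs from \<open>x\<close> and \<open>y\<close> alike. This is why each colour must recur in
  both directions.\<close>

lemma extendable_points: "extendable (points V) (colour g)"
  unfolding extendable_def
proof (intro conjI ballI allI impI)
  fix x y p q assume xy: "x \<in> points V" "y \<in> points V"
  show "x = y" if "colour g x y = Idt" using that colour_Idt[OF xy] by simp
  assume pq: "atom_le_comp (colour g x y) p q"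
  have refl: "colour g x x = Idt" "colour g y y = Idt"
    by (simp_all add: colour_def)
  show "\<exists>z\<in>points V. colour g x z = p \<and> colour g z y = q"
  proof (cases "p = Idt \<or> q = Idt")
    case True
    then show ?thesis
    proof
      assume "p = Idt"
      then have "colour g x y = q" using pq by (simp add: atom_le_comp_def)
      with \<open>p = Idt\<close> refl xy show ?thesis by (intro bexI[of _ x]) simp_all
    next
      assume "q = Idt"
      then have "colour g x y = p" using pq by (simp add: atom_le_comp_def split: if_splits)
      with \<open>q = Idt\<close> refl xy show ?thesis by (intro bexI[of _ y]) simp_all
    qed
  next
    case False
    show ?thesis
    proof (cases "x = y")
      case True
      then have "p = q"
        using pq False refl by (simp add: atom_le_comp_def)
      obtain l where l: "l \<noteq> 0" "level_colour l = p"
        using level_colour_cofinal[of p 0] False by blast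
      let ?z = "x(l := Suc (x l))"
      have "colour g x ?z = level_colour l"
        by (rule colour_upd(2)) (use xy l in simp_all)
      moreover have "colour g ?z y = level_colour l"
        by (rule colour_upd(1)) (use xy l True in simp_all)
      ultimately show ?thesis
        using l(2) \<open>p = q\<close> points_upd[OF xy(1) l(1)] by (intro bexI[of _ ?z] conjI) simp_all
    next
      case ne: False
      obtain m where m: "first_diff x y m"
        using first_diff_exists[OF xy ne] by blast
      have "colour g x y \<noteq> Idt" using colour_Idt[OF xy] ne by simp
      then have "p = colour g x y \<or> q = colour g x y \<or> p = q"
        using pq False by (auto simp: atom_le_comp_def)
      then show ?thesis
      proof (elim disjE)
        assume p: "p = colour g x y"
        obtain l where l: "m < l" "l \<noteq> 0" "level_colour l = q"
          using level_colour_cofinal[of q m] False by blast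
        let ?z = "y(l := Suc (y l))"
        have "colour g x ?z = p"
          unfolding p by (rule colour_upd_later[OF m l(1)])
        moreover have "colour g ?z y = level_colour l"
          by (rule colour_upd(1)) (use xy l in simp_all)
        ultimately show ?thesis
          using l(3) points_upd[OF xy(2) l(2)] by (intro bexI[of _ ?z] conjI) simp_all
      next
        assume q: "q = colour g x y"
        obtain l where l: "m < l" "l \<noteq> 0" "level_colour l = p"
          using level_colour_cofinal[of p m] False by blast
        let ?z = "x(l := Suc (x l))"
        have z: "?z \<in> points V" by (rule points_upd[OF xy(1) l(2)])
        have "first_diff y x m" using m first_diff_sym by blast
        from colour_upd_later[OF this l(1), of "Suc (x l)"] have "colour g ?z y = q"
          unfolding q using colour_sym[OF xy] colour_sym[OF xy(2) z] by simp
        moreover have "colour g x ?z = level_colour l"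
          by (rule colour_upd(2)) (use xy l in simp_all)
        ultimately show ?thesis
          using l(3) z by (intro bexI[of _ ?z] conjI) simp_all
      next
        assume "p = q"
        obtain l where l: "l < m" "l \<noteq> 0" "level_colour l = p"
          using level_colour_cofinal[of p m] False by blast
        let ?z = "x(l := Suc (x l))"
        have eq: "\<forall>j<l. x j = y j" "x l = y l" using m l(1) unfolding first_diff_def by simp_all
        have "colour g x ?z = level_colour l"
          by (rule colour_upd(2)) (use xy l in simp_all)
        moreover have "colour g ?z y = level_colour l"
          by (rule colour_upd(1)) (use xy l eq in simp_all)
        ultimately show ?thesis
          using l(3) \<open>p = q\<close> points_upd[OF xy(1) l(2)] by (intro bexI[of _ ?z] conjI) simp_all
      qed
    qed
  qed
qed

lemma gallai_points: "gallai (points V) (colour g)"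
  unfolding gallai_def
proof (intro conjI ballI)
  show "colour g x x = Idt" for x by (simp add: colour_def)
qed (rule colour_sym colour_triangle; assumption)+

end

text \<open>Identified vertices are replaced by a common representative. A representative
  \<open>v\<close> becomes the point with \<open>v\<close> at level \<open>0\<close> and
  \<open>0\<close> elsewhere; two such points first differ at level \<open>0\<close>, where their
  colour is that of \<open>g\<close>.\<close>

lemma gallai_satisfiable:
  fixes W :: "nat set"
  assumes g: "gallai W g" and gf: "\<And>x y. x \<in> W \<Longrightarrow> y \<in> W \<Longrightarrow> g x y \<in> f x y"
  shows "ra_24_65.satisfiable (U :: nat itself) W f"
proof -
  \<comment> \<open>The least choice depends only on the set of vertices identified with
    \<open>x\<close>, so identified vertices share it.\<close>
  define r where "r x = (LEAST y. y \<in> W \<and> g x y = Idt)" for x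
  have r: "r x \<in> W \<and> g x (r x) = Idt" if "x \<in> W" for x
    unfolding r_def
    by (rule LeastI[of "\<lambda>y. y \<in> W \<and> g x y = Idt" x]) (use that gallai_refl[OF g that] in simp)
  then have rW: "r x \<in> W" and rI: "g x (r x) = Idt" if "x \<in> W" for x using that by blast+
  have gr: "g (r x) (r y) = g x y" if "x \<in> W" "y \<in> W" for x y
  proof -
    have "g (r x) (r y) = g x (r y)"
      by (rule gallai_Idt[OF g that(1) rW[OF that(1)] rW[OF that(2)] rI[OF that(1)], symmetric])
    also have "\<dots> = g (r y) x"
      by (rule gallai_sym[OF g that(1) rW[OF that(2)]])
    also have "\<dots> = g y x"
      by (rule gallai_Idt[OF g that(2) rW[OF that(2)] that(1) rI[OF that(2)], symmetric])
    also have "\<dots> = g x y"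
      by (rule gallai_sym[OF g that(2,1)])
    finally show ?thesis .
  qed
  have r_eq: "r x = r y" if "x \<in> W" "y \<in> W" "g x y = Idt" for x y
  proof -
    have "(z \<in> W \<and> g x z = Idt) = (z \<in> W \<and> g y z = Idt)" for z
      using gallai_Idt[OF g that(1,2) _ that(3), of z] by (cases "z \<in> W") simp_all
    then show ?thesis unfolding r_def by (simp only:)
  qed
  define V where "V = r ` W"
  have gV: "gallai V g"
    by (rule gallai_subset[OF g]) (use rW in \<open>auto simp: V_def\<close>)
  have inj: "u = v" if uv: "u \<in> V" "v \<in> V" "g u v = Idt" for u v
  proof -
    obtain x y where xy: "x \<in> W" "u = r x" "y \<in> W" "v = r y"
      using uv(1,2) unfolding V_def by blast
    then have "g x y = Idt" using gr[OF xy(1,3)] uv(3) by simp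
    then show ?thesis using r_eq xy by blast
  qed
  define P where "P = points V"
  define e where "e = to_nat_on P"
  define d where "d = inv_into P e"
  have inj_e: "inj_on e P"
    unfolding e_def by (rule inj_on_to_nat_on) (simp add: P_def countable_points)
  have de: "d (e x) = x" if "x \<in> P" for x
    unfolding d_def by (rule inv_into_f_f[OF inj_e that])
  have bij: "bij_betw d (e ` P) P"
    unfolding d_def by (rule bij_betw_inv_into) (rule inj_on_imp_bij_betw[OF inj_e])
  have "gallai P (colour g)"
    unfolding P_def by (rule gallai_points[OF gV]) (rule inj)
  moreover have "d ` e ` P \<subseteq> P"
    using bij by (simp only: bij_betw_def)
  ultimately have gP: "gallai (e ` P) (\<lambda>x y. colour g (d x) (d y))"
    by (rule gallai_comap)
  have "extendable P (colour g)"
    unfolding P_def by (rule extendable_points[OF gV]) (rule inj)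
  from this bij have eP: "extendable (e ` P) (\<lambda>x y. colour g (d x) (d y))"
    by (rule extendable_comap)
  define R where "R X = {(x, y). x \<in> e ` P \<and> y \<in> e ` P \<and> colour g (d x) (d y) \<in> X}" for X
  have rep: "ra_24_65.representation (e ` P) R"
    unfolding R_def by (rule representation_extendable[OF gP eP])
  define pt where "pt v = (\<lambda>l::int. if l = 0 then v else 0 :: nat)" for v
  have pt: "pt v \<in> P" if "v \<in> V" for v
  proof -
    have "{l. pt v l \<noteq> 0} \<subseteq> {0}" by (auto simp: pt_def)
    then have fin: "finite {l. pt v l \<noteq> 0}"
      by (rule finite_subset) simp
    have "pt v 0 \<in> V" using that by (simp add: pt_def)
    with fin show ?thesis unfolding P_def points_def by (intro CollectI conjI)
  qed
  have col: "colour g (pt u) (pt v) = g u v" if "u \<in> V" "v \<in> V" for u v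
  proof (cases "u = v")
    case True
    then show ?thesis using gallai_refl[OF gV that(1)] by (simp add: colour_def)
  next
    case False
    then have "first_diff (pt u) (pt v) 0" by (auto simp: first_diff_def pt_def)
    from colour_first_diff[OF this, of g] show ?thesis by (simp add: level_def pt_def)
  qed
  have rP: "pt (r x) \<in> P" if "x \<in> W" for x
    by (rule pt) (use that in \<open>simp add: V_def\<close>)
  show ?thesis
    unfolding ra_24_65.satisfiable_def
  proof (intro exI conjI ballI)
    show "ra_24_65.representation (e ` P) R"
      by (rule rep)
    show "(\<lambda>x. e (pt (r x))) ` W \<subseteq> e ` P" using rP by blast
    show "(e (pt (r x)), e (pt (r y))) \<in> R (f x y)" if xy: "x \<in> W" "y \<in> W" for x y
    proof -
      have "r x \<in> V" "r y \<in> V" using xy by (simp_all add: V_def)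
      then have "colour g (d (e (pt (r x)))) (d (e (pt (r y)))) = g x y"
        using de[OF rP[OF xy(1)]] de[OF rP[OF xy(2)]] col gr[OF xy] by simp
      then show ?thesis
        using gf[OF xy] rP[OF xy(1)] rP[OF xy(2)] unfolding R_def by simp
    qed
  qed
qed

section \<open>The encoding of networks\<close>

lemma concat_uniform:
  assumes "\<And>i. i < n \<Longrightarrow> length (h i) = m"
  shows "length (concat (map h [0..<n])) = n * m"
    and "i < n \<Longrightarrow> j < m \<Longrightarrow> concat (map h [0..<n]) ! (i * m + j) = h i ! j"
  using assms
proof (induction n)
  case (Suc n)
  { case 1
    then show ?case using Suc.IH(1) by simp
  next
    case 2
    have len: "length (concat (map h [0..<n])) = n * m" using Suc.IH(1) 2 by simp
    show ?case
    proof (cases "i < n")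
      case True
      have "i * m + j < Suc i * m" using 2(2) by simp
      also have "\<dots> \<le> n * m" using True by (intro mult_le_mono1) simp
      finally show ?thesis using Suc.IH(2) 2 True len by (simp add: nth_append)
    next
      case False
      then have "i = n" using 2 by simp
      then show ?thesis using len by (simp add: nth_append)
    qed
  }
qed simp_all

definition labels :: "bool list \<Rightarrow> nat \<Rightarrow> nat \<Rightarrow> nat \<Rightarrow> atom set" where
  "labels w n x y = (let b = \<lambda>k. input_bit w (entry_pos n x y + k) in
     (if b 0 then {Idt} else {}) \<union> (if b 1 then {At_a} else {}) \<union>
     (if b 2 then {At_b} else {}) \<union> (if b 3 then {At_c} else {}))"

lemma leading_encode: "leading (replicate n True @ False # r) = n"
  unfolding leading_def by (induction n) simp_all

lemma encode_rows:
  defines "h f n i \<equiv> concat (map (\<lambda>j. encode_label (f i j)) [0..<n])"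
  shows "length (concat (map (h f n) [0..<n])) = 4 * (n * n)"
    and "x < n \<Longrightarrow> y < n \<Longrightarrow> k < 4 \<Longrightarrow>
      concat (map (h f n) [0..<n]) ! (4 * (x * n + y) + k) = encode_label (f x y) ! k"
proof -
  have row: "length (h f n i) = n * 4" for i
    unfolding h_def by (rule concat_uniform) (simp add: encode_label_def)
  then show "length (concat (map (h f n) [0..<n])) = 4 * (n * n)"
    using concat_uniform(1)[of n "h f n" "n * 4"] by simp
  assume *: "x < n" "y < n" "k < 4"
  have "y * 4 + k < Suc y * 4" using *(3) by simp
  also have "\<dots> \<le> n * 4" using *(2) by (intro mult_le_mono1) simp
  finally have "concat (map (h f n) [0..<n]) ! (x * (n * 4) + (y * 4 + k)) = h f n x ! (y * 4 + k)"
    using concat_uniform(2)[of n "h f n" "n * 4"] row *(1) by blast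
  also have "\<dots> = encode_label (f x y) ! k"
    unfolding h_def by (rule concat_uniform(2)) (use * in \<open>simp_all add: encode_label_def\<close>)
  finally show "concat (map (h f n) [0..<n]) ! (4 * (x * n + y) + k) = encode_label (f x y) ! k"
    by (simp add: algebra_simps)
qed

lemma length_encode: "length (encode_network n f) = Suc n + 4 * (n * n)"
  unfolding encode_network_def using encode_rows(1)[of f n] by simp

lemma nth_encode:
  assumes "x < n" "y < n" "k < 4"
  shows "encode_network n f ! (entry_pos n x y + k) = encode_label (f x y) ! k"
    "entry_pos n x y + k < length (encode_network n f)"
proof -
  show "encode_network n f ! (entry_pos n x y + k) = encode_label (f x y) ! k"
    using encode_rows(2)[OF assms, of f] unfolding encode_network_def entry_pos_def
    by (simp add: nth_append add.assoc)
  have "x * n + y < Suc x * n" using assms(2) by simp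
  also have "\<dots> \<le> n * n" using assms(1) by (intro mult_le_mono1) simp
  finally have "x * n + y < n * n" .
  moreover have "Suc n + 4 * a + k < Suc n + 4 * b" if "a < b" for a b
    using that assms(3) by simp
  ultimately show "entry_pos n x y + k < length (encode_network n f)"
    unfolding length_encode entry_pos_def by blast
qed

lemma labels_encode:
  assumes "x < n" "y < n"
  shows "labels (encode_network n f) n x y = f x y"
proof -
  have b: "input_bit (encode_network n f) (entry_pos n x y + k) = encode_label (f x y) ! k" if "k < 4" for k
    using nth_encode[OF assms that, of f] by (simp add: input_bit_def)
  have "p \<in> labels (encode_network n f) n x y \<longleftrightarrow> p \<in> f x y" for p
    unfolding labels_def Let_def using b[of 0] b[of 1] b[of 2] b[of 3]
    by (cases p) (simp_all add: encode_label_def)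
  then show ?thesis by blast
qed

text \<open>Every word of the right length is an encoding, so membership requires no further check
  of the syntax.\<close>

lemma encode_labels:
  assumes "n = leading w" "length w = Suc n + 4 * (n * n)"
  shows "encode_network n (labels w n) = w"
proof (rule nth_equalityI)
  show "length (encode_network n (labels w n)) = length w"
    using assms(2) length_encode by simp
  fix i assume "i < length (encode_network n (labels w n))"
  then have i: "i < Suc n + 4 * (n * n)" unfolding length_encode .
  consider "i < n" | "i = n" | "n < i" by linarith
  then show "encode_network n (labels w n) ! i = w ! i"
  proof cases
    case 1
    then show ?thesis
      using input_bit_leading(1)[of i w] assms(1) by (simp add: encode_network_def nth_append input_bit_def)
  next
    case 2
    then show ?thesis
      using input_bit_leading(2)[of w] assms i by (simp add: encode_network_def nth_append input_bit_def)
  next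
    case 3
    define t where "t = i - Suc n"
    define c where "c = t div 4"
    define k where "k = t mod 4"
    have t: "i = Suc n + t" "t < 4 * (n * n)" using 3 i by (simp_all add: t_def)
    have c: "c < n * n" "t = 4 * c + k" "k < 4"
      using t(2) by (simp_all add: c_def k_def less_mult_imp_div_less mult.commute)
    have "0 < n" using c(1) by (cases n) auto
    then have xy: "c div n < n" "c mod n < n"
      using c(1) by (simp_all add: less_mult_imp_div_less)
    have pos: "entry_pos n (c div n) (c mod n) + k = i"
      unfolding entry_pos_def div_mult_mod_eq using t(1) c(2) by simp
    have "encode_label (labels w n (c div n) (c mod n)) ! k = input_bit w (entry_pos n (c div n) (c mod n) + k)"
      using c(3) unfolding labels_def Let_def encode_label_def
      by (auto simp: less_Suc_eq numeral_eq_Suc nth_Cons')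
    then show ?thesis
      using nth_encode(1)[OF xy c(3), of "labels w n"] i assms(2) unfolding pos by (simp add: input_bit_def)
  qed
qed

text \<open>\<open>eqv\<close> is \<open>True\<close> everywhere: the algorithm starts with a single
  class.\<close>

definition load_ini :: "bool \<Rightarrow> cell" where
  "load_ini d = Cell d {} True False {}"

definition load_upd :: "nat \<Rightarrow> bool \<Rightarrow> cell \<Rightarrow> cell" where
  "load_upd k b m =
     Cell (dg m) (if b then insert ([Idt, At_a, At_b, At_c] ! k) (lb m) else lb m) (eqv m) (mrg m) (bad m)"

lemma load_cells:
  "dg (load load_ini load_upd w x y) \<longleftrightarrow> x = y" "eqv (load load_ini load_upd w x y)"
  "lb (load load_ini load_upd w x y) = labels w (leading w) x y"
  by (auto simp: load_def load_upd_def load_ini_def labels_def Let_def numeral_2_eq_2 numeral_3_eq_3)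

section \<open>Assembly of the decision procedure\<close>

lemma NSP_iff:
  "w \<in> NSP_24_65 TYPE(nat) \<longleftrightarrow> length w = Suc (leading w) + 4 * (leading w * leading w) \<and>
     (\<exists>g. gallai {..<leading w} g \<and>
        (\<forall>x<leading w. \<forall>y<leading w. g x y \<in> labels w (leading w) x y))" (is "_ \<longleftrightarrow> ?R")
proof
  assume "w \<in> NSP_24_65 TYPE(nat)"
  then obtain n f where w: "w = encode_network n f" and sat: "ra_24_65.satisfiable TYPE(nat) {..<n} f"
    unfolding NSP_24_65_def by blast
  have n: "leading w = n" unfolding w encode_network_def by (rule leading_encode)
  obtain g where "gallai {..<n} g" "\<forall>x\<in>{..<n}. \<forall>y\<in>{..<n}. g x y \<in> f x y"
    using satisfiable_gallai[OF sat] by blast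
  then show ?R
    unfolding n using length_encode[of n f] labels_encode[of _ n _ f] w by auto
next
  assume R: ?R
  then obtain g where g: "gallai {..<leading w} g"
    "\<forall>x<leading w. \<forall>y<leading w. g x y \<in> labels w (leading w) x y" by blast
  have "ra_24_65.satisfiable TYPE(nat) {..<leading w} (labels w (leading w))"
    by (rule gallai_satisfiable[OF g(1)]) (use g(2) in auto)
  moreover have "encode_network (leading w) (labels w (leading w)) = w"
    by (rule encode_labels) (use R in auto)
  ultimately show "w \<in> NSP_24_65 TYPE(nat)"
    unfolding NSP_24_65_def by (metis (mono_tags, lifting) mem_Collect_eq)
qed

lemma in_P_NSP: "in_P (NSP_24_65 TYPE(nat))"
proof (rule in_P_sweep)
  fix w
  have "diagonal (leading w) (load load_ini load_upd w)"
    by (simp add: diagonal_def load_cells)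
  from main_prog_correct[OF this load_cells(3) load_cells(2)]
  show "w \<in> NSP_24_65 TYPE(nat) \<longleftrightarrow> length w = Suc (leading w) + 4 * (leading w * leading w) \<and>
    (\<forall>x<leading w. \<forall>y<leading w. (\<lambda>m. eqv m \<longrightarrow> Idt \<in> lb m)
      (sem (leading w) main_prog (load load_ini load_upd w) x y))"
    unfolding NSP_iff by (simp only:)
qed

text \<open>The detour through colourings replaces a representation of any size by a countable
  one.\<close>

lemma NSP_subset: "NSP_24_65 (U :: 'u itself) \<subseteq> NSP_24_65 TYPE(nat)"
proof
  fix w assume "w \<in> NSP_24_65 U"
  then obtain n f where w: "w = encode_network n f" and sat: "ra_24_65.satisfiable U {..<n} f"
    unfolding NSP_24_65_def by blast
  obtain g where g: "gallai {..<n} g" "\<forall>x\<in>{..<n}. \<forall>y\<in>{..<n}. g x y \<in> f x y"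
    using satisfiable_gallai[OF sat] by blast
  have "ra_24_65.satisfiable TYPE(nat) {..<n} f"
    by (rule gallai_satisfiable[OF g(1)]) (use g(2) in auto)
  then show "w \<in> NSP_24_65 TYPE(nat)"
    unfolding NSP_24_65_def w by blast
qed

(* HOL cannot quantify over types inside a formula. The second conjunct says that representations
   with domain in an arbitrary type 'u yield no further satisfiable networks, so the language in the
   first conjunct is the network satisfaction problem over representations of any size. *)
theorem proposition6p23:
  "in_P (NSP_24_65 TYPE(nat)) \<and> NSP_24_65 TYPE('u) \<subseteq> NSP_24_65 TYPE(nat)"
  using in_P_NSP NSP_subset by blast

end
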